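(* Let $d\ge1$, $\Omega=(0,1)^d$, and let $\Psi=\{\psi_\lambda:\lambda\in\mathcal J\}$ be the tensor product wavelet system on $\Omega$ constructed in the context. Then: a) The functions $\psi_\lambda$ are ($d$-variate tensor product) cubic splines belonging to $C^1(\Omega)$. b) $\Psi$ is an orthogonal basis of $L^2(\Omega)$. c) $\langle p,\psi_\lambda\rangle=0$ for every polynomial $p$ of degree less than $4$ and every $\lambda=(\lambda_1,\dots,\lambda_d)$ with $\lambda_i=(j_i,k_i)$, $3\le k_i\le6\cdot2^{j_i}-2$; i.e. inner wavelets have four vanishing moments. d) There is a constant $C$ such that $\operatorname{diam}\operatorname{supp}\psi_\lambda\le C\sqrt d\,2^{-[\lambda]}$ for all $\lambda$, where $[\lambda]=\min_{i=1,\dots,d}|\lambda_i|$.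
   Context: Real line construction. $\langle\cdot,\cdot\rangle$, $\|\cdot\|$ are $L^2$ inner products and norms (on $\mathbb R$, $(0,1)$ or $\Omega$ as appropriate); $\mathcal X\ominus\mathcal Y$ is the $L^2$-orthogonal complement of $\mathcal Y$ in $\mathcal X$. $\xi_1(x)=(x+1)^2(1-2x)$ on $[-1,0]$, $(1-x)^2(1+2x)$ on $[0,1]$, $0$ otherwise; $\xi_2(x)=(x+1)^2x$ on $[-1,0]$, $(1-x)^2x$ on $[0,1]$, $0$ otherwise; $\xi_{j,2k+l-1}(x)=2^{j/2}\xi_l(2^jx-k)$, $l=1,2$. $\phi_1=\xi_{1,2}/\|\xi_{1,2}\|$, $\phi_2=\xi_{1,3}/\|\xi_{1,3}\|$. $\mathcal A_0=\operatorname{span}\{\xi_{1,2},\xi_{1,3}\}$, $\mathcal A_1=\operatorname{span}\{\xi_{2,k}:k=2,\dots,7\}$, $\mathcal B_0=\operatorname{span}(\{\xi_{1,0}\chi_{[0,1]},\xi_{1,1}\chi_{[0,1]}\}\cup\mathcal A_0)$, $\mathcal B_1=\operatorname{span}(\{\xi_{1,4}\chi_{[0,1]},\xi_{1,5}\chi_{[0,1]}\}\cup\mathcal A_0)$, $\mathcal C_h=\mathcal B_h\ominus\mathcal A_0$. $\phi_3,\phi_4$ form an orthonormal basis of a two-dimensional subspace $W\subset\mathcal A_1\ominus\mathcal A_0$ with $(I-P_W)\mathcal C_0\perp(I-P_W)\mathcal C_1$ ($P_W$ orthogonal projection). $g_5=\xi_{1,0}-\sum_{j=1}^4\langle\xi_{1,0},\phi_j\rangle\phi_j-\sum_{j=1}^4\langle\xi_{1,0},\phi_j(\cdot+1)\rangle\phi_j(\cdot+1)$,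 $\phi_5=g_5/\|g_5\|$; $g_6=\xi_{1,1}-\sum_{j=1}^5\langle\xi_{1,1},\phi_j\rangle\phi_j-\sum_{j=1}^5\langle\xi_{1,1},\phi_j(\cdot+1)\rangle\phi_j(\cdot+1)$, $\phi_6=g_6/\|g_6\|$. Write $\phi^{\mathbb R}_{j,6k+l}(x)=2^{j/2}\phi_l(2^jx-k)$ for $l=1,\dots,4$ and $\phi^{\mathbb R}_{j,6k+l}(x)=2^{j/2}\phi_l(2^jx-k-1)$ for $l=5,6$. Wavelet generators: $\psi_1,\psi_2$ form an orthonormal basis of the space of all $f\in\operatorname{span}\{\phi_k(2\cdot),k=1,\dots,4;\ \phi_k(2\cdot-1),k=1,\dots,6\}$ orthogonal to $\phi_1,\dots,\phi_6,\phi_5(\cdot-1),\phi_6(\cdot-1)$ (taken to be two-dimensional). With $h_i=\phi_{i+4}(2\cdot)-\langle\phi_{i+4}(2\cdot),\phi_5\rangle\phi_5-\langle\phi_{i+4}(2\cdot),\phi_6\rangle\phi_6$, $i=1,2$, the functions $\psi_3,\psi_4$ are obtained from $h_1,h_2$ by Gram--Schmidt orthonormalization. $\psi_5,\psi_6$ form an orthonormal basis of the (two-dimensional) space of all $f\in\operatorname{span}\{\phi^{\mathbb R}_{1,k}:k=-11,\dots,10\}$ orthogonal to $\phi^{\mathbb R}_{0,k}$ ($k=-7,\dots,6$), $\psi_1(\cdot+1),\psi_2(\cdot+1)$, $\psi_1,\dots,\psi_4$. Write $\psi^{\mathbb R}_{j,6k+l}(x)=2^{j/2}\psi_l(2^jx-k)$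 for $l=1,2$ and $\psi^{\mathbb R}_{j,6k+l}(x)=2^{j/2}\psi_l(2^jx-k-1)$ for $l=3,\dots,6$. Interval construction. $\phi_L$ is the $L^2$-normalization of $(\phi_6(0)\phi_5-\phi_5(0)\phi_6)\chi_{[0,1]}$ and $\phi_R$ that of $(\phi_6(0)\phi_5(\cdot-1)-\phi_5(0)\phi_6(\cdot-1))\chi_{[0,1]}$. $\psi_{L_1},\psi_{L_2}$ form an orthonormal basis of the space of functions $g=\sum_{j=1}^4b_j\psi_{j+2}\chi_{[0,1]}$ with $\sum_jb_j\psi_{j+2}(0)=0$ and $\langle\phi_L,g\rangle=0$; $\psi_{R_1},\psi_{R_2}$ form an orthonormal basis of the space of functions $g=\sum_{j=1}^4c_j\psi_{j+2}(\cdot-1)\chi_{[0,1]}$ with $\sum_jc_j\psi_{j+2}(0)=0$ and $\langle\phi_R,g\rangle=0$; both spaces are taken to be two-dimensional in the construction. Set $\phi_{0,1}=\phi_L$, $\phi_{0,6}=\phi_R$, $\phi_{0,k}=\phi_{k-1}$ for $k=2,\dots,5$. For $j\ge0$: boundary wavelets $\psi_{j,i}=2^{j/2}\psi_{L_i}(2^j\cdot)$ and $\psi_{j,6\cdot2^j+i-2}=2^{j/2}\psi_{R_i}(2^j\cdot-2^j+1)$, $i=1,2$; inner wavelets $\psi_{j,n+2}=\psi^{\mathbb R}_{j,n}$ for $1\le n\le6\cdot2^j-4$. All functions are considered on $[0,1]$. Tensor product. Put $\psi_{0,k-6}=\phi_{0,k}$ for $k=1,\dots,6$, $\mathcal J_0=\{-5,\dots,6\}$,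 $\mathcal J_j=\{1,\dots,6\cdot2^j\}$ for $j\ge1$. $\mathcal J$ is the set of $\lambda=(\lambda_1,\dots,\lambda_d)$ with $\lambda_i=(j_i,k_i)$, $j_i\ge0$, $k_i\in\mathcal J_{j_i}$; $|\lambda_i|=j_i$ is the level; $\psi_\lambda(x)=\prod_{i=1}^d\psi_{\lambda_i}(x_i)$. *)

theory Defs
  imports "HOL-Analysis.Analysis"
begin

definition square_integrable :: "'a measure \<Rightarrow> ('a \<Rightarrow> real) \<Rightarrow> bool" where
  "square_integrable M f \<longleftrightarrow> f \<in> borel_measurable M \<and> integrable M (\<lambda>x. (f x)\<^sup>2)"

definition l2_inner :: "'a measure \<Rightarrow> ('a \<Rightarrow> real) \<Rightarrow> ('a \<Rightarrow> real) \<Rightarrow> real" where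
  "l2_inner M f g = (LINT x|M. f x * g x)"

definition l2_norm :: "'a measure \<Rightarrow> ('a \<Rightarrow> real) \<Rightarrow> real" where
  "l2_norm M f = sqrt (l2_inner M f f)"

definition orthogonal_basis :: "'a measure \<Rightarrow> 'i set \<Rightarrow> ('i \<Rightarrow> 'a \<Rightarrow> real) \<Rightarrow> bool" where
  "orthogonal_basis M I e \<longleftrightarrow>
     (\<forall>i\<in>I. square_integrable M (e i) \<and> l2_norm M (e i) \<noteq> 0) \<and>
     (\<forall>i\<in>I. \<forall>j\<in>I. i \<noteq> j \<longrightarrow> l2_inner M (e i) (e j) = 0) \<and>
     (\<forall>f. square_integrable M f \<longrightarrow>
        (\<forall>\<epsilon>>0. \<exists>F c. finite F \<and> F \<subseteq> I \<and> l2_norm M (\<lambda>x. f x - (\<Sum>i\<in>F. c i * e i x)) < \<epsilon>))"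

definition fspan :: "(real \<Rightarrow> real) set \<Rightarrow> (real \<Rightarrow> real) set" where
  "fspan S = {f. \<exists>A c. finite A \<and> A \<subseteq> S \<and> f = (\<lambda>x. \<Sum>g\<in>A. c g * g x)}"

definition l2_minus :: "(real \<Rightarrow> real) set \<Rightarrow> (real \<Rightarrow> real) set \<Rightarrow> (real \<Rightarrow> real) set"
    (infixl "\<ominus>" 65) where
  "X \<ominus> Y = {f \<in> X. \<forall>g\<in>Y. l2_inner lborel f g = 0}"

definition l2_normalize :: "(real \<Rightarrow> real) \<Rightarrow> real \<Rightarrow> real" where
  "l2_normalize f = (\<lambda>x. f x / l2_norm lborel f)"

text \<open>An orthonormal pair spanning the space \<open>V\<close>; in particular \<open>V\<close> is then two-dimensional.\<close>

definition orthonormal_basis2 ::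
    "(real \<Rightarrow> real) \<Rightarrow> (real \<Rightarrow> real) \<Rightarrow> (real \<Rightarrow> real) set \<Rightarrow> bool" where
  "orthonormal_basis2 u v V \<longleftrightarrow>
     l2_norm lborel u = 1 \<and> l2_norm lborel v = 1 \<and> l2_inner lborel u v = 0 \<and> V = fspan {u, v}"

text \<open>The projection is unique as a function (not just almost everywhere) if \<open>W\<close> is spanned by
  an orthonormal pair, the only case used below.\<close>

definition l2_proj :: "(real \<Rightarrow> real) set \<Rightarrow> (real \<Rightarrow> real) \<Rightarrow> real \<Rightarrow> real" where
  "l2_proj W f = (THE g. g \<in> W \<and> (\<forall>h\<in>W. l2_inner lborel (\<lambda>x. f x - g x) h = 0))"

definition dilate :: "nat \<Rightarrow> int \<Rightarrow> (real \<Rightarrow> real) \<Rightarrow> real \<Rightarrow> real" where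
  "dilate j k f = (\<lambda>x. 2 powr (real j / 2) * f (2 ^ j * x - of_int k))"

definition cut :: "(real \<Rightarrow> real) \<Rightarrow> real \<Rightarrow> real" where
  "cut f = (\<lambda>x. f x * indicator {0..1} x)"

definition xi_gen :: "nat \<Rightarrow> real \<Rightarrow> real" where
  "xi_gen l x =
     (if l = 1 then
        (if x \<in> {-1..0} then (x + 1)\<^sup>2 * (1 - 2 * x)
         else if x \<in> {0..1} then (1 - x)\<^sup>2 * (1 + 2 * x) else 0)
      else
        (if x \<in> {-1..0} then (x + 1)\<^sup>2 * x
         else if x \<in> {0..1} then (1 - x)\<^sup>2 * x else 0))"

text \<open>The index is \<open>n = 2 * k + l - 1\<close> with \<open>l \<in> {1, 2}\<close>.\<close>

definition \<xi> :: "nat \<Rightarrow> int \<Rightarrow> real \<Rightarrow> real" where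
  "\<xi> j n = dilate j (n div 2) (xi_gen (nat (n mod 2) + 1))"

definition A0 :: "(real \<Rightarrow> real) set" where
  "A0 = fspan {\<xi> 1 2, \<xi> 1 3}"

definition A1 :: "(real \<Rightarrow> real) set" where
  "A1 = fspan (\<xi> 2 ` {2..7})"

definition B0 :: "(real \<Rightarrow> real) set" where
  "B0 = fspan ({cut (\<xi> 1 0), cut (\<xi> 1 1)} \<union> A0)"

definition B1 :: "(real \<Rightarrow> real) set" where
  "B1 = fspan ({cut (\<xi> 1 4), cut (\<xi> 1 5)} \<union> A0)"

definition C0 :: "(real \<Rightarrow> real) set" where
  "C0 = B0 \<ominus> A0"

definition C1 :: "(real \<Rightarrow> real) set" where
  "C1 = B1 \<ominus> A0"

definition residual :: "(nat \<Rightarrow> real \<Rightarrow> real) \<Rightarrow> nat \<Rightarrow> (real \<Rightarrow> real) \<Rightarrow> real \<Rightarrow> real" where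
  "residual \<phi> m f = (\<lambda>x. f x
     - (\<Sum>j=1..m. l2_inner lborel f (\<phi> j) * \<phi> j x)
     - (\<Sum>j=1..m. l2_inner lborel f (\<lambda>y. \<phi> j (y + 1)) * \<phi> j (x + 1)))"

definition scaling_generators :: "(nat \<Rightarrow> real \<Rightarrow> real) \<Rightarrow> bool" where
  "scaling_generators \<phi> \<longleftrightarrow>
     \<phi> 1 = l2_normalize (\<xi> 1 2) \<and>
     \<phi> 2 = l2_normalize (\<xi> 1 3) \<and>
     (\<exists>W. W \<subseteq> A1 \<ominus> A0 \<and> orthonormal_basis2 (\<phi> 3) (\<phi> 4) W \<and>
        (\<forall>f\<in>C0. \<forall>g\<in>C1.
           l2_inner lborel (\<lambda>x. f x - l2_proj W f x) (\<lambda>x. g x - l2_proj W g x) = 0)) \<and>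
     \<phi> 5 = l2_normalize (residual \<phi> 4 (\<xi> 1 0)) \<and>
     \<phi> 6 = l2_normalize (residual \<phi> 5 (\<xi> 1 1))"

text \<open>In the following families the index is \<open>n = 6 * k + l\<close> with \<open>l \<in> {1..6}\<close>.\<close>

definition phiR :: "(nat \<Rightarrow> real \<Rightarrow> real) \<Rightarrow> nat \<Rightarrow> int \<Rightarrow> real \<Rightarrow> real" where
  "phiR \<phi> j n = (let k = (n - 1) div 6; l = nat ((n - 1) mod 6) + 1
     in dilate j (if l \<le> 4 then k else k + 1) (\<phi> l))"

definition psiR :: "(nat \<Rightarrow> real \<Rightarrow> real) \<Rightarrow> nat \<Rightarrow> int \<Rightarrow> real \<Rightarrow> real" where
  "psiR \<psi> j n = (let k = (n - 1) div 6; l = nat ((n - 1) mod 6) + 1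
     in dilate j (if l \<le> 2 then k else k + 1) (\<psi> l))"

definition h_fun :: "(nat \<Rightarrow> real \<Rightarrow> real) \<Rightarrow> nat \<Rightarrow> real \<Rightarrow> real" where
  "h_fun \<phi> i = (let f = (\<lambda>x. \<phi> (i + 4) (2 * x)) in
     (\<lambda>x. f x - l2_inner lborel f (\<phi> 5) * \<phi> 5 x - l2_inner lborel f (\<phi> 6) * \<phi> 6 x))"

text \<open>The formulas for \<open>\<psi> 3\<close> and \<open>\<psi> 4\<close> are the Gram-Schmidt process. The two-dimensionality
  of the space spanned by \<open>\<psi> 5, \<psi> 6\<close> forces \<open>h_fun \<phi> 1, h_fun \<phi> 2\<close> to be independent, so no
  division by zero is hidden here: 22 functions are subject to at most 18 conditions besides
  orthogonality to \<open>\<psi> 3\<close> and \<open>\<psi> 4\<close>.\<close>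

definition wavelet_generators ::
    "(nat \<Rightarrow> real \<Rightarrow> real) \<Rightarrow> (nat \<Rightarrow> real \<Rightarrow> real) \<Rightarrow> bool" where
  "wavelet_generators \<phi> \<psi> \<longleftrightarrow>
     orthonormal_basis2 (\<psi> 1) (\<psi> 2)
       (fspan ({\<lambda>x. \<phi> k (2 * x) |k. k \<in> {1..4}} \<union> {\<lambda>x. \<phi> k (2 * x - 1) |k. k \<in> {1..6}})
        \<ominus> (\<phi> ` {1..6} \<union> {\<lambda>x. \<phi> 5 (x - 1), \<lambda>x. \<phi> 6 (x - 1)})) \<and>
     \<psi> 3 = l2_normalize (h_fun \<phi> 1) \<and>
     \<psi> 4 = l2_normalize (\<lambda>x. h_fun \<phi> 2 x - l2_inner lborel (h_fun \<phi> 2) (\<psi> 3) * \<psi> 3 x) \<and>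
     orthonormal_basis2 (\<psi> 5) (\<psi> 6)
       (fspan (phiR \<phi> 1 ` {-11..10})
        \<ominus> (phiR \<phi> 0 ` {-7..6} \<union> {\<lambda>x. \<psi> 1 (x + 1), \<lambda>x. \<psi> 2 (x + 1)} \<union> \<psi> ` {1..4}))"

definition phiL :: "(nat \<Rightarrow> real \<Rightarrow> real) \<Rightarrow> real \<Rightarrow> real" where
  "phiL \<phi> = l2_normalize (cut (\<lambda>x. \<phi> 6 0 * \<phi> 5 x - \<phi> 5 0 * \<phi> 6 x))"

definition phiRt :: "(nat \<Rightarrow> real \<Rightarrow> real) \<Rightarrow> real \<Rightarrow> real" where
  "phiRt \<phi> = l2_normalize (cut (\<lambda>x. \<phi> 6 0 * \<phi> 5 (x - 1) - \<phi> 5 0 * \<phi> 6 (x - 1)))"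

definition boundary_generators ::
    "(nat \<Rightarrow> real \<Rightarrow> real) \<Rightarrow> (nat \<Rightarrow> real \<Rightarrow> real) \<Rightarrow>
     (nat \<Rightarrow> real \<Rightarrow> real) \<Rightarrow> (nat \<Rightarrow> real \<Rightarrow> real) \<Rightarrow> bool" where
  "boundary_generators \<phi> \<psi> \<psi>L \<psi>R \<longleftrightarrow>
     orthonormal_basis2 (\<psi>L 1) (\<psi>L 2)
       {g. \<exists>b :: nat \<Rightarrow> real. g = (\<lambda>x. \<Sum>j=1..4. b j * cut (\<psi> (j + 2)) x) \<and>
           (\<Sum>j=1..4. b j * \<psi> (j + 2) 0) = 0 \<and> l2_inner lborel (phiL \<phi>) g = 0} \<and>
     orthonormal_basis2 (\<psi>R 1) (\<psi>R 2)
       {g. \<exists>c :: nat \<Rightarrow> real. g = (\<lambda>x. \<Sum>j=1..4. c j * cut (\<lambda>y. \<psi> (j + 2) (y - 1)) x) \<and>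
           (\<Sum>j=1..4. c j * \<psi> (j + 2) 0) = 0 \<and> l2_inner lborel (phiRt \<phi>) g = 0}"

definition spline_wavelet_construction ::
    "(nat \<Rightarrow> real \<Rightarrow> real) \<Rightarrow> (nat \<Rightarrow> real \<Rightarrow> real) \<Rightarrow>
     (nat \<Rightarrow> real \<Rightarrow> real) \<Rightarrow> (nat \<Rightarrow> real \<Rightarrow> real) \<Rightarrow> bool" where
  "spline_wavelet_construction \<phi> \<psi> \<psi>L \<psi>R \<longleftrightarrow>
     scaling_generators \<phi> \<and> wavelet_generators \<phi> \<psi> \<and> boundary_generators \<phi> \<psi> \<psi>L \<psi>R"

definition phi0 :: "(nat \<Rightarrow> real \<Rightarrow> real) \<Rightarrow> nat \<Rightarrow> real \<Rightarrow> real" where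
  "phi0 \<phi> k = (if k = 1 then phiL \<phi> else if k = 6 then phiRt \<phi> else \<phi> (k - 1))"

text \<open>Nonpositive indices stand for the scaling functions and are used on level \<open>0\<close> only.\<close>

definition psi1 ::
    "(nat \<Rightarrow> real \<Rightarrow> real) \<Rightarrow> (nat \<Rightarrow> real \<Rightarrow> real) \<Rightarrow>
     (nat \<Rightarrow> real \<Rightarrow> real) \<Rightarrow> (nat \<Rightarrow> real \<Rightarrow> real) \<Rightarrow> nat \<times> int \<Rightarrow> real \<Rightarrow> real" where
  "psi1 \<phi> \<psi> \<psi>L \<psi>R = (\<lambda>(j, k).
     if k \<le> 0 then phi0 \<phi> (nat (k + 6))
     else if k \<le> 2 then dilate j 0 (\<psi>L (nat k))
     else if k \<le> 6 * 2 ^ j - 2 then psiR \<psi> j (k - 2)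
     else dilate j (2 ^ j - 1) (\<psi>R (nat (k - 6 * 2 ^ j + 2))))"

definition index1 :: "(nat \<times> int) set" where
  "index1 = {(j, k). k \<in> (if j = 0 then {-5..6} else {1..6 * 2 ^ j})}"

text \<open>The dimension \<open>d\<close> is a number rather than a type, so that one can quantify over it
  below the constant in the support estimate. Points of \<open>d\<close>-space are the extensional functions
  on \<open>{1..d}\<close>; the topology of \<^typ>\<open>nat \<Rightarrow> real\<close> restricts to the Euclidean one on them.\<close>

definition cube :: "nat \<Rightarrow> (nat \<Rightarrow> real) set" where
  "cube d = {1..d} \<rightarrow>\<^sub>E {0<..<1}"

definition cube_measure :: "nat \<Rightarrow> (nat \<Rightarrow> real) measure" where
  "cube_measure d = PiM {1..d} (\<lambda>_. restrict_space lborel {0<..<1})"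

definition tensor_index :: "nat \<Rightarrow> (nat \<Rightarrow> nat \<times> int) set" where
  "tensor_index d = {1..d} \<rightarrow>\<^sub>E index1"

definition psi_tensor ::
    "(nat \<Rightarrow> real \<Rightarrow> real) \<Rightarrow> (nat \<Rightarrow> real \<Rightarrow> real) \<Rightarrow>
     (nat \<Rightarrow> real \<Rightarrow> real) \<Rightarrow> (nat \<Rightarrow> real \<Rightarrow> real) \<Rightarrow>
     nat \<Rightarrow> (nat \<Rightarrow> nat \<times> int) \<Rightarrow> (nat \<Rightarrow> real) \<Rightarrow> real" where
  "psi_tensor \<phi> \<psi> \<psi>L \<psi>R d l = (\<lambda>x. \<Prod>i=1..d. psi1 \<phi> \<psi> \<psi>L \<psi>R (l i) (x i))"

definition cubic_spline :: "(real \<Rightarrow> real) \<Rightarrow> bool" where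
  "cubic_spline s \<longleftrightarrow>
     (\<exists>t. t \<noteq> [] \<and> sorted_wrt (<) t \<and> hd t = 0 \<and> last t = 1 \<and>
        (\<forall>m. Suc m < length t \<longrightarrow>
           (\<exists>p :: real poly. degree p \<le> 3 \<and> (\<forall>x\<in>{t ! m..t ! Suc m}. s x = poly p x))))"

definition tensor_cubic_spline :: "nat \<Rightarrow> ((nat \<Rightarrow> real) \<Rightarrow> real) \<Rightarrow> bool" where
  "tensor_cubic_spline d f \<longleftrightarrow>
     (\<exists>s. (\<forall>i\<in>{1..d}. cubic_spline (s i)) \<and> (\<forall>x\<in>cube d. f x = (\<Prod>i=1..d. s i (x i))))"

definition C1_on_cube :: "nat \<Rightarrow> ((nat \<Rightarrow> real) \<Rightarrow> real) \<Rightarrow> bool" where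
  "C1_on_cube d f \<longleftrightarrow>
     continuous_on (cube d) f \<and>
     (\<exists>f'. \<forall>i\<in>{1..d}. continuous_on (cube d) (f' i) \<and>
        (\<forall>x\<in>cube d. ((\<lambda>t. f (x(i := t))) has_real_derivative f' i x) (at (x i))))"

definition polys_deg_less :: "nat \<Rightarrow> nat \<Rightarrow> ((nat \<Rightarrow> real) \<Rightarrow> real) set" where
  "polys_deg_less d n =
     {p. \<exists>c. p = (\<lambda>x. \<Sum>\<alpha> | \<alpha> \<in> {1..d} \<rightarrow>\<^sub>E UNIV \<and> (\<Sum>i=1..d. \<alpha> i) < n.
                      c \<alpha> * (\<Prod>i=1..d. x i ^ \<alpha> i))}"

definition supp :: "nat \<Rightarrow> ((nat \<Rightarrow> real) \<Rightarrow> real) \<Rightarrow> (nat \<Rightarrow> real) set" where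
  "supp d f = closure {x \<in> cube d. f x \<noteq> 0}"

definition euclidean_diam :: "nat \<Rightarrow> (nat \<Rightarrow> real) set \<Rightarrow> real" where
  "euclidean_diam d S =
     (if S = {} then 0 else SUP (x, y)\<in>S \<times> S. L2_set (\<lambda>i. x i - y i) {1..d})"

definition min_level :: "nat \<Rightarrow> (nat \<Rightarrow> nat \<times> int) \<Rightarrow> nat" where
  "min_level d l = Min ((\<lambda>i. fst (l i)) ` {1..d})"

end

theory Submission
  imports Defs
begin

text \<open>
  Since the parts of \<open>\<phi> 5\<close> and \<open>\<phi> 6\<close> on the two sides of the origin come from \<open>C0\<close> and \<open>C1\<close>, the
  construction of \<open>W\<close> makes all integer translates of \<open>\<phi> 1, \<dots>, \<phi> 6\<close> orthonormal. Their span lies between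
  the continuously differentiable cubic splines with knots in \<open>\<int>/2\<close> and those with knots in \<open>\<int>/4\<close>; hence it is refinable and locally
  contains the cubic polynomials, to which the wavelets are therefore orthogonal. The wavelets of a given level
  are orthogonal to each other by disjoint supports and by construction, except for \<open>\<psi> 5, \<psi> 6\<close> and
  their neighbours, which are compared after projection onto the functions supported in a single cell.

  On the interval, level \<open>j\<close> consists of the restrictions to \<open>[0, 1]\<close> of the functions of level \<open>j\<close> on the line that vanish at
  both endpoints. It has dimension \<open>6 * 2 ^ j\<close>, which is the number of scaling functions and
  wavelets below that level, so these form an orthonormal basis of it. Density then
  only requires approximating indicators of boxes by tensor products of sums of translates of \<open>xi_gen 1\<close>,
  which form a partition of unity.
\<close>

text \<open>The generators \<open>\<phi> 3\<close>, \<open>\<phi> 4\<close> and the wavelets are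
  given by conditions only, without coefficients, so every nondegeneracy has to be derived. The
  available pointwise information sits at the origin: \<open>\<phi> 1\<close>, ...,
  \<open>\<phi> 4\<close> vanish to first order at the integers, hence removing their components
  changes neither value nor slope of \<open>\<xi> 1 0\<close> and \<open>\<xi> 1 1\<close> at
  \<open>0\<close>. This gives a nonzero value of \<open>\<phi> 5\<close>, a nonzero slope of
  \<open>\<phi> 6\<close> and of the boundary combination \<open>u\<close>, so that none of their
  normalizations divides by zero. For \<open>\<psi> 3\<close> and \<open>\<psi> 4\<close> the source
  is different: the prescribed space of \<open>\<psi> 5\<close>, \<open>\<psi> 6\<close> would be
  too large if one of them vanished. Completeness is obtained by counting in finite dimension on the
  interval, where on the line only orthogonality and inclusions are proved. The count yields
  equality in the L2 seminorm, not pointwise; the passage to tensor products therefore goes through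
  inner products, which factor over the coordinates. The support constant is \<open>2\<close>, since
  every generator lives in \<open>(-1, 1)\<close>.\<close>

section \<open>Square-integrable functions\<close>

lemma square_integrable_mult:
  assumes "square_integrable M f" "square_integrable M g"
  shows "integrable M (\<lambda>x. f x * g x)"
proof -
  have i: "integrable M (\<lambda>x. (f x)\<^sup>2 + (g x)\<^sup>2)"
    using assms unfolding square_integrable_def by auto
  have m: "(\<lambda>x. f x * g x) \<in> borel_measurable M"
    using assms unfolding square_integrable_def by auto
  have "norm (f x * g x) \<le> norm ((f x)\<^sup>2 + (g x)\<^sup>2)" for x
  proof -
    have "0 \<le> (\<bar>f x\<bar> - \<bar>g x\<bar>)\<^sup>2" by simp
    hence "2 * (\<bar>f x\<bar> * \<bar>g x\<bar>) \<le> (f x)\<^sup>2 + (g x)\<^sup>2" by (simp add: power2_diff)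
    moreover have "0 \<le> \<bar>f x\<bar> * \<bar>g x\<bar>" by simp
    ultimately have "\<bar>f x\<bar> * \<bar>g x\<bar> \<le> (f x)\<^sup>2 + (g x)\<^sup>2" by linarith
    thus ?thesis by (simp add: abs_mult)
  qed
  thus ?thesis by (intro Bochner_Integration.integrable_bound[OF i m]) auto
qed

lemma square_integrable_zero [simp]: "square_integrable M (\<lambda>x. 0)"
  by (simp add: square_integrable_def)

lemma square_integrable_cmult:
  "square_integrable M f \<Longrightarrow> square_integrable M (\<lambda>x. c * f x)"
  by (auto simp: square_integrable_def power_mult_distrib)

lemma square_integrable_add:
  assumes "square_integrable M f" "square_integrable M g"
  shows "square_integrable M (\<lambda>x. f x + g x)"
proof -
  have "integrable M (\<lambda>x. (f x)\<^sup>2 + (g x)\<^sup>2 + 2 * (f x * g x))"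
    using assms square_integrable_mult[OF assms]
    unfolding square_integrable_def by (intro Bochner_Integration.integrable_add) auto
  hence "integrable M (\<lambda>x. (f x + g x)\<^sup>2)" by (simp add: power2_sum mult.assoc)
  thus ?thesis using assms by (auto simp: square_integrable_def)
qed

lemma square_integrable_diff:
  assumes "square_integrable M f" "square_integrable M g"
  shows "square_integrable M (\<lambda>x. f x - g x)"
  using square_integrable_add[OF assms(1) square_integrable_cmult[OF assms(2), of "-1"]] by simp

lemma square_integrable_sum:
  "(\<And>i. i \<in> A \<Longrightarrow> square_integrable M (f i)) \<Longrightarrow> square_integrable M (\<lambda>x. \<Sum>i\<in>A. f i x)"
  by (induction A rule: infinite_finite_induct) (auto intro: square_integrable_add)

lemmas square_integrable_intros =
  square_integrable_zero square_integrable_cmult square_integrable_add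
  square_integrable_diff square_integrable_sum

lemma l2_inner_commute: "l2_inner M f g = l2_inner M g f"
  by (simp add: l2_inner_def mult.commute)

lemma l2_inner_zero [simp]:
  "l2_inner M (\<lambda>x. 0) g = 0" "l2_inner M g (\<lambda>x. 0) = 0"
  by (simp_all add: l2_inner_def)

lemma l2_inner_cmult_left: "l2_inner M (\<lambda>x. c * f x) g = c * l2_inner M f g"
  by (simp add: l2_inner_def mult.assoc)

lemma l2_inner_cmult_right: "l2_inner M g (\<lambda>x. c * f x) = c * l2_inner M g f"
  by (metis l2_inner_cmult_left l2_inner_commute)

lemma l2_inner_add_left:
  assumes "square_integrable M f" "square_integrable M g" "square_integrable M h"
  shows "l2_inner M (\<lambda>x. f x + g x) h = l2_inner M f h + l2_inner M g h"
  unfolding l2_inner_def distrib_right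
  by (intro Bochner_Integration.integral_add square_integrable_mult assms)

lemma l2_inner_diff_left:
  assumes "square_integrable M f" "square_integrable M g" "square_integrable M h"
  shows "l2_inner M (\<lambda>x. f x - g x) h = l2_inner M f h - l2_inner M g h"
  unfolding l2_inner_def left_diff_distrib
  by (intro Bochner_Integration.integral_diff square_integrable_mult assms)

lemma l2_inner_add_right:
  assumes "square_integrable M f" "square_integrable M g" "square_integrable M h"
  shows "l2_inner M h (\<lambda>x. f x + g x) = l2_inner M h f + l2_inner M h g"
  using l2_inner_add_left[OF assms] by (simp add: l2_inner_commute)

lemma l2_inner_diff_right:
  assumes "square_integrable M f" "square_integrable M g" "square_integrable M h"
  shows "l2_inner M h (\<lambda>x. f x - g x) = l2_inner M h f - l2_inner M h g"
  using l2_inner_diff_left[OF assms] by (simp add: l2_inner_commute)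

lemma l2_inner_sum_left:
  assumes "\<And>i. i \<in> A \<Longrightarrow> square_integrable M (f i)" "square_integrable M h"
  shows "l2_inner M (\<lambda>x. \<Sum>i\<in>A. f i x) h = (\<Sum>i\<in>A. l2_inner M (f i) h)"
  unfolding l2_inner_def sum_distrib_right
  by (intro Bochner_Integration.integral_sum square_integrable_mult assms)

lemma l2_inner_sum_right:
  assumes "\<And>i. i \<in> A \<Longrightarrow> square_integrable M (f i)" "square_integrable M h"
  shows "l2_inner M h (\<lambda>x. \<Sum>i\<in>A. f i x) = (\<Sum>i\<in>A. l2_inner M h (f i))"
  using l2_inner_sum_left[OF assms] by (simp add: l2_inner_commute)

lemma l2_inner_self_nonneg [simp]: "l2_inner M f f \<ge> 0"
  by (simp add: l2_inner_def)

lemma l2_norm_square: "(l2_norm M f)\<^sup>2 = l2_inner M f f"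
  by (simp add: l2_norm_def)

lemma l2_norm_eq_1_iff: "l2_norm M f = 1 \<longleftrightarrow> l2_inner M f f = 1"
  by (simp add: l2_norm_def)

lemma l2_inner_null:
  assumes "square_integrable M f" "l2_inner M f f = 0"
  shows "AE x in M. f x = 0"
proof -
  have "AE x in M. f x * f x = 0"
    using assms square_integrable_mult[OF assms(1,1)]
    unfolding l2_inner_def by (subst (asm) integral_nonneg_eq_0_iff_AE) auto
  thus ?thesis by simp
qed

lemma l2_inner_null_left:
  assumes "square_integrable M f" "l2_inner M f f = 0"
  shows "l2_inner M f g = 0"
proof -
  have "AE x in M. f x * g x = 0" using l2_inner_null[OF assms] by auto
  thus ?thesis unfolding l2_inner_def by (rule integral_eq_zero_AE)
qed

text \<open>A null set that is open is empty. Continuity is only asked on an open set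
  \<open>S\<close>, so that functions cut to \<open>[0, 1]\<close> are covered.\<close>

lemma l2_inner_null_continuous:
  assumes "square_integrable lborel f" "l2_inner lborel f f = 0"
    and "open S" "continuous_on S f" "x \<in> S"
  shows "f x = (0::real)"
proof (rule ccontr)
  assume nz: "f x \<noteq> 0"
  let ?U = "S \<inter> f -` (- {0})"
  have o: "open ?U" using assms by (intro continuous_open_preimage) auto
  have "AE y in lborel. y \<notin> ?U" using l2_inner_null[OF assms(1,2)] by auto
  hence "?U \<in> null_sets lborel"
    using o by (subst AE_iff_null_sets) auto
  hence "negligible ?U" by (simp add: negligible_iff_null_sets null_sets_completionI)
  thus False using open_not_negligible[OF o] nz assms(5) by auto
qed

lemma l2_inner_scaled_sum_left:
  assumes "\<And>i. i \<in> A \<Longrightarrow> square_integrable M (f i)" "square_integrable M h"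
  shows "l2_inner M (\<lambda>x. \<Sum>i\<in>A. c i * f i x) h = (\<Sum>i\<in>A. c i * l2_inner M (f i) h)"
  using assms by (simp add: l2_inner_sum_left square_integrable_cmult l2_inner_cmult_left)

lemma l2_inner_scaled_sum_right:
  assumes "\<And>i. i \<in> A \<Longrightarrow> square_integrable M (f i)" "square_integrable M h"
  shows "l2_inner M h (\<lambda>x. \<Sum>i\<in>A. c i * f i x) = (\<Sum>i\<in>A. c i * l2_inner M h (f i))"
  using assms by (simp add: l2_inner_sum_right square_integrable_cmult l2_inner_cmult_right)

text \<open>Gram-Schmidt without independence: a zero denominator belongs to a null function, whose
  inner products vanish, and division by zero then returns a harmless \<open>0\<close>. This matters
  for the projections of \<open>\<phi> 5\<close> and \<open>\<phi> 6\<close> to one cell, whose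
  independence is never established.\<close>

lemma l2_proj2_exists:
  assumes [simp]: "square_integrable M u" "square_integrable M v" "square_integrable M f"
  obtains a b where
    "l2_inner M (\<lambda>x. f x - (a * u x + b * v x)) u = 0"
    "l2_inner M (\<lambda>x. f x - (a * u x + b * v x)) v = 0"
proof -
  have *: "l2_inner M f g - (l2_inner M f g / l2_inner M g g) * l2_inner M g g = 0"
    if "square_integrable M g" "square_integrable M f" for f g
    using l2_inner_null_left[OF that(1)] by (cases "l2_inner M g g = 0") (auto simp: l2_inner_commute)
  define c where "c = l2_inner M v u / l2_inner M u u"
  define w where "w = (\<lambda>x. v x - c * u x)"
  have [simp]: "square_integrable M w" unfolding w_def by (intro square_integrable_intros) simp_all
  have "l2_inner M w u = l2_inner M v u - c * l2_inner M u u"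
    unfolding w_def by (simp add: l2_inner_diff_left square_integrable_cmult l2_inner_cmult_left)
  hence wu: "l2_inner M w u = 0" using *[of u v] by (simp only: c_def assms)
  define \<beta> where "\<beta> = l2_inner M f w / l2_inner M w w"
  define \<alpha> where "\<alpha> = l2_inner M f u / l2_inner M u u"
  define r where "r = (\<lambda>x. f x - \<alpha> * u x - \<beta> * w x)"
  have "l2_inner M r u = l2_inner M f u - \<alpha> * l2_inner M u u" unfolding r_def using wu
    by (simp add: l2_inner_diff_left square_integrable_intros l2_inner_cmult_left)
  hence ru: "l2_inner M r u = 0" using *[of u f] by (simp only: \<alpha>_def assms)
  have "l2_inner M r w = l2_inner M f w - \<beta> * l2_inner M w w" unfolding r_def using wu
    by (simp add: l2_inner_diff_left square_integrable_intros l2_inner_cmult_left l2_inner_commute[of M u w])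
  hence rw: "l2_inner M r w = 0"
    using *[of w f] \<open>square_integrable M w\<close> by (simp only: \<beta>_def assms)
  have [simp]: "square_integrable M r" unfolding r_def by (intro square_integrable_intros) simp_all
  have v: "v = (\<lambda>x. w x + c * u x)" by (simp add: w_def)
  have rv: "l2_inner M r v = 0"
    unfolding v using ru rw by (simp add: l2_inner_add_right square_integrable_cmult l2_inner_cmult_right)
  have "r = (\<lambda>x. f x - ((\<alpha> - \<beta> * c) * u x + \<beta> * v x))"
    by (simp add: r_def w_def algebra_simps)
  with ru rv show ?thesis using that by blast
qed

section \<open>Linear spans of functions\<close>

lemma fspan_base: "f \<in> S \<Longrightarrow> f \<in> fspan S"
  unfolding fspan_def by (auto intro!: exI[of _ "{f}"] exI[of _ "\<lambda>_. 1"])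

lemma fspan_zero: "(\<lambda>x. 0) \<in> fspan S"
  unfolding fspan_def by (auto intro!: exI[of _ "{}"])

lemma fspan_lincomb2:
  assumes "f \<in> fspan S" "g \<in> fspan S"
  shows "(\<lambda>x. a * f x + b * g x) \<in> fspan S"
proof -
  from assms obtain A c B d where A: "finite A" "A \<subseteq> S" "f = (\<lambda>x. \<Sum>h\<in>A. c h * h x)"
    and B: "finite B" "B \<subseteq> S" "g = (\<lambda>x. \<Sum>h\<in>B. d h * h x)" unfolding fspan_def by blast
  let ?e = "\<lambda>h. a * (if h \<in> A then c h else 0) + b * (if h \<in> B then d h else 0)"
  have "(\<Sum>h\<in>A \<union> B. ?e h * h x) = a * f x + b * g x" for x
  proof -
    have "(\<Sum>h\<in>A \<union> B. ?e h * h x) = a * (\<Sum>h\<in>A \<union> B. (if h \<in> A then c h else 0) * h x) +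
        b * (\<Sum>h\<in>A \<union> B. (if h \<in> B then d h else 0) * h x)"
      by (simp add: distrib_right sum.distrib sum_distrib_left mult.assoc)
    also have "(\<Sum>h\<in>A \<union> B. (if h \<in> A then c h else 0) * h x) = (\<Sum>h\<in>A. c h * h x)"
      using A B by (intro sum.mono_neutral_cong_right) auto
    also have "(\<Sum>h\<in>A \<union> B. (if h \<in> B then d h else 0) * h x) = (\<Sum>h\<in>B. d h * h x)"
      using A B by (intro sum.mono_neutral_cong_right) auto
    finally show ?thesis using A B by simp
  qed
  thus ?thesis unfolding fspan_def using A B
    by (intro CollectI exI[of _ "A \<union> B"] exI[of _ ?e]) auto
qed

lemma fspan_cmult: "f \<in> fspan S \<Longrightarrow> (\<lambda>x. c * f x) \<in> fspan S"
  using fspan_lincomb2[of f S f c 0] by simp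

lemma fspan_add: "f \<in> fspan S \<Longrightarrow> g \<in> fspan S \<Longrightarrow> (\<lambda>x. f x + g x) \<in> fspan S"
  using fspan_lincomb2[of f S g 1 1] by simp

lemma fspan_diff: "f \<in> fspan S \<Longrightarrow> g \<in> fspan S \<Longrightarrow> (\<lambda>x. f x - g x) \<in> fspan S"
  using fspan_lincomb2[of f S g 1 "-1"] by simp

lemma fspan_sum: "(\<And>i. i \<in> A \<Longrightarrow> f i \<in> fspan S) \<Longrightarrow> (\<lambda>x. \<Sum>i\<in>A. f i x) \<in> fspan S"
  by (induction A rule: infinite_finite_induct) (auto intro: fspan_zero fspan_add)

lemma fspan_divide: "f \<in> fspan S \<Longrightarrow> (\<lambda>x. f x / c) \<in> fspan S"
  using fspan_cmult[of f S "1/c"] by simp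

lemma fspan_induct [consumes 1, case_names zero step]:
  assumes "f \<in> fspan S" "P (\<lambda>x. 0)"
    and "\<And>c g h. g \<in> S \<Longrightarrow> h \<in> fspan S \<Longrightarrow> P h \<Longrightarrow> P (\<lambda>x. c * g x + h x)"
  shows "P f"
proof -
  from assms(1) obtain A c where A: "finite A" "A \<subseteq> S" "f = (\<lambda>x. \<Sum>h\<in>A. c h * h x)"
    unfolding fspan_def by blast
  from A(1,2) have "P (\<lambda>x. \<Sum>h\<in>A. c h * h x)"
  proof (induction A rule: finite_induct)
    case (insert g A)
    have "(\<lambda>x. \<Sum>h\<in>A. c h * h x) \<in> fspan S"
      using insert by (intro fspan_sum fspan_cmult fspan_base) auto
    thus ?case using assms(3)[of g "\<lambda>x. \<Sum>h\<in>A. c h * h x" "c g"] insert by simp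
  qed (simp add: assms(2))
  thus ?thesis using A by simp
qed

lemma fspan_trans:
  assumes "f \<in> fspan S" "\<And>s. s \<in> S \<Longrightarrow> s \<in> fspan T"
  shows "f \<in> fspan T"
  using assms(1)
proof (induction rule: fspan_induct)
  case (step c g h)
  thus ?case using assms(2) by (intro fspan_add fspan_cmult)
qed (simp add: fspan_zero)

lemma fspan_mono: "S \<subseteq> T \<Longrightarrow> f \<in> fspan S \<Longrightarrow> f \<in> fspan T"
  by (erule fspan_trans) (auto intro: fspan_base)

lemma fspan_square_integrable:
  assumes "f \<in> fspan S" "\<And>s. s \<in> S \<Longrightarrow> square_integrable M s"
  shows "square_integrable M f"
  using assms(1)
proof (induction rule: fspan_induct)
  case (step c g h)
  thus ?case using assms(2) by (intro square_integrable_add square_integrable_cmult)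
qed simp

lemma fspan_orthogonal:
  assumes "f \<in> fspan S" "\<And>s. s \<in> S \<Longrightarrow> square_integrable M s" "square_integrable M g"
    and "\<And>s. s \<in> S \<Longrightarrow> l2_inner M s g = 0"
  shows "l2_inner M f g = 0"
  using assms(1)
proof (induction rule: fspan_induct)
  case (step c s h)
  hence "square_integrable M s" "square_integrable M h"
    using fspan_square_integrable assms(2) by auto
  thus ?case using step assms(3,4)
    by (simp add: l2_inner_add_left square_integrable_intros l2_inner_cmult_left)
qed simp

lemma fspan_orthogonal2:
  assumes "f \<in> fspan S" "g \<in> fspan T"
    and "\<And>s. s \<in> S \<Longrightarrow> square_integrable M s" "\<And>t. t \<in> T \<Longrightarrow> square_integrable M t"
    and "\<And>s t. s \<in> S \<Longrightarrow> t \<in> T \<Longrightarrow> l2_inner M s t = 0"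
  shows "l2_inner M f g = 0"
proof (rule fspan_orthogonal[OF assms(1,3)])
  show "square_integrable M g" using fspan_square_integrable assms(2,4) by blast
  fix s assume s: "s \<in> S"
  have "l2_inner M g s = 0"
    using assms s by (intro fspan_orthogonal[OF assms(2,4)]) (auto simp: l2_inner_commute[of M _ s])
  thus "l2_inner M s g = 0" by (simp add: l2_inner_commute)
qed

lemma fspan_reindex:
  assumes "f \<in> fspan S"
  shows "(\<lambda>x. m x * f (t x)) \<in> fspan ((\<lambda>f x. m x * f (t x)) ` S)"
  using assms
proof (induction rule: fspan_induct)
  case (step c g h)
  have "(\<lambda>x. c * (m x * g (t x)) + m x * h (t x)) \<in> fspan ((\<lambda>f x. m x * f (t x)) ` S)"
    using step by (intro fspan_add fspan_cmult) (auto intro: fspan_base)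
  thus ?case by (simp add: algebra_simps)
qed (simp add: fspan_zero)

text \<open>\<open>fspan\<close> attaches coefficients to functions, this form to indices. As
  \<open>b\<close> need not be injective, a new coefficient is added at one chosen index.\<close>

lemma fspan_image_finite:
  assumes "f \<in> fspan (b ` A)" "finite A"
  obtains c where "f = (\<lambda>x. \<Sum>n\<in>A. c n * b n x)"
proof -
  have "\<exists>c. f = (\<lambda>x. \<Sum>n\<in>A. c n * b n x)"
    using assms(1)
  proof (induction rule: fspan_induct)
    case (step a g h)
    then obtain m c where m: "m \<in> A" "g = b m" "h = (\<lambda>x. \<Sum>n\<in>A. c n * b n x)" by blast
    have "(\<Sum>n\<in>A. (c n + (if n = m then a else 0)) * b n x) = a * g x + h x" for x
    proof -
      have "(\<Sum>n\<in>A. (c n + (if n = m then a else 0)) * b n x) =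
          (\<Sum>n\<in>A. c n * b n x) + (\<Sum>n\<in>A. if n = m then a * b n x else 0)"
        unfolding sum.distrib[symmetric] by (intro sum.cong) (auto simp: algebra_simps)
      thus ?thesis using m assms(2) by (simp add: sum.delta')
    qed
    thus ?case by (intro exI[of _ "\<lambda>n. c n + (if n = m then a else 0)"] ext) simp
  qed (auto intro: exI[of _ "\<lambda>_. 0"])
  thus ?thesis using that by blast
qed

lemma fspan_pair_iff: "f \<in> fspan {u, v} \<longleftrightarrow> (\<exists>a b. f = (\<lambda>x. a * u x + b * v x))"
proof
  assume "f \<in> fspan {u, v}"
  thus "\<exists>a b. f = (\<lambda>x. a * u x + b * v x)"
  proof (induction rule: fspan_induct)
    case zero
    show ?case by (rule exI[of _ 0], rule exI[of _ 0]) simp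
  next
    case (step c g h)
    then obtain a b where h: "h = (\<lambda>x. a * u x + b * v x)" by blast
    from step(1) consider "g = u" | "g = v" by blast
    thus ?case
    proof cases
      case 1
      show ?thesis by (rule exI[of _ "a + c"], rule exI[of _ b]) (simp add: h 1 algebra_simps)
    next
      case 2
      show ?thesis by (rule exI[of _ a], rule exI[of _ "b + c"]) (simp add: h 2 algebra_simps)
    qed
  qed
qed (auto intro!: fspan_lincomb2 intro: fspan_base)

lemma orthonormal_lincomb_inner:
  fixes b :: "'i \<Rightarrow> real \<Rightarrow> real"
  assumes "\<And>n. square_integrable M (b n)" "\<And>m n. l2_inner M (b m) (b n) = (if m = n then 1 else 0)"
    and "finite A" "f = (\<lambda>x. \<Sum>n\<in>A. c n * b n x)"
  shows "l2_inner M f (b n) = (if n \<in> A then c n else 0)"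
proof -
  have "l2_inner M f (b n) = (\<Sum>m\<in>A. c m * l2_inner M (b m) (b n))"
    unfolding assms(4) by (rule l2_inner_scaled_sum_left) (rule assms(1))+
  also have "\<dots> = (\<Sum>m\<in>A. if m = n then c m else 0)"
    by (intro sum.cong) (auto simp: assms(2))
  finally show ?thesis using assms(3) by simp
qed

section \<open>Dimension counting\<close>

text \<open>Gaussian elimination, by induction on the equations: an equation with a nonzero
  coefficient removes one unknown and itself, which keeps the surplus of unknowns.\<close>

lemma underdetermined_system:
  fixes a :: "'i \<Rightarrow> 'j \<Rightarrow> real"
  assumes "finite I" "finite J" "card I < card J"
  shows "\<exists>x. (\<exists>j\<in>J. x j \<noteq> 0) \<and> (\<forall>i\<in>I. (\<Sum>j\<in>J. a i j * x j) = 0)"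
  using assms
proof (induction I arbitrary: J a rule: finite_induct)
  case empty
  hence "J \<noteq> {}" by auto
  thus ?case by (intro exI[of _ "\<lambda>_. 1"]) auto
next
  case (insert i0 I)
  show ?case
  proof (cases "\<forall>j\<in>J. a i0 j = 0")
    case True
    have "card I < card J" using insert by simp
    from insert.IH[OF insert.prems(1) this, of a] True show ?thesis by auto
  next
    case False
    then obtain p where p: "p \<in> J" "a i0 p \<noteq> 0" by blast
    let ?J = "J - {p}"
    \<comment> \<open>Equation \<open>i0\<close> is subtracted so that the unknown \<open>p\<close>
      disappears from every other equation; \<open>y\<close> below restores it by back
      substitution.\<close>
    let ?a = "\<lambda>i j. a i j - a i p * a i0 j / a i0 p"
    have "card I < card ?J" using insert p by simp
    from insert.IH[OF _ this, of ?a] insert.prems obtain x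
      where x: "\<exists>j\<in>?J. x j \<noteq> 0" "\<And>i. i \<in> I \<Longrightarrow> (\<Sum>j\<in>?J. ?a i j * x j) = 0" by auto
    define s where "s = (\<Sum>j\<in>?J. a i0 j * x j)"
    define y where "y = x(p := - s / a i0 p)"
    have sum: "(\<Sum>j\<in>J. a i j * y j) = (\<Sum>j\<in>?J. a i j * x j) - a i p * s / a i0 p" for i
    proof -
      have "(\<Sum>j\<in>J. a i j * y j) = a i p * y p + (\<Sum>j\<in>?J. a i j * y j)"
        using p insert.prems by (intro sum.remove) auto
      also have "(\<Sum>j\<in>?J. a i j * y j) = (\<Sum>j\<in>?J. a i j * x j)"
        by (intro sum.cong) (auto simp: y_def)
      finally show ?thesis by (simp add: y_def)
    qed
    have "(\<Sum>j\<in>J. a i j * y j) = 0" if "i \<in> insert i0 I" for i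
    proof (cases "i = i0")
      case True
      thus ?thesis using p by (simp add: sum s_def)
    next
      case False
      hence "0 = (\<Sum>j\<in>?J. ?a i j * x j)" using x that by auto
      also have "\<dots> = (\<Sum>j\<in>?J. a i j * x j) - a i p / a i0 p * s"
        unfolding s_def sum_distrib_left sum_subtractf[symmetric]
        by (intro sum.cong) (auto simp: algebra_simps)
      finally show ?thesis by (simp add: sum)
    qed
    moreover have "\<exists>j\<in>J. y j \<noteq> 0" using x(1) p by (auto simp: y_def)
    ultimately show ?thesis by blast
  qed
qed

text \<open>Comparing traces: every \<open>f j\<close> has an orthogonal projection of squared norm at most \<open>1\<close>
  onto the span of the \<open>e i\<close>, and these numbers add up to the number of the \<open>e i\<close>.\<close>

lemma orthonormal_same_card:
  fixes e :: "'i \<Rightarrow> real \<Rightarrow> real" and f :: "'j \<Rightarrow> real \<Rightarrow> real"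
  assumes fin: "finite I" "finite J" and card: "card I = card J"
    and se: "\<And>i. i \<in> I \<Longrightarrow> square_integrable M (e i)"
    and sf: "\<And>j. j \<in> J \<Longrightarrow> square_integrable M (f j)"
    and oe: "\<And>i i'. i \<in> I \<Longrightarrow> i' \<in> I \<Longrightarrow> l2_inner M (e i) (e i') = (if i = i' then 1 else 0)"
    and orthf: "\<And>j j'. j \<in> J \<Longrightarrow> j' \<in> J \<Longrightarrow> l2_inner M (f j) (f j') = (if j = j' then 1 else 0)"
    and sub: "\<And>i. i \<in> I \<Longrightarrow> e i \<in> fspan (f ` J)"
    and j: "j \<in> J"
  shows "l2_norm M (\<lambda>x. f j x - (\<Sum>i\<in>I. l2_inner M (f j) (e i) * e i x)) = 0"
proof -
  define P where "P = (\<lambda>j x. \<Sum>i\<in>I. l2_inner M (f j) (e i) * e i x)"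
  have sP: "square_integrable M (P j)" for j
    unfolding P_def by (intro square_integrable_intros se)
  have fP: "l2_inner M (f j) (P j) = (\<Sum>i\<in>I. (l2_inner M (f j) (e i))\<^sup>2)" if "j \<in> J" for j
    using that by (simp add: P_def l2_inner_scaled_sum_right se sf power2_eq_square)
  have PP: "l2_inner M (P j) (P j) = (\<Sum>i\<in>I. (l2_inner M (f j) (e i))\<^sup>2)" if "j \<in> J" for j
  proof -
    have "l2_inner M (e i) (P j) = l2_inner M (f j) (e i)" if i: "i \<in> I" for i
    proof -
      have "l2_inner M (e i) (P j) = (\<Sum>k\<in>I. l2_inner M (f j) (e k) * l2_inner M (e i) (e k))"
        unfolding P_def by (intro l2_inner_scaled_sum_right se i)
      also have "\<dots> = (\<Sum>k\<in>I. if i = k then l2_inner M (f j) (e k) else 0)"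
        by (intro sum.cong) (auto simp: oe i)
      finally show ?thesis using i fin by simp
    qed
    hence "l2_inner M (\<lambda>x. \<Sum>i\<in>I. l2_inner M (f j) (e i) * e i x) (P j) =
        (\<Sum>i\<in>I. l2_inner M (f j) (e i) * l2_inner M (f j) (e i))"
      by (subst l2_inner_scaled_sum_left) (auto simp: se sP)
    thus ?thesis by (simp add: P_def power2_eq_square)
  qed
  have res: "l2_inner M (\<lambda>x. f j x - P j x) (\<lambda>x. f j x - P j x) =
      1 - (\<Sum>i\<in>I. (l2_inner M (f j) (e i))\<^sup>2)" if "j \<in> J" for j
    using that fP[OF that] PP[OF that]
    by (simp add: l2_inner_diff_left l2_inner_diff_right square_integrable_diff sf sP orthf
        l2_inner_commute[of M "P j" "f j"])
  \<comment> \<open>Parseval: \<open>e i\<close> is a unit vector in the span of the orthonormal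
    functions \<open>f j\<close>.\<close>
  have norm1: "(\<Sum>j\<in>J. (l2_inner M (f j) (e i))\<^sup>2) = 1" if i: "i \<in> I" for i
  proof -
    obtain c where c: "e i = (\<lambda>x. \<Sum>j\<in>J. c j * f j x)"
      using fspan_image_finite[OF sub[OF i] fin(2)] .
    have cj: "l2_inner M (e i) (f j) = c j" if "j \<in> J" for j
    proof -
      have "l2_inner M (e i) (f j) = (\<Sum>k\<in>J. c k * l2_inner M (f k) (f j))"
        unfolding c by (intro l2_inner_scaled_sum_left sf that)
      also have "\<dots> = (\<Sum>k\<in>J. if k = j then c k else 0)"
        by (intro sum.cong) (auto simp: orthf that)
      finally show ?thesis using that fin by simp
    qed
    have "1 = l2_inner M (e i) (e i)" using oe i by simp
    also have "\<dots> = (\<Sum>j\<in>J. c j * l2_inner M (f j) (e i))"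
      by (subst (1) c) (simp add: l2_inner_scaled_sum_left sf se i)
    also have "\<dots> = (\<Sum>j\<in>J. (l2_inner M (f j) (e i))\<^sup>2)"
      by (intro sum.cong) (auto simp: power2_eq_square cj[symmetric] l2_inner_commute)
    finally show ?thesis by simp
  qed
  \<comment> \<open>The squared residuals are nonnegative and add up to
    \<open>card J - card I = 0\<close>, so each of them is zero.\<close>
  have "(\<Sum>j\<in>J. l2_inner M (\<lambda>x. f j x - P j x) (\<lambda>x. f j x - P j x)) =
      (\<Sum>j\<in>J. 1 - (\<Sum>i\<in>I. (l2_inner M (f j) (e i))\<^sup>2))"
    by (intro sum.cong) (auto simp: res)
  also have "\<dots> = real (card J) - (\<Sum>i\<in>I. \<Sum>j\<in>J. (l2_inner M (f j) (e i))\<^sup>2)"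
    by (simp add: sum_subtractf) (rule sum.swap)
  also have "\<dots> = 0" using norm1 card by simp
  finally have "l2_inner M (\<lambda>x. f j x - P j x) (\<lambda>x. f j x - P j x) = 0"
    using fin j by (subst (asm) sum_nonneg_eq_0_iff) auto
  thus ?thesis by (simp add: l2_norm_def P_def)
qed

section \<open>Dilations\<close>

abbreviation l2ip :: "(real \<Rightarrow> real) \<Rightarrow> (real \<Rightarrow> real) \<Rightarrow> real" where
  "l2ip \<equiv> l2_inner lborel"

abbreviation sqint :: "(real \<Rightarrow> real) \<Rightarrow> bool" where
  "sqint \<equiv> square_integrable lborel"

lemma dilate_0: "dilate 0 k f = (\<lambda>x. f (x - of_int k))"
  by (simp add: dilate_def)

lemma dilate_0_0 [simp]: "dilate 0 0 f = f"
  by (simp add: dilate_def)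

lemma dilate_dilate: "dilate j k (dilate i l f) = dilate (i + j) (2 ^ i * k + l) f"
  by (simp add: dilate_def fun_eq_iff powr_add add_divide_distrib power_add algebra_simps)

lemma fspan_dilate:
  assumes "f \<in> fspan S"
  shows "dilate j k f \<in> fspan (dilate j k ` S)"
  using fspan_reindex[OF assms, of "\<lambda>_. 2 powr (real j / 2)" "\<lambda>x. 2 ^ j * x - of_int k"]
  by (simp add: dilate_def[abs_def])

text \<open>The argument is written as constant plus multiple, the shape in which
  \<open>lborel_integral_real_affine\<close> states the substitution.\<close>

lemma dilate_mult_eq:
  "dilate j k f x * dilate j k g x = 2 ^ j * (f (- of_int k + 2 ^ j * x) * g (- of_int k + 2 ^ j * x))"
proof -
  have "2 powr (real j / 2) * 2 powr (real j / 2) = (2::real) ^ j"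
    by (simp flip: powr_add add: powr_realpow)
  hence 1: "2 ^ j * (u * v) = (2 powr (real j / 2) * 2 powr (real j / 2)) * (u * v)" for u v :: real
    by simp
  have 2: "2 ^ j * x - of_int k = - of_int k + 2 ^ j * x" by simp
  show ?thesis unfolding dilate_def 1 2 by (simp only: ac_simps)
qed

lemma l2_inner_dilate: "l2ip (dilate j k f) (dilate j k g) = l2ip f g"
proof -
  have "l2ip f g = \<bar>2 ^ j\<bar> *\<^sub>R (LINT x|lborel. f (- of_int k + 2 ^ j * x) * g (- of_int k + 2 ^ j * x))"
    unfolding l2_inner_def by (rule lborel_integral_real_affine) simp
  thus ?thesis by (simp add: l2_inner_def dilate_mult_eq)
qed

lemma square_integrable_dilate:
  assumes "sqint f"
  shows "sqint (dilate j k f)"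
proof -
  have "integrable lborel (\<lambda>x. (f (- of_int k + 2 ^ j * x))\<^sup>2)"
    using assms unfolding square_integrable_def
    by (intro lborel_integrable_real_affine[where f = "\<lambda>x. (f x)\<^sup>2"]) auto
  hence "integrable lborel (\<lambda>x. 2 ^ j * (f (- of_int k + 2 ^ j * x) * f (- of_int k + 2 ^ j * x)))"
    by (simp add: power2_eq_square)
  hence "integrable lborel (\<lambda>x. (dilate j k f x)\<^sup>2)"
    by (simp add: power2_eq_square dilate_mult_eq)
  moreover have "f \<in> borel_measurable borel" using assms by (simp add: square_integrable_def)
  hence "dilate j k f \<in> borel_measurable lborel" by (simp add: dilate_def)
  ultimately show ?thesis by (simp add: square_integrable_def)
qed

lemma l2_inner_shift: "l2ip (dilate 0 k f) (dilate 0 l g) = l2ip f (dilate 0 (l - k) g)"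
  using l2_inner_dilate[of 0 k f "dilate 0 (l - k) g"] by (simp add: dilate_dilate)

text \<open>The interval is open, so \<open>f\<close> vanishes at both endpoints; boundary values
  and one-sided derivatives are read off from this. The bounds need not be tight.\<close>

definition supp_in :: "real \<Rightarrow> real \<Rightarrow> (real \<Rightarrow> real) \<Rightarrow> bool" where
  "supp_in a b f \<longleftrightarrow> (\<forall>x. f x \<noteq> 0 \<longrightarrow> a < x \<and> x < b)"

lemma supp_in_outside: "supp_in a b f \<Longrightarrow> x \<le> a \<or> b \<le> x \<Longrightarrow> f x = 0"
  unfolding supp_in_def by force

lemma supp_in_zero: "supp_in a b (\<lambda>x. 0)"
  by (simp add: supp_in_def)

lemma supp_in_lincomb: "supp_in a b f \<Longrightarrow> supp_in a b g \<Longrightarrow> supp_in a b (\<lambda>x. c * f x + g x)"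
  unfolding supp_in_def by (metis add.right_neutral mult_zero_right)

lemma supp_in_mono: "supp_in a b f \<Longrightarrow> c \<le> a \<Longrightarrow> b \<le> d \<Longrightarrow> supp_in c d f"
  unfolding supp_in_def by force

lemma supp_in_dilate:
  assumes "supp_in a b f"
  shows "supp_in ((a + of_int k) / 2 ^ j) ((b + of_int k) / 2 ^ j) (dilate j k f)"
  unfolding supp_in_def
proof (intro allI impI)
  fix x assume "dilate j k f x \<noteq> 0"
  hence "f (2 ^ j * x - of_int k) \<noteq> 0" by (auto simp: dilate_def)
  hence "a < 2 ^ j * x - of_int k \<and> 2 ^ j * x - of_int k < b" using assms by (auto simp: supp_in_def)
  thus "(a + of_int k) / 2 ^ j < x \<and> x < (b + of_int k) / 2 ^ j" by (simp add: field_simps)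
qed

lemma fspan_supp_in:
  assumes "f \<in> fspan S" "\<And>s. s \<in> S \<Longrightarrow> supp_in a b s"
  shows "supp_in a b f"
  using assms(1)
proof (induction rule: fspan_induct)
  case (step c g h)
  thus ?case using assms(2) by (intro supp_in_lincomb)
qed (simp add: supp_in_zero)

lemma l2_inner_disjoint:
  assumes "supp_in a b f" "supp_in c d g" "b \<le> c \<or> d \<le> a"
  shows "l2_inner M f g = 0"
proof -
  have "f x * g x = 0" for x
    using assms unfolding supp_in_def by (metis linorder_not_less mult_eq_0_iff order.strict_trans1 order_less_asym order_less_le_trans)
  hence "(\<lambda>x. f x * g x) = (\<lambda>x. 0)" by (rule ext)
  thus ?thesis by (simp add: l2_inner_def)
qed

lemma l2_inner_cong:
  "(\<And>x. x \<in> space M \<Longrightarrow> f x * g x = f' x * g' x) \<Longrightarrow> l2_inner M f g = l2_inner M f' g'"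
  unfolding l2_inner_def by (rule Bochner_Integration.integral_cong) auto

section \<open>Continuously differentiable cubic splines\<close>

definition C1_fun :: "(real \<Rightarrow> real) \<Rightarrow> bool" where
  "C1_fun f \<longleftrightarrow> (\<exists>f'. continuous_on UNIV f' \<and> (\<forall>x. (f has_real_derivative f' x) (at x)))"

definition C1_spline :: "nat \<Rightarrow> (real \<Rightarrow> real) \<Rightarrow> bool" where
  "C1_spline N f \<longleftrightarrow> C1_fun f \<and>
     (\<forall>k::int. \<exists>p. degree p \<le> 3 \<and> (\<forall>x\<in>{of_int k / 2 ^ N..of_int (k + 1) / 2 ^ N}. f x = poly p x))"

lemma C1_fun_lincomb:
  assumes "C1_fun f" "C1_fun g"
  shows "C1_fun (\<lambda>x. c * f x + g x)"
proof -
  from assms obtain f' g' where *: "continuous_on UNIV f'" "\<And>x. (f has_real_derivative f' x) (at x)"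
    "continuous_on UNIV g'" "\<And>x. (g has_real_derivative g' x) (at x)" unfolding C1_fun_def by blast
  show ?thesis unfolding C1_fun_def
    by (intro exI[of _ "\<lambda>x. c * f' x + g' x"] conjI allI)
      (use * in \<open>auto intro!: continuous_intros derivative_eq_intros\<close>)
qed

lemma C1_fun_dilate:
  assumes "C1_fun f"
  shows "C1_fun (dilate j k f)"
proof -
  from assms obtain f' where *: "continuous_on UNIV f'" "\<And>x. (f has_real_derivative f' x) (at x)"
    unfolding C1_fun_def by blast
  have "(dilate j k f has_real_derivative 2 powr (real j / 2) * (f' (2 ^ j * x - of_int k) * 2 ^ j)) (at x)" for x
    unfolding dilate_def
    by (rule DERIV_cmult, rule DERIV_chain2[OF *(2)]) (auto intro!: derivative_eq_intros)
  moreover have "continuous_on UNIV (\<lambda>x. 2 powr (real j / 2) * (f' (2 ^ j * x - of_int k) * 2 ^ j))"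
    by (intro continuous_intros continuous_on_compose2[OF *(1)]) auto
  ultimately show ?thesis unfolding C1_fun_def by blast
qed

lemma C1_fun_continuous: "C1_fun f \<Longrightarrow> continuous_on S f"
  unfolding C1_fun_def
  by (metis DERIV_continuous_on DERIV_subset UNIV_I continuous_on_subset subset_UNIV)

lemma C1_spline_continuous: "C1_spline N f \<Longrightarrow> continuous_on S f"
  by (simp add: C1_spline_def C1_fun_continuous)

lemma C1_spline_zero: "C1_spline N (\<lambda>x. 0)"
  by (auto simp: C1_spline_def C1_fun_def intro!: exI[of _ "\<lambda>_. 0"] exI[of _ 0])

lemma C1_spline_lincomb:
  assumes "C1_spline N f" "C1_spline N g"
  shows "C1_spline N (\<lambda>x. c * f x + g x)"
  unfolding C1_spline_def
proof (intro conjI allI)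
  show "C1_fun (\<lambda>x. c * f x + g x)" using assms by (auto simp: C1_spline_def intro: C1_fun_lincomb)
  fix k :: int
  from assms obtain p q where "degree p \<le> 3" "\<forall>x\<in>{of_int k / 2 ^ N..of_int (k + 1) / 2 ^ N}. f x = poly p x"
    "degree q \<le> 3" "\<forall>x\<in>{of_int k / 2 ^ N..of_int (k + 1) / 2 ^ N}. g x = poly q x"
    unfolding C1_spline_def by blast
  thus "\<exists>p. degree p \<le> 3 \<and> (\<forall>x\<in>{of_int k / 2 ^ N..of_int (k + 1) / 2 ^ N}. c * f x + g x = poly p x)"
    by (intro exI[of _ "smult c p + q"] conjI)
      (auto intro!: degree_add_le order.trans[OF degree_smult_le])
qed

lemma C1_spline_mono:
  assumes "C1_spline N f" "N \<le> N'"
  shows "C1_spline N' f"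
  unfolding C1_spline_def
proof (intro conjI allI)
  show "C1_fun f" using assms by (simp add: C1_spline_def)
  fix k :: int
  define e where "e = (2::int) ^ (N' - N)"
  \<comment> \<open>The coarse interval containing the fine interval number \<open>k\<close> has
    number \<open>k div e\<close>.\<close>
  define m where "m = k div e"
  have e: "e > 0" by (simp add: e_def)
  have "e * m \<le> k" unfolding m_def using e
    by (metis mod_div_decomp mult.commute add.commute add_increasing pos_mod_sign order_refl)
  moreover have "k + 1 \<le> e * (m + 1)"
  proof -
    have "k = e * m + k mod e" by (simp add: m_def)
    moreover have "k mod e < e" using e by simp
    ultimately show ?thesis by (simp add: distrib_left)
  qed
  moreover have p: "(2::real) ^ N' = of_int e * 2 ^ N"
    using assms(2) by (simp add: e_def flip: power_add)
  ultimately have "real_of_int (e * m) \<le> of_int k" "real_of_int (k + 1) \<le> of_int (e * (m + 1))"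
    by (simp_all only: of_int_le_iff)
  moreover have "real_of_int l / 2 ^ N = of_int (e * l) / 2 ^ N'" for l
    using e by (simp add: p)
  ultimately have "real_of_int m / 2 ^ N \<le> of_int k / 2 ^ N'"
    "of_int (k + 1) / 2 ^ N' \<le> real_of_int (m + 1) / 2 ^ N"
    by (simp_all only: divide_right_mono zero_le_power zero_le_numeral)
  hence sub: "{of_int k / 2 ^ N'..of_int (k + 1) / 2 ^ N'} \<subseteq> {real_of_int m / 2 ^ N..of_int (m + 1) / 2 ^ N}"
    by simp
  from assms obtain p where "degree p \<le> 3" "\<forall>x\<in>{of_int m / 2 ^ N..of_int (m + 1) / 2 ^ N}. f x = poly p x"
    unfolding C1_spline_def by blast
  thus "\<exists>p. degree p \<le> 3 \<and> (\<forall>x\<in>{of_int k / 2 ^ N'..of_int (k + 1) / 2 ^ N'}. f x = poly p x)"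
    using sub by blast
qed

lemma C1_spline_dilate:
  assumes "C1_spline N f"
  shows "C1_spline (N + j) (dilate j k f)"
  unfolding C1_spline_def
proof (intro conjI allI)
  show "C1_fun (dilate j k f)" using assms by (simp add: C1_spline_def C1_fun_dilate)
  fix m :: int
  define l where "l = m - k * 2 ^ N"
  from assms obtain p where p: "degree p \<le> 3"
    "\<And>x. of_int l / 2 ^ N \<le> x \<Longrightarrow> x \<le> of_int (l + 1) / 2 ^ N \<Longrightarrow> f x = poly p x"
    unfolding C1_spline_def by (metis atLeastAtMost_iff)
  let ?q = "smult (2 powr (real j / 2)) (pcompose p [:- of_int k, 2 ^ j:])"
  have "degree ?q \<le> 3"
    using p(1) by (intro order.trans[OF degree_smult_le]) (simp add: degree_pcompose)
  moreover have "dilate j k f x = poly ?q x"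
    if "x \<in> {of_int m / 2 ^ (N + j)..of_int (m + 1) / 2 ^ (N + j)}" for x
  proof -
    have "of_int l / 2 ^ N \<le> 2 ^ j * x - of_int k \<and> 2 ^ j * x - of_int k \<le> of_int (l + 1) / 2 ^ N"
      using that by (simp add: l_def field_simps power_add)
    thus ?thesis using p(2) by (simp add: dilate_def poly_pcompose algebra_simps)
  qed
  ultimately show "\<exists>p. degree p \<le> 3 \<and>
      (\<forall>x\<in>{of_int m / 2 ^ (N + j)..of_int (m + 1) / 2 ^ (N + j)}. dilate j k f x = poly p x)" by blast
qed

lemma fspan_C1_spline:
  assumes "f \<in> fspan S" "\<And>s. s \<in> S \<Longrightarrow> C1_spline N s"
  shows "C1_spline N f"
  using assms(1)
proof (induction rule: fspan_induct)
  case (step c g h)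
  thus ?case using assms(2) by (intro C1_spline_lincomb)
qed (simp add: C1_spline_zero)

lemma continuous_compact_square_integrable:
  assumes "continuous_on UNIV f" "supp_in a b f"
  shows "sqint f"
proof -
  have "integrable lborel (\<lambda>x. indicator {a..b} x *\<^sub>R (f x)\<^sup>2)"
    by (intro borel_integrable_compact continuous_intros continuous_on_subset[OF assms(1)]) auto
  moreover have "(\<lambda>x. indicator {a..b} x *\<^sub>R (f x)\<^sup>2) = (\<lambda>x. (f x)\<^sup>2)"
    using assms(2) by (fastforce simp: supp_in_def fun_eq_iff indicator_def)
  moreover have "f \<in> borel_measurable lborel"
    using assms(1) by (simp add: borel_measurable_continuous_onI)
  ultimately show ?thesis by (simp add: square_integrable_def)
qed

lemma C1_spline_square_integrable: "C1_spline N f \<Longrightarrow> supp_in a b f \<Longrightarrow> sqint f"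
  by (rule continuous_compact_square_integrable[OF C1_spline_continuous])

lemma has_real_derivative_glue:
  assumes "(g has_real_derivative D) (at a)" "(h has_real_derivative D) (at a)" "g a = h a"
  shows "((\<lambda>x. if x \<le> a then g x else h x) has_real_derivative D) (at a)"
proof -
  let ?f = "\<lambda>x. if x \<le> a then g x else h x"
  have "((\<lambda>y. (?f y - ?f a) / (y - a)) \<longlongrightarrow> D) (at_left a)"
  proof (rule Lim_transform_eventually)
    show "((\<lambda>y. (g y - g a) / (y - a)) \<longlongrightarrow> D) (at_left a)"
      using assms(1) by (auto simp: has_field_derivative_iff intro: filterlim_mono at_le)
    show "\<forall>\<^sub>F y in at_left a. (g y - g a) / (y - a) = (?f y - ?f a) / (y - a)"
      by (auto simp: eventually_at_filter)
  qed
  moreover have "((\<lambda>y. (?f y - ?f a) / (y - a)) \<longlongrightarrow> D) (at_right a)"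
  proof (rule Lim_transform_eventually)
    show "((\<lambda>y. (h y - h a) / (y - a)) \<longlongrightarrow> D) (at_right a)"
      using assms(2) by (auto simp: has_field_derivative_iff intro: filterlim_mono at_le)
    show "\<forall>\<^sub>F y in at_right a. (h y - h a) / (y - a) = (?f y - ?f a) / (y - a)"
      using assms(3) by (auto simp: eventually_at_filter)
  qed
  ultimately show ?thesis
    unfolding has_field_derivative_iff by (intro filterlim_split_at)
qed

text \<open>The right piece only has to be \<open>C1_fun\<close>, so the result can serve as
  \<open>h\<close> again and a spline is assembled from right to left.\<close>

lemma C1_fun_glue:
  assumes g: "continuous_on UNIV g'" "\<And>x. (g has_real_derivative g' x) (at x)"
    and h: "C1_fun h" "(h has_real_derivative g' a) (at a)"
    and eq: "g a = h a"
  shows "C1_fun (\<lambda>x. if x \<le> a then g x else h x)"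
proof -
  from h obtain h' where h': "continuous_on UNIV h'" "\<And>x. (h has_real_derivative h' x) (at x)"
    unfolding C1_fun_def by blast
  have ha: "h' a = g' a" using h'(2) h(2) DERIV_unique by blast
  have "continuous_on UNIV (\<lambda>x. if x \<le> a then g' x else h' x)"
  proof -
    have "continuous_on ({..a} \<union> {a..}) (\<lambda>x. if x \<le> a then g' x else h' x)"
      using ha by (intro continuous_on_cases continuous_on_subset[OF g(1)] continuous_on_subset[OF h'(1)]) auto
    moreover have "{..a} \<union> {a..} = (UNIV :: real set)" by auto
    ultimately show ?thesis by simp
  qed
  moreover have "((\<lambda>x. if x \<le> a then g x else h x) has_real_derivative
      (if x \<le> a then g' x else h' x)) (at x)" for x
  proof (cases x a rule: linorder_cases)
    case less
    have "\<forall>\<^sub>F y in nhds x. (if y \<le> a then g y else h y) = g y"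
      using less by (intro eventually_mono[OF eventually_nhds_in_open[of "{..<a}"]]) auto
    thus ?thesis using less g(2)[of x] by (subst DERIV_cong_ev[OF refl _ refl]) auto
  next
    case equal
    thus ?thesis using g(2)[of a] h(2) eq by (auto intro: has_real_derivative_glue)
  next
    case greater
    have "\<forall>\<^sub>F y in nhds x. (if y \<le> a then g y else h y) = h y"
      using greater by (intro eventually_mono[OF eventually_nhds_in_open[of "{a<..}"]]) auto
    thus ?thesis using greater h'(2)[of x] by (subst DERIV_cong_ev[OF refl _ refl]) auto
  qed
  ultimately show ?thesis unfolding C1_fun_def by blast
qed

text \<open>The difference quotients taken from the outer side are all zero, and an existing
  derivative equals its one-sided limits.\<close>

lemma supp_in_derivative_zero:
  assumes "supp_in a b f" "(f has_real_derivative D) (at x)" "x \<le> a \<or> b \<le> x"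
  shows "D = 0"
proof -
  let ?F = "if x \<le> a then at_left x else at_right x"
  have nb: "?F \<noteq> bot" by (simp add: trivial_limit_at_left_real trivial_limit_at_right_real)
  have "((\<lambda>y. (f y - f x) / (y - x)) \<longlongrightarrow> D) ?F"
    using assms(2) unfolding has_field_derivative_iff by (rule filterlim_mono) (auto simp: at_le)
  moreover have "f x = 0" using assms(1,3) unfolding supp_in_def by fastforce
  hence "\<forall>\<^sub>F y in ?F. (f y - f x) / (y - x) = 0"
  proof (cases "x \<le> a")
    case True
    hence "f y = 0" if "y < x" for y using assms(1) that unfolding supp_in_def by force
    thus ?thesis using True \<open>f x = 0\<close> by (simp add: eventually_at_filter)
  next
    case False
    hence "f y = 0" if "y > x" for y using assms(1,3) that unfolding supp_in_def by force
    thus ?thesis using False \<open>f x = 0\<close> by (simp add: eventually_at_filter)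
  qed
  hence "((\<lambda>y. (f y - f x) / (y - x)) \<longlongrightarrow> 0) ?F" by (rule tendsto_eventually)
  ultimately show ?thesis using tendsto_unique[OF nb] by blast
qed

section \<open>The Hermite cubic splines\<close>

text \<open>Nested conditionals of the form that \<open>C1_fun_glue\<close> produces; the zero piece
  may own the point \<open>-1\<close> because the cubic vanishes there.\<close>

lemma xi_gen_1_glue: "xi_gen (Suc 0) = (\<lambda>x. if x \<le> - 1 then 0 else if x \<le> 0 then (x + 1)\<^sup>2 * (1 - 2 * x)
    else if x \<le> 1 then (1 - x)\<^sup>2 * (1 + 2 * x) else 0)"
  by (auto simp: xi_gen_def fun_eq_iff)

lemma xi_gen_2_glue: "l \<noteq> Suc 0 \<Longrightarrow> xi_gen l = (\<lambda>x. if x \<le> - 1 then 0 else if x \<le> 0 then (x + 1)\<^sup>2 * x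
    else if x \<le> 1 then (1 - x)\<^sup>2 * x else 0)"
  by (auto simp: xi_gen_def fun_eq_iff)

lemma C1_fun_zero: "C1_fun (\<lambda>x. 0)"
  by (auto simp: C1_fun_def intro!: exI[of _ "\<lambda>_. 0"])

lemma C1_fun_xi_gen: "C1_fun (xi_gen l)"
proof (cases "l = Suc 0")
  case True
  have 1: "C1_fun (\<lambda>x. if x \<le> 1 then (1 - x)\<^sup>2 * (1 + 2 * x) else 0)"
    by (rule C1_fun_glue[where g' = "\<lambda>x. - 6 * x * (1 - x)", OF _ _ C1_fun_zero])
      (auto intro!: continuous_intros derivative_eq_intros simp: power2_eq_square algebra_simps)
  have d1: "((\<lambda>x. if x \<le> 1 then (1 - x)\<^sup>2 * (1 + 2 * x) else 0) has_real_derivative 0) (at 0)"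
    using DERIV_cong_ev[of 0 0 "\<lambda>x. if x \<le> 1 then (1 - x)\<^sup>2 * (1 + 2 * x) else 0" "\<lambda>x::real. (1 - x)\<^sup>2 * (1 + 2 * x)" 0 0]
      eventually_mono[OF eventually_nhds_in_open[of "{..<1::real}" 0]]
    by (force intro!: derivative_eq_intros simp: power2_eq_square)
  have 2: "C1_fun (\<lambda>x. if x \<le> 0 then (x + 1)\<^sup>2 * (1 - 2 * x) else if x \<le> 1 then (1 - x)\<^sup>2 * (1 + 2 * x) else 0)"
    by (rule C1_fun_glue[where g' = "\<lambda>x. - 6 * x * (1 + x)", OF _ _ 1])
      (use d1 in \<open>auto intro!: continuous_intros derivative_eq_intros simp: power2_eq_square algebra_simps\<close>)
  have d2: "((\<lambda>x. if x \<le> 0 then (x + 1)\<^sup>2 * (1 - 2 * x) else if x \<le> 1 then (1 - x)\<^sup>2 * (1 + 2 * x) else 0)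
      has_real_derivative 0) (at (- 1))"
    using DERIV_cong_ev[of "- 1" "- 1" "\<lambda>x. if x \<le> 0 then (x + 1)\<^sup>2 * (1 - 2 * x) else if x \<le> 1 then (1 - x)\<^sup>2 * (1 + 2 * x) else 0"
        "\<lambda>x::real. (x + 1)\<^sup>2 * (1 - 2 * x)" 0 0]
      eventually_mono[OF eventually_nhds_in_open[of "{..<0::real}" "- 1"]]
    by (force intro!: derivative_eq_intros simp: power2_eq_square)
  show ?thesis unfolding True xi_gen_1_glue
    by (rule C1_fun_glue[where g' = "\<lambda>x. 0", OF _ _ 2]) (use d2 in auto)
next
  case False
  have 1: "C1_fun (\<lambda>x. if x \<le> 1 then (1 - x)\<^sup>2 * x else 0)"
    by (rule C1_fun_glue[where g' = "\<lambda>x. (1 - x) * (1 - 3 * x)", OF _ _ C1_fun_zero])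
      (auto intro!: continuous_intros derivative_eq_intros simp: power2_eq_square algebra_simps)
  have d1: "((\<lambda>x. if x \<le> 1 then (1 - x)\<^sup>2 * x else 0) has_real_derivative 1) (at 0)"
    using DERIV_cong_ev[of 0 0 "\<lambda>x. if x \<le> 1 then (1 - x)\<^sup>2 * x else 0" "\<lambda>x::real. (1 - x)\<^sup>2 * x" 1 1]
      eventually_mono[OF eventually_nhds_in_open[of "{..<1::real}" 0]]
    by (force intro!: derivative_eq_intros simp: power2_eq_square)
  have 2: "C1_fun (\<lambda>x. if x \<le> 0 then (x + 1)\<^sup>2 * x else if x \<le> 1 then (1 - x)\<^sup>2 * x else 0)"
    by (rule C1_fun_glue[where g' = "\<lambda>x. (1 + x) * (1 + 3 * x)", OF _ _ 1])
      (use d1 in \<open>auto intro!: continuous_intros derivative_eq_intros simp: power2_eq_square algebra_simps\<close>)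
  have d2: "((\<lambda>x. if x \<le> 0 then (x + 1)\<^sup>2 * x else if x \<le> 1 then (1 - x)\<^sup>2 * x else 0)
      has_real_derivative 0) (at (- 1))"
    using DERIV_cong_ev[of "- 1" "- 1" "\<lambda>x. if x \<le> 0 then (x + 1)\<^sup>2 * x else if x \<le> 1 then (1 - x)\<^sup>2 * x else 0"
        "\<lambda>x::real. (x + 1)\<^sup>2 * x" 0 0]
      eventually_mono[OF eventually_nhds_in_open[of "{..<0::real}" "- 1"]]
    by (force intro!: derivative_eq_intros simp: power2_eq_square)
  show ?thesis unfolding xi_gen_2_glue[OF False]
    by (rule C1_fun_glue[where g' = "\<lambda>x. 0", OF _ _ 2]) (use d2 in auto)
qed

lemma xi_gen_has_derivative_0: "(xi_gen l has_real_derivative (if l = 1 then 0 else 1)) (at 0)"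
proof (cases "l = Suc 0")
  case True
  have *: "((\<lambda>x. if x \<le> 0 then (x + 1)\<^sup>2 * (1 - 2 * x) else (1 - x)\<^sup>2 * (1 + 2 * x)) has_real_derivative 0) (at 0)"
    by (rule has_real_derivative_glue) (auto intro!: derivative_eq_intros simp: power2_eq_square)
  have "\<forall>\<^sub>F y in nhds 0. xi_gen l y = (if y \<le> 0 then (y + 1)\<^sup>2 * (1 - 2 * y) else (1 - y)\<^sup>2 * (1 + 2 * y))"
    by (rule eventually_mono[OF eventually_nhds_in_open[of "{-1<..<1}"]]) (auto simp: True xi_gen_1_glue)
  thus ?thesis using * True by (subst DERIV_cong_ev[OF refl _ refl]) auto
next
  case False
  have *: "((\<lambda>x. if x \<le> 0 then (x + 1)\<^sup>2 * x else (1 - x)\<^sup>2 * x) has_real_derivative 1) (at 0)"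
    by (rule has_real_derivative_glue) (auto intro!: derivative_eq_intros simp: power2_eq_square)
  have "\<forall>\<^sub>F y in nhds 0. xi_gen l y = (if y \<le> 0 then (y + 1)\<^sup>2 * y else (1 - y)\<^sup>2 * y)"
    by (rule eventually_mono[OF eventually_nhds_in_open[of "{-1<..<1}"]]) (auto simp: xi_gen_2_glue[OF False])
  thus ?thesis using * False by (subst DERIV_cong_ev[OF refl _ refl]) auto
qed

lemma supp_in_xi_gen: "supp_in (- 1) 1 (xi_gen l)"
  unfolding supp_in_def by (auto simp: xi_gen_def not_less split: if_splits)

lemma C1_spline_xi_gen: "C1_spline 0 (xi_gen l)"
  unfolding C1_spline_def
proof (intro conjI allI C1_fun_xi_gen)
  fix k :: int
  consider "k = - 1" | "k = 0" | "k \<ge> 1" | "k \<le> - 2" by linarith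
  thus "\<exists>p. degree p \<le> 3 \<and> (\<forall>x\<in>{of_int k / 2 ^ 0..of_int (k + 1) / 2 ^ 0}. xi_gen l x = poly p x)"
  proof cases
    case 1
    thus ?thesis
      by (intro exI[of _ "if l = 1 then [:1, 0, -3, -2:] else [:0, 1, 2, 1:]"])
        (auto simp: xi_gen_def power2_eq_square algebra_simps)
  next
    case 2
    thus ?thesis
      by (intro exI[of _ "if l = 1 then [:1, 0, -3, 2:] else [:0, 1, -2, 1:]"])
        (auto simp: xi_gen_def power2_eq_square algebra_simps)
  next
    case 3
    have "xi_gen l x = 0" if "x \<ge> of_int k" for x
      using supp_in_xi_gen[of l] that 3 unfolding supp_in_def by force
    thus ?thesis by (intro exI[of _ 0]) auto
  next
    case 4
    have "xi_gen l x = 0" if "x \<le> of_int (k + 1)" for x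
      using supp_in_xi_gen[of l] that 4 unfolding supp_in_def by force
    thus ?thesis by (intro exI[of _ 0]) auto
  qed
qed

text \<open>Hermite interpolation at the knots \<open>m / 2\<close>, \<open>m = -1, 0, 1\<close>:
  the coefficient of \<open>xi_gen 1 (2 * x - m)\<close> is the value at the knot, that of
  \<open>xi_gen 2 (2 * x - m)\<close> half the derivative. The coefficients in
  \<open>xi_gen_2_refine\<close> arise in the same way.\<close>

lemma xi_gen_1_refine: "xi_gen 1 x = xi_gen 1 (2 * x) + 1/2 * xi_gen 1 (2 * x - 1) - 3/4 * xi_gen 2 (2 * x - 1)
    + 1/2 * xi_gen 1 (2 * x + 1) + 3/4 * xi_gen 2 (2 * x + 1)"
proof -
  consider "x < -1" | "-1 \<le> x" "x < -1/2" | "x = -1/2" | "-1/2 < x" "x < 0" | "x = 0" | "0 < x" "x < 1/2"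
    | "x = 1/2" | "1/2 < x" "x \<le> 1" | "1 < x" by linarith
  thus ?thesis by cases (simp_all add: xi_gen_def power2_eq_square field_simps)
qed

lemma xi_gen_2_refine: "xi_gen 2 x = 1/2 * xi_gen 2 (2 * x) + 1/8 * xi_gen 1 (2 * x - 1) - 1/8 * xi_gen 2 (2 * x - 1)
    - 1/8 * xi_gen 1 (2 * x + 1) - 1/8 * xi_gen 2 (2 * x + 1)"
proof -
  consider "x < -1" | "-1 \<le> x" "x < -1/2" | "x = -1/2" | "-1/2 < x" "x < 0" | "x = 0" | "0 < x" "x < 1/2"
    | "x = 1/2" | "1/2 < x" "x \<le> 1" | "1 < x" by linarith
  thus ?thesis
  proof cases
    case 3
    show ?thesis unfolding 3 by (simp add: xi_gen_def power2_eq_square)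
  next
    case 7
    show ?thesis unfolding 7 by (simp add: xi_gen_def power2_eq_square)
  qed (simp_all add: xi_gen_def power2_eq_square field_simps)
qed

lemma C1_spline_xi: "C1_spline j (\<xi> j n)"
  using C1_spline_dilate[OF C1_spline_xi_gen, of j] by (simp add: \<xi>_def)

lemma supp_in_xi: "supp_in (of_int (n div 2 - 1) / 2 ^ j) (of_int (n div 2 + 1) / 2 ^ j) (\<xi> j n)"
  using supp_in_dilate[OF supp_in_xi_gen, of "n div 2" j] by (simp add: \<xi>_def add.commute)

lemma square_integrable_xi: "sqint (\<xi> j n)"
  by (rule C1_spline_square_integrable[OF C1_spline_xi supp_in_xi])

lemma dilate_xi: "dilate i k (\<xi> j n) = \<xi> (j + i) (n + 2 * 2 ^ j * k)"
  by (simp add: \<xi>_def dilate_dilate mult.assoc add.commute)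

lemma xi_even: "\<xi> j (2 * k) = dilate j k (xi_gen 1)"
  by (simp add: \<xi>_def)

lemma xi_odd: "\<xi> j (2 * k + 1) = dilate j k (xi_gen 2)"
  by (simp add: \<xi>_def numeral_2_eq_2)

lemma xi_gen_in_fspan:
  assumes "l \<in> {1, 2}"
  shows "xi_gen l \<in> fspan (\<xi> 1 ` {-2..3})"
proof -
  define r where "r = (2::real) powr (1/2)"
  have r: "r \<noteq> 0" by (simp add: r_def)
  have e: "xi_gen 1 (2 * x) = \<xi> 1 0 x / r" "xi_gen 2 (2 * x) = \<xi> 1 1 x / r"
    "xi_gen 1 (2 * x - 1) = \<xi> 1 2 x / r" "xi_gen 2 (2 * x - 1) = \<xi> 1 3 x / r"
    "xi_gen 1 (2 * x + 1) = \<xi> 1 (-2) x / r" "xi_gen 2 (2 * x + 1) = \<xi> 1 (-1) x / r" for x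
    using r xi_even[of 1 0] xi_odd[of 1 0] xi_even[of 1 1] xi_odd[of 1 1] xi_even[of 1 "-1"] xi_odd[of 1 "-1"]
    by (simp_all add: dilate_def r_def)
  have 1: "xi_gen 1 = (\<lambda>x. \<xi> 1 0 x / r + 1/2 * (\<xi> 1 2 x / r) - 3/4 * (\<xi> 1 3 x / r)
      + 1/2 * (\<xi> 1 (-2) x / r) + 3/4 * (\<xi> 1 (-1) x / r))"
    by (rule ext) (subst xi_gen_1_refine, simp only: e)
  have 2: "xi_gen 2 = (\<lambda>x. 1/2 * (\<xi> 1 1 x / r) + 1/8 * (\<xi> 1 2 x / r) - 1/8 * (\<xi> 1 3 x / r)
      - 1/8 * (\<xi> 1 (-2) x / r) - 1/8 * (\<xi> 1 (-1) x / r))"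
    by (rule ext) (subst xi_gen_2_refine, simp only: e)
  have b: "\<xi> 1 n \<in> fspan (\<xi> 1 ` {-2..3})" if "-2 \<le> n" "n \<le> 3" for n
    using that by (intro fspan_base) auto
  have "xi_gen 1 \<in> fspan (\<xi> 1 ` {-2..3})"
    unfolding 1 by (intro fspan_add fspan_diff fspan_cmult fspan_divide b) auto
  moreover have "xi_gen 2 \<in> fspan (\<xi> 1 ` {-2..3})"
    unfolding 2 by (intro fspan_add fspan_diff fspan_cmult fspan_divide b) auto
  ultimately show ?thesis using assms by auto
qed

lemma xi_refine: "\<xi> j n \<in> fspan (\<xi> (Suc j) ` {4 * (n div 2) - 2..4 * (n div 2) + 3})"
proof -
  have "nat (n mod 2) + 1 \<in> {1, 2}" by auto
  from fspan_dilate[OF xi_gen_in_fspan[OF this], of j "n div 2"]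
  have "\<xi> j n \<in> fspan (dilate j (n div 2) ` \<xi> 1 ` {-2..3})" by (simp add: \<xi>_def)
  thus ?thesis by (rule fspan_mono[rotated]) (auto simp: dilate_xi)
qed

text \<open>On each \<open>[k, k + 1]\<close> a cubic is determined by its values and derivatives at
  the two ends. The range \<open>[-2, 2]\<close> is what remains of the wavelet support
  \<open>(-1, 1)\<close> after the knots in steps of one half have been scaled to integers.\<close>

lemma hermite_reproduces_cubic:
  fixes p :: "real poly"
  assumes "degree p \<le> 3" "-2 \<le> y" "y \<le> 2"
  shows "poly p y = (\<Sum>k\<in>{-2..2::int}. poly p (of_int k) * xi_gen 1 (y - of_int k)
           + poly (pderiv p) (of_int k) * xi_gen 2 (y - of_int k))"
proof -
  define a b c d where abcd: "a = coeff p 0" "b = coeff p 1" "c = coeff p 2" "d = coeff p 3"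
  have p: "p = [:a, b, c, d:]"
  proof (rule poly_eqI)
    fix n
    show "coeff p n = coeff [:a, b, c, d:] n"
    proof (cases "n \<le> 3")
      case True
      hence "n = 0 \<or> n = 1 \<or> n = 2 \<or> n = 3" by auto
      thus ?thesis by (auto simp: abcd numeral_2_eq_2 numeral_3_eq_3)
    next
      case False
      hence "coeff p n = 0" using assms(1) by (intro coeff_eq_0) auto
      moreover have "coeff [:a, b, c, d:] n = 0"
        using False by (intro coeff_eq_0) (auto intro: order.strict_trans1[OF degree_pCons_le])
      ultimately show ?thesis by simp
    qed
  qed
  have s: "{-2..2::int} = {-2, -1, 0, 1, 2}" by auto
  consider "y = -2" | "-2 < y" "y < -1" | "y = -1" | "-1 < y" "y < 0" | "y = 0" | "0 < y" "y < 1"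
    | "y = 1" | "1 < y" "y < 2" | "y = 2" using assms(2,3) by linarith
  thus ?thesis
    unfolding s p by cases (simp_all add: xi_gen_def pderiv_pCons power2_eq_square algebra_simps)
qed

section \<open>The scaling functions on the line\<close>

text \<open>Otherwise the indices in \<open>\<phi> 1\<close> and \<open>\<xi> 1 n\<close> are rewritten to \<open>Suc 0\<close>.\<close>

declare One_nat_def [simp del]

lemma l2_normalize_alt: "l2_normalize f = (\<lambda>x. (1 / l2_norm lborel f) * f x)"
  by (simp add: l2_normalize_def)

lemma l2_inner_normalize_left: "l2ip (l2_normalize f) g = l2ip f g / l2_norm lborel f"
  unfolding l2_normalize_alt l2_inner_cmult_left by simp

lemma l2_inner_normalize_right: "l2ip g (l2_normalize f) = l2ip g f / l2_norm lborel f"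
  unfolding l2_normalize_alt l2_inner_cmult_right by simp

lemma l2_inner_normalize_self:
  assumes "l2ip f f \<noteq> 0"
  shows "l2ip (l2_normalize f) (l2_normalize f) = 1"
  using assms
  by (simp add: l2_inner_normalize_left l2_inner_normalize_right l2_norm_square power2_eq_square[symmetric])

lemma square_integrable_normalize: "sqint f \<Longrightarrow> sqint (l2_normalize f)"
  unfolding l2_normalize_alt by (rule square_integrable_cmult)

lemma fspan_normalize: "f \<in> fspan S \<Longrightarrow> l2_normalize f \<in> fspan S"
  unfolding l2_normalize_alt by (rule fspan_cmult)

lemma fspan_normalize_inverse:
  assumes "l2ip f f \<noteq> 0"
  shows "f \<in> fspan {l2_normalize f}"
proof -
  have "f = (\<lambda>x. l2_norm lborel f * l2_normalize f x)"
    using assms by (auto simp: l2_normalize_def l2_norm_def)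
  thus ?thesis by (metis fspan_base fspan_cmult insertI1)
qed

lemma C1_spline_l2_inner_nonzero:
  assumes "C1_spline N f" "sqint f" "f x \<noteq> 0"
  shows "l2ip f f \<noteq> 0"
  using l2_inner_null_continuous[OF assms(2) _ open_UNIV C1_spline_continuous[OF assms(1)], of x] assms(3) by auto

lemma square_integrable_cut:
  assumes "sqint f"
  shows "sqint (cut f)"
proof -
  have "integrable lborel (\<lambda>x. indicator {0..1} x *\<^sub>R (f x)\<^sup>2)"
    using assms by (intro integrable_mult_indicator) (auto simp: square_integrable_def)
  moreover have "(\<lambda>x. indicator {0..1} x *\<^sub>R (f x)\<^sup>2) = (\<lambda>x. (cut f x)\<^sup>2)"
    by (auto simp: cut_def indicator_def fun_eq_iff)
  moreover have "cut f \<in> borel_measurable lborel"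
    using assms unfolding cut_def square_integrable_def
    by (intro borel_measurable_times borel_measurable_indicator) auto
  ultimately show ?thesis by (simp add: square_integrable_def)
qed

text \<open>\<open>xi_gen 1\<close> is even and \<open>xi_gen 2\<close> is odd, so reflection
  negates the integral.\<close>

lemma xi_gen_orthogonal: "l2ip (xi_gen 1) (xi_gen 2) = 0"
proof -
  have "xi_gen 1 (- x) * xi_gen 2 (- x) = - (xi_gen 1 x * xi_gen 2 x)" for x
    by (auto simp: xi_gen_def power2_eq_square algebra_simps)
  hence "(LINT x|lborel. xi_gen 1 (0 + (- 1) * x) * xi_gen 2 (0 + (- 1) * x)) = - l2ip (xi_gen 1) (xi_gen 2)"
    by (simp add: l2_inner_def)
  moreover have "l2ip (xi_gen 1) (xi_gen 2) =
      \<bar>- 1\<bar> *\<^sub>R (LINT x|lborel. xi_gen 1 (0 + (- 1) * x) * xi_gen 2 (0 + (- 1) * x))"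
    unfolding l2_inner_def by (rule lborel_integral_real_affine) simp
  ultimately show ?thesis by simp
qed

text \<open>Uniqueness for \<open>THE\<close> holds for functions, not only almost everywhere: an
  element of \<open>W\<close> is given by two coefficients, and inner products with \<open>u\<close>
  and \<open>v\<close> recover them.\<close>

lemma l2_proj_orthonormal_basis2:
  assumes "orthonormal_basis2 u v W" and [simp]: "sqint u" "sqint v" "sqint f"
  shows "l2_proj W f = (\<lambda>x. l2ip f u * u x + l2ip f v * v x)"
proof -
  have uv: "l2ip u u = 1" "l2ip v v = 1" "l2ip u v = 0" "l2ip v u = 0" and W: "W = fspan {u, v}"
    using assms(1) by (auto simp: orthonormal_basis2_def l2_norm_eq_1_iff l2_inner_commute[of _ v u])
  have res: "l2ip (\<lambda>x. f x - (a * u x + b * v x)) h = l2ip f h - (a * l2ip u h + b * l2ip v h)"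
    if "sqint h" for a b h
    using that by (simp add: l2_inner_diff_left l2_inner_add_left square_integrable_intros l2_inner_cmult_left)
  show ?thesis
    unfolding l2_proj_def
  proof (rule the_equality)
    show "(\<lambda>x. l2ip f u * u x + l2ip f v * v x) \<in> W \<and>
        (\<forall>h\<in>W. l2ip (\<lambda>x. f x - (l2ip f u * u x + l2ip f v * v x)) h = 0)"
    proof (intro conjI ballI)
      show "(\<lambda>x. l2ip f u * u x + l2ip f v * v x) \<in> W"
        unfolding W fspan_pair_iff by blast
      fix h assume "h \<in> W"
      let ?r = "\<lambda>x. f x - (l2ip f u * u x + l2ip f v * v x)"
      have r: "sqint ?r" by (intro square_integrable_diff square_integrable_add square_integrable_cmult) simp_all
      have 0: "l2ip ?r u = 0" "l2ip ?r v = 0" by (simp_all add: res uv)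
      have "l2ip h ?r = 0"
      proof (rule fspan_orthogonal[OF _ _ r])
        show "h \<in> fspan {u, v}" using \<open>h \<in> W\<close> W by simp
        fix s assume "s \<in> {u, v}"
        hence "l2ip ?r s = 0" using 0 by auto
        thus "l2ip s ?r = 0" by (simp add: l2_inner_commute)
      qed auto
      thus "l2ip (\<lambda>x. f x - (l2ip f u * u x + l2ip f v * v x)) h = 0" by (simp add: l2_inner_commute)
    qed
  next
    fix g assume g: "g \<in> W \<and> (\<forall>h\<in>W. l2ip (\<lambda>x. f x - g x) h = 0)"
    then obtain a b where ab: "g = (\<lambda>x. a * u x + b * v x)" unfolding W fspan_pair_iff by blast
    have "u \<in> W" "v \<in> W" unfolding W by (auto intro: fspan_base)
    hence "l2ip (\<lambda>x. f x - (a * u x + b * v x)) u = 0" "l2ip (\<lambda>x. f x - (a * u x + b * v x)) v = 0"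
      using g ab by auto
    hence "a = l2ip f u" "b = l2ip f v" by (simp_all add: res uv)
    thus "g = (\<lambda>x. l2ip f u * u x + l2ip f v * v x)" using ab by simp
  qed
qed

lemma residual_alt: "residual \<phi> m f = (\<lambda>x. f x - (\<Sum>j=1..m. l2ip f (\<phi> j) * \<phi> j x)
     - (\<Sum>j=1..m. l2ip f (dilate 0 (-1) (\<phi> j)) * dilate 0 (-1) (\<phi> j) x))"
  by (simp add: residual_def dilate_0)

lemma fspan_mono_interval:
  fixes b :: "'i::preorder \<Rightarrow> real \<Rightarrow> real"
  shows "f \<in> fspan (b ` {c..d}) \<Longrightarrow> a \<le> c \<Longrightarrow> d \<le> e \<Longrightarrow> f \<in> fspan (b ` {a..e})"
  by (rule fspan_mono[rotated], assumption, rule image_mono) (auto intro: order_trans)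

lemma index6_cases:
  obtains k :: int and l :: nat where "l \<in> {1..6}" "n = 6 * k + int l"
proof
  show "nat ((n - 1) mod 6) + 1 \<in> {1..6}"
    using pos_mod_bound[of 6 "n - 1"] by auto
  show "n = 6 * ((n - 1) div 6) + int (nat ((n - 1) mod 6) + 1)"
    by (simp add: mult_div_mod_eq)
qed

text \<open>Serves \<open>phiR\<close> with \<open>c = 4\<close> and \<open>psiR\<close> with
  \<open>c = 2\<close>. Generators beyond \<open>c\<close> carry an extra unit shift, which cancels
  as soon as the two generators coincide.\<close>

lemma indexed6_inner:
  assumes f: "\<And>l m k. l \<in> {1..6} \<Longrightarrow> m \<in> {1..6} \<Longrightarrow>
      l2ip (f l) (dilate 0 k (f m)) = (if l = m \<and> k = 0 then 1 else 0)"
    and F: "\<And>l k. l \<in> {1..6} \<Longrightarrow> F (6 * k + int l) = dilate j (if l \<le> c then k else k + 1) (f l)"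
  shows "l2ip (F m) (F n) = (if m = n then 1 else 0)"
proof -
  obtain k l k' l' where l: "l \<in> {1..6}" "m = 6 * k + int l" "l' \<in> {1..6}" "n = 6 * k' + int l'"
    by (metis index6_cases)
  let ?c = "\<lambda>l k. if l \<le> c then k else k + 1 :: int"
  have "l2ip (F m) (F n) = l2ip (dilate j 0 (dilate 0 (?c l k) (f l))) (dilate j 0 (dilate 0 (?c l' k') (f l')))"
    unfolding l(2,4) F[OF l(1)] F[OF l(3)] by (simp add: dilate_dilate)
  also have "\<dots> = (if l = l' \<and> ?c l' k' - ?c l k = 0 then 1 else 0)"
    unfolding l2_inner_dilate l2_inner_shift by (rule f[OF l(1,3)])
  also have "(l = l' \<and> ?c l' k' - ?c l k = 0) \<longleftrightarrow> m = n"
  proof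
    assume "m = n"
    hence "6 * (k - k') = int l' - int l" using l by simp
    moreover have "\<bar>int l' - int l\<bar> < 6" using l by auto
    ultimately have "k = k'" by presburger
    thus "l = l' \<and> ?c l' k' - ?c l k = 0" using \<open>m = n\<close> l by simp
  qed (auto simp: l split: if_splits)
  finally show ?thesis .
qed

locale spline_scaling =
  fixes \<phi> :: "nat \<Rightarrow> real \<Rightarrow> real"
  assumes scaling: "scaling_generators \<phi>"
begin

lemma phi_eqs:
  "\<phi> 1 = l2_normalize (\<xi> 1 2)" "\<phi> 2 = l2_normalize (\<xi> 1 3)"
  "\<phi> 5 = l2_normalize (residual \<phi> 4 (\<xi> 1 0))" "\<phi> 6 = l2_normalize (residual \<phi> 5 (\<xi> 1 1))"
  using scaling unfolding scaling_generators_def by blast+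

section \<open>Generators supported in a single cell\<close>

definition W where
  "W = (SOME W. W \<subseteq> A1 \<ominus> A0 \<and> orthonormal_basis2 (\<phi> 3) (\<phi> 4) W \<and>
        (\<forall>f\<in>C0. \<forall>g\<in>C1. l2ip (\<lambda>x. f x - l2_proj W f x) (\<lambda>x. g x - l2_proj W g x) = 0))"

lemma W: "W \<subseteq> A1 \<ominus> A0" "orthonormal_basis2 (\<phi> 3) (\<phi> 4) W"
  "f \<in> C0 \<Longrightarrow> g \<in> C1 \<Longrightarrow> l2ip (\<lambda>x. f x - l2_proj W f x) (\<lambda>x. g x - l2_proj W g x) = 0"
proof -
  have "\<exists>W. W \<subseteq> A1 \<ominus> A0 \<and> orthonormal_basis2 (\<phi> 3) (\<phi> 4) W \<and>
        (\<forall>f\<in>C0. \<forall>g\<in>C1. l2ip (\<lambda>x. f x - l2_proj W f x) (\<lambda>x. g x - l2_proj W g x) = 0)"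
    using scaling unfolding scaling_generators_def by blast
  from someI_ex[OF this, folded W_def]
  show "W \<subseteq> A1 \<ominus> A0" "orthonormal_basis2 (\<phi> 3) (\<phi> 4) W"
    "f \<in> C0 \<Longrightarrow> g \<in> C1 \<Longrightarrow> l2ip (\<lambda>x. f x - l2_proj W f x) (\<lambda>x. g x - l2_proj W g x) = 0"
    by blast+
qed

lemma phi_34: "l \<in> {3, 4} \<Longrightarrow> \<phi> l \<in> A1" "l \<in> {3, 4} \<Longrightarrow> g \<in> A0 \<Longrightarrow> l2ip (\<phi> l) g = 0"
proof -
  have "\<phi> 3 \<in> W" "\<phi> 4 \<in> W" using W(2) by (auto simp: orthonormal_basis2_def intro: fspan_base)
  thus "l \<in> {3, 4} \<Longrightarrow> \<phi> l \<in> A1" "l \<in> {3, 4} \<Longrightarrow> g \<in> A0 \<Longrightarrow> l2ip (\<phi> l) g = 0"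
    using W(1) by (auto simp: l2_minus_def)
qed

lemma xi_A0_nonzero: "l2ip (\<xi> 1 2) (\<xi> 1 2) \<noteq> 0" "l2ip (\<xi> 1 3) (\<xi> 1 3) \<noteq> 0"
proof -
  \<comment> \<open>The centre \<open>1/2\<close> works for the first function only; the second
    vanishes there and is evaluated halfway to its right end.\<close>
  have "\<xi> 1 2 (1/2) \<noteq> 0" "\<xi> 1 3 (3/4) \<noteq> 0"
    using xi_even[of 1 1] xi_odd[of 1 1] by (simp_all add: dilate_def xi_gen_def)
  thus "l2ip (\<xi> 1 2) (\<xi> 1 2) \<noteq> 0" "l2ip (\<xi> 1 3) (\<xi> 1 3) \<noteq> 0"
    by (intro C1_spline_l2_inner_nonzero[OF C1_spline_xi square_integrable_xi]; simp)+
qed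

lemma xi_A0_orthogonal: "l2ip (\<xi> 1 2) (\<xi> 1 3) = 0"
  using xi_even[of 1 1] xi_odd[of 1 1] xi_gen_orthogonal by (simp add: l2_inner_dilate)

lemma phi_12_A0: "l \<in> {1, 2} \<Longrightarrow> \<phi> l \<in> A0"
proof -
  have "\<phi> 1 \<in> A0" "\<phi> 2 \<in> A0"
    unfolding phi_eqs(1,2) A0_def by (intro fspan_normalize fspan_base; simp)+
  thus "l \<in> {1, 2} \<Longrightarrow> \<phi> l \<in> A0" by auto
qed

lemma A0_subset_A1: "f \<in> A0 \<Longrightarrow> f \<in> A1"
  unfolding A0_def A1_def
  using xi_refine[of 1 2] xi_refine[of 1 3] by (elim fspan_trans) (auto simp: numeral_2_eq_2)

lemma phi_A1: "l \<in> {1..4} \<Longrightarrow> \<phi> l \<in> A1"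
proof -
  assume "l \<in> {1..4}"
  hence "l \<in> {1, 2} \<or> l \<in> {3, 4}" by auto
  thus ?thesis using phi_12_A0 A0_subset_A1 phi_34(1) by blast
qed

lemma A1_C1_spline: "f \<in> A1 \<Longrightarrow> C1_spline 2 f"
  unfolding A1_def by (erule fspan_C1_spline) (auto simp: C1_spline_xi)

lemma A1_supp_in: "f \<in> A1 \<Longrightarrow> supp_in 0 1 f"
  unfolding A1_def
proof (erule fspan_supp_in)
  fix s assume "s \<in> \<xi> 2 ` {2..7}"
  then obtain n where n: "s = \<xi> 2 n" "2 \<le> n" "n \<le> 7" by auto
  hence "1 \<le> n div 2" "n div 2 \<le> 3" by auto
  hence "0 \<le> real_of_int (n div 2 - 1)" "real_of_int (n div 2 + 1) \<le> 4" by linarith+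
  thus "supp_in 0 1 s" unfolding n(1) by (intro supp_in_mono[OF supp_in_xi]) auto
qed

lemma A1_square_integrable: "f \<in> A1 \<Longrightarrow> sqint f"
  using C1_spline_square_integrable A1_C1_spline A1_supp_in by blast

lemma phi_inner_14:
  assumes "l \<in> {1..4}" "m \<in> {1..4}"
  shows "l2ip (\<phi> l) (\<phi> m) = (if l = m then 1 else 0)"
proof -
  have 1: "l2ip (\<phi> 1) (\<phi> 1) = 1" "l2ip (\<phi> 2) (\<phi> 2) = 1"
    unfolding phi_eqs(1,2) by (intro l2_inner_normalize_self xi_A0_nonzero)+
  have 2: "l2ip (\<phi> 1) (\<phi> 2) = 0"
    unfolding phi_eqs(1,2) l2_inner_normalize_left l2_inner_normalize_right xi_A0_orthogonal by simp
  have 3: "l2ip (\<phi> 3) (\<phi> 3) = 1" "l2ip (\<phi> 4) (\<phi> 4) = 1" "l2ip (\<phi> 3) (\<phi> 4) = 0"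
    using W(2) by (auto simp: orthonormal_basis2_def l2_norm_eq_1_iff)
  have 4: "l2ip (\<phi> 3) (\<phi> 1) = 0" "l2ip (\<phi> 3) (\<phi> 2) = 0" "l2ip (\<phi> 4) (\<phi> 1) = 0" "l2ip (\<phi> 4) (\<phi> 2) = 0"
    by (intro phi_34(2) phi_12_A0; simp)+
  have c: "l \<in> {1, 2, 3, 4}" "m \<in> {1, 2, 3, 4}" using assms by auto
  have 5: "l2ip (\<phi> 2) (\<phi> 1) = 0" "l2ip (\<phi> 4) (\<phi> 3) = 0" "l2ip (\<phi> 1) (\<phi> 3) = 0"
    "l2ip (\<phi> 2) (\<phi> 3) = 0" "l2ip (\<phi> 1) (\<phi> 4) = 0" "l2ip (\<phi> 2) (\<phi> 4) = 0"
    using 2 3 4 by (simp_all only: l2_inner_commute)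
  show ?thesis using c 1 2 3 4 5 by (elim insertE emptyE) simp_all
qed

lemma phi_14_square_integrable: "l \<in> {1..4} \<Longrightarrow> sqint (\<phi> l)"
  using A1_square_integrable phi_A1 by blast

lemma phi_14_supp_in: "l \<in> {1..4} \<Longrightarrow> supp_in 0 1 (\<phi> l)"
  using A1_supp_in phi_A1 by blast

lemma phi_14_shift_supp_in: "l \<in> {1..4} \<Longrightarrow> supp_in (-1) 0 (dilate 0 (-1) (\<phi> l))"
  using supp_in_dilate[OF phi_14_supp_in, of l "-1" 0] by simp

text \<open>\<open>G 0\<close> is the function normalized to \<open>\<phi> 5\<close>;
  \<open>G 1\<close> is the one behind \<open>\<phi> 6\<close> before its component along
  \<open>\<phi> 5\<close> is removed. Up to that point both are treated alike.\<close>

definition G :: "int \<Rightarrow> real \<Rightarrow> real" where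
  "G i = residual \<phi> 4 (\<xi> 1 i)"

lemma G_in_fspan:
  "G i \<in> fspan ({\<xi> 1 i} \<union> \<phi> ` {1..4} \<union> (\<lambda>l. dilate 0 (-1) (\<phi> l)) ` {1..4})"
  unfolding G_def residual_alt by (intro fspan_diff fspan_sum fspan_cmult) (auto intro!: fspan_base)

lemma xi_in_fspan_G:
  "\<xi> 1 i \<in> fspan ({G i} \<union> \<phi> ` {1..4} \<union> (\<lambda>l. dilate 0 (-1) (\<phi> l)) ` {1..4})"
proof -
  have "\<xi> 1 i = (\<lambda>x. G i x + (\<Sum>j=1..4. l2ip (\<xi> 1 i) (\<phi> j) * \<phi> j x)
     + (\<Sum>j=1..4. l2ip (\<xi> 1 i) (dilate 0 (-1) (\<phi> j)) * dilate 0 (-1) (\<phi> j) x))"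
    by (simp add: G_def residual_alt)
  also have "\<dots> \<in> fspan ({G i} \<union> \<phi> ` {1..4} \<union> (\<lambda>l. dilate 0 (-1) (\<phi> l)) ` {1..4})"
    by (intro fspan_add fspan_sum fspan_cmult) (auto intro!: fspan_base)
  finally show ?thesis .
qed

lemma supp_in_xi_01: "i \<in> {0, 1} \<Longrightarrow> supp_in (-1/2) (1/2) (\<xi> 1 i)"
  using supp_in_xi[of i 1] by auto

lemma G_C1_spline: "C1_spline 2 (G i)"
  using G_in_fspan[of i]
proof (rule fspan_C1_spline)
  fix s assume "s \<in> {\<xi> 1 i} \<union> \<phi> ` {1..4} \<union> (\<lambda>l. dilate 0 (-1) (\<phi> l)) ` {1..4}"
  thus "C1_spline 2 s"
    using C1_spline_mono[OF C1_spline_xi, of 1 2 i] A1_C1_spline[OF phi_A1]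
      C1_spline_dilate[OF A1_C1_spline[OF phi_A1], of _ 0] by auto
qed

lemma G_supp_in: "i \<in> {0, 1} \<Longrightarrow> supp_in (-1) 1 (G i)"
  using G_in_fspan[of i]
proof (rule fspan_supp_in)
  fix s assume "i \<in> {0, 1}" "s \<in> {\<xi> 1 i} \<union> \<phi> ` {1..4} \<union> (\<lambda>l. dilate 0 (-1) (\<phi> l)) ` {1..4}"
  thus "supp_in (-1) 1 s"
    using supp_in_mono[OF supp_in_xi_01, of i "-1" 1] supp_in_mono[OF phi_14_supp_in, of _ "-1" 1]
      supp_in_mono[OF phi_14_shift_supp_in, of _ "-1" 1] by auto
qed

lemma G_square_integrable: "i \<in> {0, 1} \<Longrightarrow> sqint (G i)"
  using C1_spline_square_integrable G_C1_spline G_supp_in by blast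

lemma phi_14_inner_shift:
  assumes "l \<in> {1..4}" "m \<in> {1..4}"
  shows "l2ip (\<phi> l) (dilate 0 (-1) (\<phi> m)) = 0" "l2ip (dilate 0 (-1) (\<phi> m)) (\<phi> l) = 0"
proof -
  show "l2ip (\<phi> l) (dilate 0 (-1) (\<phi> m)) = 0"
    by (rule l2_inner_disjoint[OF phi_14_supp_in phi_14_shift_supp_in]) (use assms in auto)
  thus "l2ip (dilate 0 (-1) (\<phi> m)) (\<phi> l) = 0" by (simp add: l2_inner_commute)
qed

lemma residual_inner:
  assumes f: "sqint f" and m: "\<And>l. l \<in> {1..m} \<Longrightarrow> sqint (\<phi> l)" and h: "sqint h"
  shows "l2ip (residual \<phi> m f) h = l2ip f h - (\<Sum>j=1..m. l2ip f (\<phi> j) * l2ip (\<phi> j) h)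
     - (\<Sum>j=1..m. l2ip f (dilate 0 (-1) (\<phi> j)) * l2ip (dilate 0 (-1) (\<phi> j)) h)"
proof -
  have s: "sqint (\<lambda>x. \<Sum>j=1..m. l2ip f (\<phi> j) * \<phi> j x)"
    "sqint (\<lambda>x. \<Sum>j=1..m. l2ip f (dilate 0 (-1) (\<phi> j)) * dilate 0 (-1) (\<phi> j) x)"
    using m by (intro square_integrable_sum square_integrable_cmult square_integrable_dilate; simp)+
  have "l2ip (residual \<phi> m f) h = l2ip f h - l2ip (\<lambda>x. \<Sum>j=1..m. l2ip f (\<phi> j) * \<phi> j x) h
      - l2ip (\<lambda>x. \<Sum>j=1..m. l2ip f (dilate 0 (-1) (\<phi> j)) * dilate 0 (-1) (\<phi> j) x) h"
    unfolding residual_alt by (simp only: l2_inner_diff_left square_integrable_diff f s h)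
  thus ?thesis using m h by (simp only: l2_inner_scaled_sum_left square_integrable_dilate)
qed

lemma G_inner_phi:
  assumes l: "l \<in> {1..4}"
  shows "l2ip (G i) (\<phi> l) = 0" "l2ip (G i) (dilate 0 (-1) (\<phi> l)) = 0"
proof -
  have s: "sqint (\<phi> j)" if "j \<in> {1..4}" for j using that by (rule phi_14_square_integrable)
  have "l2ip (G i) (\<phi> l) = l2ip (\<xi> 1 i) (\<phi> l) - (\<Sum>j=1..4. l2ip (\<xi> 1 i) (\<phi> j) * l2ip (\<phi> j) (\<phi> l))
     - (\<Sum>j=1..4. l2ip (\<xi> 1 i) (dilate 0 (-1) (\<phi> j)) * l2ip (dilate 0 (-1) (\<phi> j)) (\<phi> l))"
    unfolding G_def by (intro residual_inner square_integrable_xi s l)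
  also have "(\<Sum>j=1..4. l2ip (\<xi> 1 i) (\<phi> j) * l2ip (\<phi> j) (\<phi> l)) =
      (\<Sum>j\<in>{1..4}. if j = l then l2ip (\<xi> 1 i) (\<phi> j) else 0)"
    by (intro sum.cong) (use l in \<open>auto simp: phi_inner_14\<close>)
  also have "(\<Sum>j=1..4. l2ip (\<xi> 1 i) (dilate 0 (-1) (\<phi> j)) * l2ip (dilate 0 (-1) (\<phi> j)) (\<phi> l)) = 0"
    by (intro sum.neutral) (use l in \<open>auto simp: phi_14_inner_shift\<close>)
  finally show "l2ip (G i) (\<phi> l) = 0" using l by simp
  have "l2ip (G i) (dilate 0 (-1) (\<phi> l)) = l2ip (\<xi> 1 i) (dilate 0 (-1) (\<phi> l))
     - (\<Sum>j=1..4. l2ip (\<xi> 1 i) (\<phi> j) * l2ip (\<phi> j) (dilate 0 (-1) (\<phi> l)))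
     - (\<Sum>j=1..4. l2ip (\<xi> 1 i) (dilate 0 (-1) (\<phi> j)) * l2ip (dilate 0 (-1) (\<phi> j)) (dilate 0 (-1) (\<phi> l)))"
    unfolding G_def by (intro residual_inner square_integrable_xi square_integrable_dilate s l)
  also have "(\<Sum>j=1..4. l2ip (\<xi> 1 i) (dilate 0 (-1) (\<phi> j)) * l2ip (dilate 0 (-1) (\<phi> j)) (dilate 0 (-1) (\<phi> l))) =
      (\<Sum>j\<in>{1..4}. if j = l then l2ip (\<xi> 1 i) (dilate 0 (-1) (\<phi> j)) else 0)"
    by (intro sum.cong) (use l in \<open>auto simp: phi_inner_14 l2_inner_dilate\<close>)
  also have "(\<Sum>j=1..4. l2ip (\<xi> 1 i) (\<phi> j) * l2ip (\<phi> j) (dilate 0 (-1) (\<phi> l))) = 0"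
    by (intro sum.neutral) (use l in \<open>auto simp: phi_14_inner_shift\<close>)
  finally show "l2ip (G i) (dilate 0 (-1) (\<phi> l)) = 0" using l by simp
qed

definition Q :: "(real \<Rightarrow> real) \<Rightarrow> real \<Rightarrow> real" where
  "Q f = (\<lambda>x. f x - (\<Sum>j=1..4. l2ip f (\<phi> j) * \<phi> j x))"

text \<open>Removing the components along \<open>\<phi> 1\<close> and \<open>\<phi> 2\<close> sends
  the cut functions from \<open>B0\<close> and \<open>B1\<close> to \<open>C0\<close> and
  \<open>C1\<close>. The projection onto the complement of \<open>W\<close> then removes
  \<open>\<phi> 3\<close> and \<open>\<phi> 4\<close>, and the defining property of \<open>W\<close>
  applies to the result.\<close>

lemma Q_C0_C1:
  assumes "i \<in> {0, 1}" "i' \<in> {0, 1}"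
  shows "l2ip (Q (cut (\<xi> 1 i))) (Q (cut (\<xi> 1 (i' + 4)))) = 0"
proof -
  define P where "P f = (\<lambda>x. f x - (l2ip f (\<phi> 1) * \<phi> 1 x + l2ip f (\<phi> 2) * \<phi> 2 x))" for f
  have sp: "sqint (\<phi> 1)" "sqint (\<phi> 2)" "sqint (\<phi> 3)" "sqint (\<phi> 4)" by (simp_all add: phi_14_square_integrable)
  have Pin: "l2ip (P f) h = l2ip f h - (l2ip f (\<phi> 1) * l2ip (\<phi> 1) h + l2ip f (\<phi> 2) * l2ip (\<phi> 2) h)"
    if "sqint f" "sqint h" for f h
    unfolding P_def using that sp
    by (simp add: l2_inner_diff_left l2_inner_add_left square_integrable_intros l2_inner_cmult_left)
  have sP: "sqint (P f)" if "sqint f" for f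
    unfolding P_def by (intro square_integrable_intros sp that)
  have A0: "l2ip (P f) g = 0" if "sqint f" "g \<in> A0" for f g
  proof -
    have "\<xi> 1 2 \<in> fspan {\<phi> 1, \<phi> 2}" "\<xi> 1 3 \<in> fspan {\<phi> 1, \<phi> 2}"
      using fspan_normalize_inverse[OF xi_A0_nonzero(1)] fspan_normalize_inverse[OF xi_A0_nonzero(2)]
      unfolding phi_eqs(1,2) by (auto elim!: fspan_mono[rotated])
    hence "g \<in> fspan {\<phi> 1, \<phi> 2}" using that(2) unfolding A0_def by (elim fspan_trans) auto
    moreover have "l2ip (P f) (\<phi> 1) = 0" "l2ip (P f) (\<phi> 2) = 0"
      using phi_inner_14[of 1 1] phi_inner_14[of 2 1] phi_inner_14[of 1 2] phi_inner_14[of 2 2]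
      by (simp_all add: Pin[OF that(1) sp(1)] Pin[OF that(1) sp(2)])
    hence "l2ip s (P f) = 0" if "s \<in> {\<phi> 1, \<phi> 2}" for s
      using that by (auto simp only: l2_inner_commute[of lborel s])
    ultimately have "l2ip g (P f) = 0"
      using sp(1,2) sP[OF that(1)] by (intro fspan_orthogonal[where S = "{\<phi> 1, \<phi> 2}" and f = g]) auto
    thus ?thesis by (simp add: l2_inner_commute)
  qed
  \<comment> \<open>The first removal leaves the coefficients along \<open>\<phi> 3\<close> and
    \<open>\<phi> 4\<close> unchanged, so the two steps together subtract all four
    components.\<close>
  have QP: "(\<lambda>x. P f x - l2_proj W (P f) x) = Q f" if "sqint f" for f
  proof -
    have "l2_proj W (P f) = (\<lambda>x. l2ip f (\<phi> 3) * \<phi> 3 x + l2ip f (\<phi> 4) * \<phi> 4 x)"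
      using that sp by (subst l2_proj_orthonormal_basis2[OF W(2)]) (simp_all add: sP Pin phi_inner_14)
    moreover have "{1..4} = {1, 2, 3, 4::nat}" by auto
    ultimately show ?thesis by (simp add: P_def Q_def fun_eq_iff)
  qed
  have sc: "sqint (cut (\<xi> 1 n))" for n
    by (intro square_integrable_cut square_integrable_xi)
  have "P (cut (\<xi> 1 i)) \<in> B0"
    unfolding B0_def P_def using assms(1) phi_12_A0
    by (intro fspan_diff fspan_add fspan_cmult) (auto intro!: fspan_base)
  hence 1: "P (cut (\<xi> 1 i)) \<in> C0" using A0 sc by (simp add: C0_def l2_minus_def)
  have "P (cut (\<xi> 1 (i' + 4))) \<in> B1"
    unfolding B1_def P_def using assms(2) phi_12_A0
    by (intro fspan_diff fspan_add fspan_cmult) (auto intro!: fspan_base)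
  hence 2: "P (cut (\<xi> 1 (i' + 4))) \<in> C1" using A0 sc by (simp add: C1_def l2_minus_def)
  show ?thesis using W(3)[OF 1 2] by (simp add: QP sc)
qed

text \<open>On \<open>[0, 1]\<close>, the only interval on which both functions live, they are the images of
  elements of \<open>C0\<close> and \<open>C1\<close> under the projection onto the complement of \<open>W\<close>.\<close>

lemma G_inner_shift:
  assumes "i \<in> {0, 1}" "i' \<in> {0, 1}"
  shows "l2ip (G i) (dilate 0 1 (G i')) = 0"
proof -
  have x4: "\<xi> 1 (i' + 4) x = \<xi> 1 i' (x - 1)" for x
    using dilate_xi[of 0 1 1 i'] by (simp add: dilate_0 fun_eq_iff)
  have c: "l2ip (cut f) (\<phi> j) = l2ip f (\<phi> j)" if "j \<in> {1..4}" for f j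
    by (rule l2_inner_cong) (use phi_14_supp_in[OF that] in \<open>auto simp: cut_def supp_in_def indicator_def\<close>)
  \<comment> \<open>The part of \<open>\<xi> 1 (i' + 4)\<close> in \<open>[0, 1]\<close> is the left
    half of \<open>\<xi> 1 i'\<close> moved by one, so \<open>Q\<close> uses the same coefficients
    that \<open>residual\<close> attaches to the translates on \<open>[-1, 0]\<close>.\<close>
  have c4: "l2ip (cut (\<xi> 1 (i' + 4))) (\<phi> j) = l2ip (\<xi> 1 i') (dilate 0 (-1) (\<phi> j))" if "j \<in> {1..4}" for j
    using l2_inner_shift[of "-1" "\<xi> 1 (i' + 4)" "-1" "\<phi> j"] that
    by (simp add: c dilate_xi)
  have z: "f x = 0" if "supp_in a b f" "x \<le> a \<or> b \<le> x" for f a b and x :: real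
    using that unfolding supp_in_def by force
  have z2: "\<xi> 1 i x = 0" if "x \<ge> 1" for x using z[OF supp_in_xi_01[OF assms(1)]] that by simp
  have z3: "\<xi> 1 i' x = 0" if "x \<le> - 1" for x using z[OF supp_in_xi_01[OF assms(2)]] that by simp
  have "G i x * dilate 0 1 (G i') x = Q (cut (\<xi> 1 i)) x * Q (cut (\<xi> 1 (i' + 4))) x" for x
  proof (cases "0 < x \<and> x < 1")
    case True
    have cutx: "cut f x = f x" for f using True by (simp add: cut_def)
    have shx: "dilate 0 (-1) f (x - 1) = f x" for f by (simp add: dilate_0)
    have "G i x = Q (cut (\<xi> 1 i)) x"
      using True z[OF phi_14_shift_supp_in, of _ x] by (simp add: G_def residual_alt Q_def c cutx)
    moreover have "dilate 0 1 (G i') x = Q (cut (\<xi> 1 (i' + 4))) x"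
      using True z[OF phi_14_supp_in, of _ "x - 1"]
      by (simp add: G_def residual_alt Q_def c4 cutx x4 shx dilate_0[of 1])
    ultimately show ?thesis by simp
  next
    \<comment> \<open>At the points \<open>0\<close> and \<open>1\<close> only one of the two
      factors is known to vanish, which suffices for the product.\<close>
    case False
    have p: "\<phi> j x = 0" if "j \<in> {1..4}" for j using False z[OF phi_14_supp_in[OF that]] by auto
    have "G i x = 0 \<or> dilate 0 1 (G i') x = 0"
      using False z[OF G_supp_in[OF assms(1)], of x] z[OF G_supp_in[OF assms(2)], of "x - 1"] by (auto simp: dilate_0)
    moreover have "Q (cut (\<xi> 1 i)) x = 0 \<or> Q (cut (\<xi> 1 (i' + 4))) x = 0"
      using False z2[of x] z3[of "x - 1"] by (auto simp: Q_def p cut_def x4 not_less)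
    ultimately show ?thesis by auto
  qed
  thus ?thesis using Q_C0_C1[OF assms] by (simp add: l2_inner_def)
qed

section \<open>Behaviour at the origin and the generators \<open>\<phi> 5\<close>,
  \<open>\<phi> 6\<close>\<close>

lemma phi_14_derivative:
  assumes "l \<in> {1..4}" "x \<le> 0 \<or> 1 \<le> x"
  shows "(\<phi> l has_real_derivative 0) (at x)"
proof -
  obtain D where "(\<phi> l has_real_derivative D) (at x)"
    using A1_C1_spline[OF phi_A1[OF assms(1)]] unfolding C1_spline_def C1_fun_def by blast
  thus ?thesis using supp_in_derivative_zero[OF phi_14_supp_in[OF assms(1)]] assms(2) by blast
qed

lemma G_0: "G i 0 = \<xi> 1 i 0"
proof -
  have "\<phi> j 0 = 0 \<and> \<phi> j 1 = 0" if "j \<in> {1..4}" for j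
    using phi_14_supp_in[OF that] unfolding supp_in_def by force
  thus ?thesis by (simp add: G_def residual_alt dilate_0)
qed

text \<open>All subtracted functions have slope \<open>0\<close> at the integers, so the slope of
  \<open>\<xi> 1 i\<close> survives: the normalizing factor \<open>2 powr (1/2)\<close> times the
  inner derivative \<open>2\<close> times the slope of the generator.\<close>

lemma G_derivative_0:
  assumes "i \<in> {0, 1}"
  shows "(G i has_real_derivative (if i = 0 then 0 else 2 powr (1/2) * 2)) (at 0)"
proof -
  have x: "\<xi> 1 i = (\<lambda>x. 2 powr (1/2) * xi_gen (nat i + 1) (2 * x))"
    using assms by (auto simp: \<xi>_def dilate_def)
  have "(\<xi> 1 i has_real_derivative 2 powr (1/2) * ((if i = 0 then 0 else 1) * 2)) (at 0)"
    unfolding x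
  proof (rule DERIV_cmult, rule DERIV_chain2[where f = "xi_gen (nat i + 1)" and g = "\<lambda>x. 2 * x"])
    show "(xi_gen (nat i + 1) has_real_derivative (if i = 0 then 0 else 1)) (at (2 * 0))"
      using xi_gen_has_derivative_0[of "nat i + 1"] assms by auto
  qed (auto intro!: derivative_eq_intros)
  moreover have "((\<lambda>x. \<phi> j (x + 1)) has_real_derivative 0) (at 0)" if "j \<in> {1..4}" for j
    using DERIV_shift[of "\<phi> j" 0 0 1] phi_14_derivative[OF that, of 1] by simp
  moreover have "(\<phi> j has_real_derivative 0) (at 0)" if "j \<in> {1..4}" for j
    using phi_14_derivative[OF that, of 0] by simp
  ultimately have "(G i has_real_derivative (2 powr (1/2) * ((if i = 0 then 0 else 1) * 2)
      - (\<Sum>j=1..4. l2ip (\<xi> 1 i) (\<phi> j) * 0)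
      - (\<Sum>j=1..4. l2ip (\<xi> 1 i) (\<lambda>y. \<phi> j (y + 1)) * 0))) (at 0)"
    unfolding G_def residual_def
    by (intro DERIV_diff DERIV_sum DERIV_cmult) auto
  thus ?thesis by (simp split: if_splits)
qed

lemma G0_nonzero: "l2ip (G 0) (G 0) \<noteq> 0"
proof -
  have "G 0 0 \<noteq> 0" by (simp add: G_0 \<xi>_def dilate_def xi_gen_def)
  thus ?thesis by (intro C1_spline_l2_inner_nonzero[OF G_C1_spline G_square_integrable]) auto
qed

lemma phi_5: "\<phi> 5 = l2_normalize (G 0)"
  by (simp add: phi_eqs G_def)

lemma phi_5_square_integrable: "sqint (\<phi> 5)"
  unfolding phi_5 by (intro square_integrable_normalize G_square_integrable) simp

definition G6 :: "real \<Rightarrow> real" where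
  "G6 = (\<lambda>x. G 1 x - l2ip (G 1) (\<phi> 5) * \<phi> 5 x)"

text \<open>The coefficient along \<open>\<phi> 5 (x + 1)\<close> is zero by
  \<open>G_inner_shift\<close>, and the one along \<open>\<phi> 5\<close> may be computed with
  \<open>G 1\<close> in place of \<open>\<xi> 1 1\<close>, since the two differ by functions
  orthogonal to \<open>\<phi> 5\<close>.\<close>

lemma phi_6: "\<phi> 6 = l2_normalize G6"
proof -
  have s: "sqint (G 1)" "sqint (\<phi> 5)" "sqint (dilate 0 (-1) (\<phi> 5))"
    by (auto simp: G_square_integrable phi_5_square_integrable square_integrable_dilate)
  have sl: "sqint (\<phi> j)" if "j \<in> {1..4}" for j using that by (rule phi_14_square_integrable)
  have 1: "l2ip (\<phi> j) (\<phi> 5) = 0" "l2ip (dilate 0 (-1) (\<phi> j)) (\<phi> 5) = 0" if "j \<in> {1..4}" for j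
    using G_inner_phi[OF that, of 0] unfolding phi_5 l2_inner_normalize_right by (simp_all add: l2_inner_commute)
  have "supp_in (-1) 1 (\<lambda>x. 1 / l2_norm lborel (G 0) * G 0 x + 0)"
    by (intro supp_in_lincomb G_supp_in supp_in_zero) simp
  hence s5: "supp_in (-1) 1 (\<phi> 5)" unfolding phi_5 l2_normalize_alt by simp
  have 2: "l2ip (\<phi> j) (dilate 0 (-1) (\<phi> 5)) = 0" if "j \<in> {1..4}" for j
    by (rule l2_inner_disjoint[OF phi_14_supp_in[OF that] supp_in_dilate[OF s5, of "-1" 0]]) simp
  have 3: "l2ip (dilate 0 (-1) (\<phi> j)) (dilate 0 (-1) (\<phi> 5)) = 0" if "j \<in> {1..4}" for j
    using 1(1)[OF that] by (simp add: l2_inner_dilate)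
  have a: "l2ip (G 1) (\<phi> 5) = l2ip (\<xi> 1 1) (\<phi> 5)"
    unfolding G_def by (subst residual_inner) (auto simp: square_integrable_xi sl s 1)
  have "l2ip (G 1) (dilate 0 (-1) (\<phi> 5)) = l2ip (\<xi> 1 1) (dilate 0 (-1) (\<phi> 5))"
    unfolding G_def by (subst residual_inner) (auto simp: square_integrable_xi sl s 2 3)
  moreover have "l2ip (G 1) (dilate 0 (-1) (\<phi> 5)) = l2ip (\<phi> 5) (dilate 0 1 (G 1))"
    using l2_inner_shift[of 1 "G 1" 0 "\<phi> 5"] by (simp add: l2_inner_commute)
  moreover have "l2ip (\<phi> 5) (dilate 0 1 (G 1)) = 0"
    unfolding phi_5 l2_inner_normalize_left using G_inner_shift[of 0 1] by simp
  ultimately have b: "l2ip (\<xi> 1 1) (dilate 0 (-1) (\<phi> 5)) = 0" by simp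
  have "{1..5} = insert 5 {1..4::nat}" by auto
  hence "residual \<phi> 5 (\<xi> 1 1) = G6"
    unfolding G6_def G_def residual_alt a[symmetric] by (simp add: b a[symmetric] G_def residual_alt algebra_simps)
  thus ?thesis by (simp add: phi_eqs)
qed

lemma phi_5_derivative_0: "(\<phi> 5 has_real_derivative 0) (at 0)"
  unfolding phi_5 l2_normalize_alt using DERIV_cmult[OF G_derivative_0[of 0], of "1 / l2_norm lborel (G 0)"] by simp

lemma G6_derivative_0: "(G6 has_real_derivative 2 powr (1/2) * 2) (at 0)"
  unfolding G6_def using DERIV_diff[OF G_derivative_0[of 1] DERIV_cmult[OF phi_5_derivative_0]] by auto

lemma G6_in_fspan: "G6 \<in> fspan {G 0, G 1}"
  unfolding G6_def phi_5 by (intro fspan_diff fspan_cmult fspan_normalize) (auto intro: fspan_base)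

lemma G6_C1_spline: "C1_spline 2 G6"
  using G6_in_fspan by (rule fspan_C1_spline) (auto simp: G_C1_spline)

lemma G6_square_integrable: "sqint G6"
  using G6_in_fspan by (rule fspan_square_integrable) (auto simp: G_square_integrable)

text \<open>Independence of \<open>G 0\<close> and \<open>G 1\<close> shows at the origin:
  \<open>\<phi> 5\<close> has slope \<open>0\<close> there, \<open>G 1\<close> does not.\<close>

lemma G6_nonzero: "l2ip G6 G6 \<noteq> 0"
proof
  assume 0: "l2ip G6 G6 = 0"
  have "G6 = (\<lambda>x. 0)"
    using l2_inner_null_continuous[OF G6_square_integrable 0 open_UNIV C1_spline_continuous[OF G6_C1_spline]] by auto
  hence "(G6 has_real_derivative 0) (at 0)" by simp
  from DERIV_unique[OF G6_derivative_0 this] show False by simp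
qed

lemma phi_6_derivative_0: obtains D where "(\<phi> 6 has_real_derivative D) (at 0)" "D \<noteq> 0"
proof
  show "(\<phi> 6 has_real_derivative 1 / l2_norm lborel G6 * (2 powr (1/2) * 2)) (at 0)"
    unfolding phi_6 l2_normalize_alt by (rule DERIV_cmult[OF G6_derivative_0])
  show "1 / l2_norm lborel G6 * (2 powr (1/2) * 2) \<noteq> 0"
    using G6_nonzero by (simp add: l2_norm_def)
qed

lemma phi_5_0: "\<phi> 5 0 \<noteq> 0"
  using G0_nonzero unfolding phi_5 by (simp add: l2_normalize_def G_0 l2_norm_def \<xi>_def dilate_def xi_gen_def)

lemma phi_56_in_fspan_G: "l \<in> {5, 6} \<Longrightarrow> \<phi> l \<in> fspan {G 0, G 1}"
proof -
  have "\<phi> 5 \<in> fspan {G 0, G 1}" unfolding phi_5 by (intro fspan_normalize fspan_base) auto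
  moreover have "\<phi> 6 \<in> fspan {G 0, G 1}" unfolding phi_6 by (intro fspan_normalize G6_in_fspan)
  ultimately show "l \<in> {5, 6} \<Longrightarrow> \<phi> l \<in> fspan {G 0, G 1}" by auto
qed

lemma G_in_fspan_phi_56: "i \<in> {0, 1} \<Longrightarrow> G i \<in> fspan {\<phi> 5, \<phi> 6}"
proof -
  have 0: "G 0 \<in> fspan {\<phi> 5, \<phi> 6}"
    using fspan_normalize_inverse[OF G0_nonzero] unfolding phi_5 by (elim fspan_mono[rotated]) auto
  have 6: "G6 \<in> fspan {\<phi> 5, \<phi> 6}"
    using fspan_normalize_inverse[OF G6_nonzero] unfolding phi_6 by (elim fspan_mono[rotated]) auto
  have "G 1 = (\<lambda>x. G6 x + l2ip (G 1) (\<phi> 5) * \<phi> 5 x)" by (simp add: G6_def)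
  also have "\<dots> \<in> fspan {\<phi> 5, \<phi> 6}"
    by (intro fspan_add fspan_cmult 6 fspan_base) auto
  finally show "i \<in> {0, 1} \<Longrightarrow> G i \<in> fspan {\<phi> 5, \<phi> 6}" using 0 by auto
qed

lemma phi_C1_spline: "l \<in> {1..6} \<Longrightarrow> C1_spline 2 (\<phi> l)"
proof -
  have "C1_spline 2 (\<phi> l)" if "l \<in> {5, 6}"
    using phi_56_in_fspan_G[OF that] by (rule fspan_C1_spline) (auto simp: G_C1_spline)
  moreover assume "l \<in> {1..6}"
  hence "l \<in> {1..4} \<or> l \<in> {5, 6}" by auto
  ultimately show ?thesis using A1_C1_spline phi_A1 by blast
qed

lemma phi_56_supp_in: "l \<in> {5, 6} \<Longrightarrow> supp_in (-1) 1 (\<phi> l)"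
  by (rule fspan_supp_in[OF phi_56_in_fspan_G]) (auto simp: G_supp_in)

lemma phi_supp_in: "l \<in> {1..6} \<Longrightarrow> supp_in (if l \<le> 4 then 0 else -1) 1 (\<phi> l)"
proof -
  assume "l \<in> {1..6}"
  hence "l \<in> {1..4} \<or> l \<in> {5, 6}" by auto
  thus ?thesis using phi_14_supp_in[of l] phi_56_supp_in[of l] by auto
qed

lemma phi_square_integrable: "l \<in> {1..6} \<Longrightarrow> sqint (\<phi> l)"
  using C1_spline_square_integrable[OF phi_C1_spline phi_supp_in] by blast

lemma phi_56_inner:
  assumes "l \<in> {5, 6}" "m \<in> {5, 6}"
  shows "l2ip (\<phi> l) (\<phi> m) = (if l = m then 1 else 0)"
proof -
  have 5: "l2ip (\<phi> 5) (\<phi> 5) = 1" unfolding phi_5 by (rule l2_inner_normalize_self[OF G0_nonzero])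
  have 6: "l2ip (\<phi> 6) (\<phi> 6) = 1" unfolding phi_6 by (rule l2_inner_normalize_self[OF G6_nonzero])
  have "l2ip G6 (\<phi> 5) = 0"
    unfolding G6_def using 5
    by (simp add: l2_inner_diff_left G_square_integrable phi_5_square_integrable square_integrable_cmult l2_inner_cmult_left)
  hence 56: "l2ip (\<phi> 6) (\<phi> 5) = 0" unfolding phi_6 l2_inner_normalize_left by simp
  show ?thesis using assms 5 6 56 by (auto simp: l2_inner_commute[of _ "\<phi> 5" "\<phi> 6"])
qed

lemma phi_56_inner_14:
  assumes "l \<in> {5, 6}" "m \<in> {1..4}"
  shows "l2ip (\<phi> l) (\<phi> m) = 0" "l2ip (\<phi> l) (dilate 0 (-1) (\<phi> m)) = 0"
proof -
  show "l2ip (\<phi> l) (\<phi> m) = 0"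
    by (rule fspan_orthogonal[OF phi_56_in_fspan_G[OF assms(1)]])
      (use assms(2) in \<open>auto simp: G_square_integrable phi_14_square_integrable G_inner_phi\<close>)
  show "l2ip (\<phi> l) (dilate 0 (-1) (\<phi> m)) = 0"
    by (rule fspan_orthogonal[OF phi_56_in_fspan_G[OF assms(1)]])
      (use assms(2) in \<open>auto simp: G_square_integrable phi_14_square_integrable G_inner_phi square_integrable_dilate\<close>)
qed

lemma phi_56_inner_shift:
  assumes "l \<in> {5, 6}" "m \<in> {5, 6}"
  shows "l2ip (\<phi> l) (dilate 0 1 (\<phi> m)) = 0"
proof (rule fspan_orthogonal2[OF phi_56_in_fspan_G[OF assms(1)] fspan_dilate[OF phi_56_in_fspan_G[OF assms(2)]]])
  show "l2ip s t = 0" if "s \<in> {G 0, G 1}" "t \<in> dilate 0 1 ` {G 0, G 1}" for s t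
    using that G_inner_shift[of 0 0] G_inner_shift[of 0 1] G_inner_shift[of 1 0] G_inner_shift[of 1 1] by auto
qed (auto simp: G_square_integrable square_integrable_dilate)

text \<open>The supports leave only the shifts \<open>-1\<close>, \<open>0\<close>, \<open>1\<close>
  to inspect, and \<open>rev\<close> exchanges the signs. The remaining cases are the orthogonality
  of \<open>G\<close> to the functions of both adjacent cells and
  \<open>G_inner_shift\<close>.\<close>

lemma phi_inner:
  assumes "l \<in> {1..6}" "m \<in> {1..6}"
  shows "l2ip (\<phi> l) (dilate 0 k (\<phi> m)) = (if l = m \<and> k = 0 then 1 else 0)"
proof -
  have disj: "l2ip (\<phi> l) (dilate 0 k (\<phi> m)) = 0"
    if "1 \<le> (if m \<le> 4 then 0 else -1) + k \<or> 1 + k \<le> (if l \<le> 4 then 0 else -1)" "l \<in> {1..6}" "m \<in> {1..6}" for l m k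
  proof (rule l2_inner_disjoint[OF phi_supp_in[OF that(2)] supp_in_dilate[OF phi_supp_in[OF that(3)]]])
    have "1 \<le> real_of_int ((if m \<le> 4 then 0 else -1) + k) \<or> real_of_int (1 + k) \<le> of_int (if l \<le> 4 then 0 else -1)"
      using that(1) by linarith
    thus "1 \<le> ((if m \<le> 4 then 0 else - 1) + real_of_int k) / 2 ^ 0 \<or>
        (1 + real_of_int k) / 2 ^ 0 \<le> (if l \<le> 4 then 0 else - 1)"
      by (simp split: if_splits)
  qed
  have rev: "l2ip (\<phi> l) (dilate 0 k (\<phi> m)) = l2ip (\<phi> m) (dilate 0 (- k) (\<phi> l))" for l m k
    using l2_inner_shift[of k "\<phi> m" 0 "\<phi> l"] by (simp add: l2_inner_commute)
  consider "l \<in> {1..4}" "m \<in> {1..4}" | "l \<in> {5, 6}" "m \<in> {1..4}" | "l \<in> {1..4}" "m \<in> {5, 6}" | "l \<in> {5, 6}" "m \<in> {5, 6}"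
    using assms by force
  thus ?thesis
  proof cases
    case 1
    consider "k = 0" | "1 \<le> k \<or> k \<le> -1" by linarith
    thus ?thesis using 1 disj[of m k l] phi_inner_14[of l m] assms by cases auto
  next
    case 2
    consider "k = 0" | "k = -1" | "k \<ge> 1 \<or> k \<le> -2" by linarith
    thus ?thesis
      using 2 phi_56_inner_14[of l m] disj[of m k l] assms by cases auto
  next
    case 3
    consider "k = 0" | "k = 1" | "k \<ge> 2 \<or> k \<le> -1" by linarith
    thus ?thesis
      using 3 phi_56_inner_14[of m l] disj[of m k l] assms unfolding rev[of l k m] by cases (auto simp: rev[of l k m])
  next
    case 4
    consider "k = 0" | "k = 1" | "k = -1" | "k \<ge> 2 \<or> k \<le> -2" by linarith
    thus ?thesis
    proof cases
      case 1
      thus ?thesis using 4 phi_56_inner[of l m] by simp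
    next
      case 2
      thus ?thesis using 4 phi_56_inner_shift[of l m] by simp
    next
      case 3
      thus ?thesis using 4 phi_56_inner_shift[of m l] rev[of l "-1" m] by simp
    next
      assume "k \<ge> 2 \<or> k \<le> -2"
      thus ?thesis using 4 disj[of m k l] assms by auto
    qed
  qed
qed

section \<open>Families of translates and refinability\<close>

lemma phiR_eq: "l \<in> {1..6} \<Longrightarrow> phiR \<phi> j (6 * k + int l) = dilate j (if l \<le> 4 then k else k + 1) (\<phi> l)"
proof -
  assume l: "l \<in> {1..6}"
  have "(6 * k + int l - 1) div 6 = k" "(6 * k + int l - 1) mod 6 = int l - 1"
    using l by (auto simp: div_pos_pos_trivial mod_pos_pos_trivial intro: int_div_pos_eq[where r = "int l - 1"] int_mod_pos_eq[where q = k])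
  thus ?thesis using l by (auto simp: phiR_def Let_def nat_diff_distrib)
qed

lemma dilate_phiR: "dilate i k (phiR \<phi> j n) = phiR \<phi> (j + i) (n + 6 * 2 ^ j * k)"
proof -
  obtain k' l where l: "l \<in> {1..6}" "n = 6 * k' + int l" by (rule index6_cases)
  have "n + 6 * 2 ^ j * k = 6 * (k' + 2 ^ j * k) + int l" by (simp add: l)
  thus ?thesis using l(1) by (auto simp only: l(2) phiR_eq dilate_dilate) (auto simp: ac_simps)
qed

lemma phiR_square_integrable: "sqint (phiR \<phi> j n)"
  by (rule index6_cases[of n]) (auto simp: phiR_eq intro!: square_integrable_dilate phi_square_integrable)

lemma phiR_inner: "l2ip (phiR \<phi> j m) (phiR \<phi> j n) = (if m = n then 1 else 0)"
  by (rule indexed6_inner[where f = \<phi> and c = 4]) (auto simp: phi_inner phiR_eq)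

text \<open>Decoding the indices: \<open>1..4\<close> are the generators of the cell
  \<open>[0, 1]\<close>, \<open>-5..-2\<close> those of \<open>[-1, 0]\<close>, and
  \<open>-1\<close>, \<open>0\<close> are \<open>\<phi> 5\<close>, \<open>\<phi> 6\<close> at the
  origin. For \<open>n \<le> 1\<close> the Hermite function straddles the origin and needs both
  cells.\<close>

lemma xi_in_fspan_phiR_0:
  assumes "0 \<le> n" "n \<le> 3"
  shows "\<xi> 1 n \<in> fspan (phiR \<phi> 0 ` {if n \<le> 1 then -5 else 1..4})"
proof -
  have p: "\<phi> l = phiR \<phi> 0 (int l)" "dilate 0 (-1) (\<phi> l) = phiR \<phi> 0 (int l - 6)" if "l \<in> {1..4}" for l
    using phiR_eq[of l 0 0] phiR_eq[of l 0 "-1"] that by (simp_all add: algebra_simps)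
  have p5: "\<phi> 5 = phiR \<phi> 0 (-1)" "\<phi> 6 = phiR \<phi> 0 0"
    using phiR_eq[of 5 0 "-1"] phiR_eq[of 6 0 "-1"] by simp_all
  consider "n \<in> {0, 1}" | "n = 2" | "n = 3" using assms by fastforce
  thus ?thesis
  proof cases
    case 1
    have "\<xi> 1 n \<in> fspan (phiR \<phi> 0 ` {-5..4})"
      using xi_in_fspan_G[of n]
    proof (rule fspan_trans)
      fix s assume "s \<in> {G n} \<union> \<phi> ` {1..4} \<union> (\<lambda>l. dilate 0 (-1) (\<phi> l)) ` {1..4}"
      moreover have "G n \<in> fspan (phiR \<phi> 0 ` {-5..4})"
        using G_in_fspan_phi_56[OF 1] by (rule fspan_trans) (auto simp: p5 intro!: fspan_base)
      moreover have "\<phi> l \<in> fspan (phiR \<phi> 0 ` {-5..4})" if "l \<in> {1..4}" for l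
        unfolding p(1)[OF that] using that by (intro fspan_base imageI) auto
      moreover have "dilate 0 (-1) (\<phi> l) \<in> fspan (phiR \<phi> 0 ` {-5..4})" if "l \<in> {1..4}" for l
        unfolding p(2)[OF that] using that by (intro fspan_base imageI) auto
      ultimately show "s \<in> fspan (phiR \<phi> 0 ` {-5..4})" by blast
    qed
    thus ?thesis using 1 by auto
  next
    case 2
    have "\<xi> 1 2 \<in> fspan (phiR \<phi> 0 ` {1..4})"
      using fspan_normalize_inverse[OF xi_A0_nonzero(1)] unfolding phi_eqs(1)[symmetric]
      by (rule fspan_mono[rotated]) (use p(1)[of 1] in auto)
    thus ?thesis using 2 by auto
  next
    case 3
    have "\<xi> 1 3 \<in> fspan (phiR \<phi> 0 ` {1..4})"
      using fspan_normalize_inverse[OF xi_A0_nonzero(2)] unfolding phi_eqs(2)[symmetric]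
      by (rule fspan_mono[rotated]) (use p(1)[of 2] in auto)
    thus ?thesis using 3 by auto
  qed
qed

lemma xi_in_fspan_phiR:
  "\<xi> (Suc j) n \<in> fspan (phiR \<phi> j ` {6 * (n div 4) + (if n mod 4 \<le> 1 then -5 else 1)..6 * (n div 4) + 4})"
proof -
  let ?a = "if n mod 4 \<le> 1 then -5 else 1 :: int"
  have "\<xi> 1 (n mod 4) \<in> fspan (phiR \<phi> 0 ` {?a..4})"
    by (intro xi_in_fspan_phiR_0) auto
  from fspan_dilate[OF this, of j "n div 4"] 
  have "dilate j (n div 4) (\<xi> 1 (n mod 4)) \<in> fspan (dilate j (n div 4) ` phiR \<phi> 0 ` {?a..4})" .
  moreover have "dilate j (n div 4) (\<xi> 1 (n mod 4)) = \<xi> (Suc j) n"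
    by (simp add: dilate_xi Suc_eq_plus1 add.commute)
  ultimately have "\<xi> (Suc j) n \<in> fspan (dilate j (n div 4) ` phiR \<phi> 0 ` {?a..4})" by (simp only:)
  thus ?thesis by (rule fspan_mono[rotated]) (auto simp: dilate_phiR)
qed

text \<open>On level \<open>1\<close> the indices \<open>1..4\<close> belong to
  \<open>[0, 1/2]\<close>, \<open>5\<close> and \<open>6\<close> straddle \<open>1/2\<close>, and
  \<open>7..10\<close> belong to \<open>[1/2, 1]\<close>. The straddling functions at
  \<open>0\<close> and \<open>1\<close> are absent because \<open>A1\<close> lives strictly inside
  the cell.\<close>

lemma A1_subset_level_1:
  assumes "f \<in> A1"
  shows "f \<in> fspan (phiR \<phi> 1 ` {1..10})"
  using assms unfolding A1_def
proof (rule fspan_trans)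
  fix s assume "s \<in> \<xi> 2 ` {2..7}"
  then obtain n where n: "s = \<xi> 2 n" "2 \<le> n" "n \<le> 7" by auto
  have "n div 4 = 0 \<and> n mod 4 > 1 \<or> n div 4 = 1" using n by presburger
  thus "s \<in> fspan (phiR \<phi> 1 ` {1..10})"
    using fspan_mono_interval[OF xi_in_fspan_phiR[of 1 n], of 1 10] unfolding n(1)
    by (elim disjE) (auto split: if_splits)
qed

lemma phi_14_level_1: "l \<in> {1..4} \<Longrightarrow> \<phi> l \<in> fspan (phiR \<phi> 1 ` {1..10})"
  using A1_subset_level_1 phi_A1 by blast

lemma shift_level_1:
  assumes "f \<in> fspan (phiR \<phi> 1 ` {a..b})"
  shows "dilate 0 k f \<in> fspan (phiR \<phi> 1 ` {a + 12 * k..b + 12 * k})"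
  using fspan_dilate[OF assms, of 0 k] by (rule fspan_mono[rotated]) (auto simp: dilate_phiR)

lemma phi_56_level_1: "l \<in> {5, 6} \<Longrightarrow> \<phi> l \<in> fspan (phiR \<phi> 1 ` {-11..10})"
proof -
  have "G i \<in> fspan (phiR \<phi> 1 ` {-11..10})" if i: "i \<in> {0, 1}" for i
    using G_in_fspan[of i]
  proof (rule fspan_trans)
    fix s assume s: "s \<in> {\<xi> 1 i} \<union> \<phi> ` {1..4} \<union> (\<lambda>l. dilate 0 (-1) (\<phi> l)) ` {1..4}"
    have "\<xi> 1 i \<in> fspan (phiR \<phi> 1 ` {-11..10})"
      using xi_refine[of 1 i]
    proof (rule fspan_trans)
      fix s assume "s \<in> \<xi> (Suc 1) ` {4 * (i div 2) - 2..4 * (i div 2) + 3}"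
      then obtain n where n: "s = \<xi> 2 n" "-2 \<le> n" "n \<le> 3" using i by (auto simp: numeral_2_eq_2)
      have "n div 4 = 0 \<or> n div 4 = -1" using n by presburger
      thus "s \<in> fspan (phiR \<phi> 1 ` {-11..10})"
        using fspan_mono_interval[OF xi_in_fspan_phiR[of 1 n], of "-11" 10] unfolding n(1)
        by (elim disjE) (auto split: if_splits)
    qed
    moreover have "\<phi> l \<in> fspan (phiR \<phi> 1 ` {-11..10})" if "l \<in> {1..4}" for l
      using phi_14_level_1[OF that] by (rule fspan_mono[rotated]) auto
    moreover have "dilate 0 (-1) (\<phi> l) \<in> fspan (phiR \<phi> 1 ` {-11..10})" if "l \<in> {1..4}" for l
      using shift_level_1[OF phi_14_level_1[OF that], of "-1"] by (rule fspan_mono[rotated]) auto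
    ultimately show "s \<in> fspan (phiR \<phi> 1 ` {-11..10})" using s by blast
  qed
  thus "l \<in> {5, 6} \<Longrightarrow> \<phi> l \<in> fspan (phiR \<phi> 1 ` {-11..10})"
    by - (rule fspan_trans[OF phi_56_in_fspan_G], auto)
qed

lemma phiR_refine: "phiR \<phi> j n \<in> fspan (range (phiR \<phi> (Suc j)))"
proof -
  obtain k l where l: "l \<in> {1..6}" "n = 6 * k + int l" by (rule index6_cases)
  have "\<phi> l \<in> fspan (range (phiR \<phi> 1))"
  proof -
    have "l \<in> {1..4} \<or> l \<in> {5, 6}" using l(1) by auto
    thus ?thesis using phi_14_level_1[of l] phi_56_level_1[of l]
      by (elim disjE) (auto elim!: fspan_mono[rotated])
  qed
  from fspan_dilate[OF this, of j] have "phiR \<phi> j n \<in> fspan (dilate j (if l \<le> 4 then k else k + 1) ` range (phiR \<phi> 1))"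
    using l by (simp only: phiR_eq)
  thus ?thesis by (rule fspan_mono[rotated]) (auto simp: dilate_phiR Suc_eq_plus1 add.commute)
qed

end

section \<open>The wavelets on the line\<close>

locale spline_wavelets = spline_scaling +
  fixes \<psi> :: "nat \<Rightarrow> real \<Rightarrow> real"
  assumes wavelets: "wavelet_generators \<phi> \<psi>"
begin

lemma phiR_C1_spline: "C1_spline (2 + j) (phiR \<phi> j n)"
  by (rule index6_cases[of n]) (simp only: phiR_eq C1_spline_dilate phi_C1_spline)

text \<open>The index range starts just after the pair \<open>6 * a - 1\<close>,
  \<open>6 * a\<close> straddling the left end and stops just before the pair
  \<open>6 * c - 1\<close>, \<open>6 * c\<close> straddling the right end.\<close>

lemma phiR_supp_in:
  assumes "6 * a + 1 \<le> n" "n \<le> 6 * c - 2"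
  shows "supp_in (of_int a / 2 ^ j) (of_int c / 2 ^ j) (phiR \<phi> j n)"
proof -
  obtain k l where l: "l \<in> {1..6}" "n = 6 * k + int l" by (rule index6_cases)
  have a: "a \<le> k" using assms(1) l by auto
  have c: "k + (if l \<le> 4 then 1 else 2) \<le> c" using assms(2) l by (auto split: if_splits)
  have "supp_in (((if l \<le> 4 then 0 else -1) + of_int (if l \<le> 4 then k else k + 1)) / 2 ^ j)
      ((1 + of_int (if l \<le> 4 then k else k + 1)) / 2 ^ j) (phiR \<phi> j n)"
    unfolding l(2) phiR_eq[OF l(1)] by (rule supp_in_dilate[OF phi_supp_in[OF l(1)]])
  thus ?thesis
  proof (rule supp_in_mono)
    have "real_of_int a \<le> of_int k" "real_of_int (k + (if l \<le> 4 then 1 else 2)) \<le> of_int c"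
      using a c by (simp_all only: of_int_le_iff)
    thus "of_int a / 2 ^ j \<le> ((if l \<le> 4 then 0 else - 1) + real_of_int (if l \<le> 4 then k else k + 1)) / 2 ^ j"
      "(1 + real_of_int (if l \<le> 4 then k else k + 1)) / 2 ^ j \<le> of_int c / 2 ^ j"
      by (auto intro!: divide_right_mono split: if_splits)
  qed
qed

lemma fspan_phiR_square_integrable: "f \<in> fspan (phiR \<phi> j ` A) \<Longrightarrow> sqint f"
  by (rule fspan_square_integrable) (auto simp: phiR_square_integrable)

lemma fspan_phiR_orthogonal:
  assumes "f \<in> fspan (phiR \<phi> j ` A)" "g \<in> fspan (phiR \<phi> j ` B)" "A \<inter> B = {}"
  shows "l2ip f g = 0"
  using assms by (intro fspan_orthogonal2[OF assms(1,2)]) (auto simp: phiR_square_integrable phiR_inner)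

definition cell :: "(real \<Rightarrow> real) set" where "cell = fspan (phiR \<phi> 1 ` {1..10})"

text \<open>A unit translation changes level-\<open>1\<close> indices by \<open>12\<close>:
  \<open>-11..-2\<close> is the copy of \<open>cell\<close> in \<open>[-1, 0]\<close>, and
  \<open>-1\<close>, \<open>0\<close> straddle the origin.\<close>

definition two_cells :: "(real \<Rightarrow> real) set" where "two_cells = fspan (phiR \<phi> 1 ` {-11..10})"

lemma cell_subset: "f \<in> cell \<Longrightarrow> f \<in> two_cells"
  unfolding cell_def two_cells_def by (rule fspan_mono_interval) auto

lemma two_cells_square_integrable: "f \<in> two_cells \<Longrightarrow> sqint f"
  unfolding two_cells_def by (rule fspan_phiR_square_integrable)

lemma cell_square_integrable: "f \<in> cell \<Longrightarrow> sqint f"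
  using cell_subset two_cells_square_integrable by blast

lemma cell_supp_in: "f \<in> cell \<Longrightarrow> supp_in 0 1 f"
  unfolding cell_def by (erule fspan_supp_in) (use phiR_supp_in[of 0 _ 2 1] in auto)

lemma two_cells_supp_in: "f \<in> two_cells \<Longrightarrow> supp_in (-1) 1 f"
  unfolding two_cells_def by (erule fspan_supp_in) (use phiR_supp_in[of "-2" _ 2 1] in auto)

lemma phi_level_1: "l \<in> {1..6} \<Longrightarrow> \<phi> l \<in> two_cells"
proof -
  assume "l \<in> {1..6}"
  hence "l \<in> {1..4} \<or> l \<in> {5, 6}" by auto
  thus ?thesis
    using phi_14_level_1 phi_56_level_1 cell_subset unfolding two_cells_def cell_def by blast
qed

lemma scaled_phi:
  "k \<in> {1..4} \<Longrightarrow> (\<lambda>x. \<phi> k (2 * x)) = (\<lambda>x. (1 / 2 powr (1/2)) * phiR \<phi> 1 (int k) x)"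
  "k \<in> {1..4} \<Longrightarrow> (\<lambda>x. \<phi> k (2 * x - 1)) = (\<lambda>x. (1 / 2 powr (1/2)) * phiR \<phi> 1 (int k + 6) x)"
  "k \<in> {5, 6} \<Longrightarrow> (\<lambda>x. \<phi> k (2 * x - 1)) = (\<lambda>x. (1 / 2 powr (1/2)) * phiR \<phi> 1 (int k) x)"
  "k \<in> {5, 6} \<Longrightarrow> (\<lambda>x. \<phi> k (2 * x)) = (\<lambda>x. (1 / 2 powr (1/2)) * phiR \<phi> 1 (int k - 6) x)"
  using phiR_eq[of k 1 0] phiR_eq[of k 1 1] phiR_eq[of k 1 "-1"]
  by (auto simp: dilate_def add.commute)

abbreviation gen12 :: "(real \<Rightarrow> real) set" where
  "gen12 \<equiv> {\<lambda>x. \<phi> k (2 * x) |k. k \<in> {1..4}} \<union> {\<lambda>x. \<phi> k (2 * x - 1) |k. k \<in> {1..6}}"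

lemma fspan_gen12: "fspan gen12 = cell"
proof (intro set_eqI iffI)
  fix f assume "f \<in> fspan gen12"
  thus "f \<in> cell" unfolding cell_def
  proof (rule fspan_trans)
    fix s assume "s \<in> gen12"
    then obtain k where "s = (\<lambda>x. \<phi> k (2 * x)) \<and> k \<in> {1..4} \<or> s = (\<lambda>x. \<phi> k (2 * x - 1)) \<and> (k \<in> {1..4} \<or> k \<in> {5, 6})"
      by fastforce
    then obtain n where "s = (\<lambda>x. (1 / 2 powr (1/2)) * phiR \<phi> 1 n x)" "n \<in> {1..10}"
      using scaled_phi[of k] by fastforce
    thus "s \<in> fspan (phiR \<phi> 1 ` {1..10})" by (metis fspan_base fspan_cmult imageI)
  qed
next
  fix f assume "f \<in> cell"
  thus "f \<in> fspan gen12" unfolding cell_def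
  proof (rule fspan_trans)
    fix s assume "s \<in> phiR \<phi> 1 ` {1..10}"
    then obtain n where n: "s = phiR \<phi> 1 n" "1 \<le> n" "n \<le> 10" by auto
    have base: "s \<in> fspan gen12" if "t \<in> gen12" "t = (\<lambda>x. (1 / 2 powr (1/2)) * s x)" for t
    proof -
      have "s = (\<lambda>x. 2 powr (1/2) * t x)" using that(2) by simp
      thus ?thesis using fspan_cmult[OF fspan_base[OF that(1)], of "2 powr (1/2)"] by simp
    qed
    consider "n \<le> 4" | "n \<in> {5, 6}" | "7 \<le> n" using n by fastforce
    thus "s \<in> fspan gen12"
    proof cases
      case 1
      hence "nat n \<in> {1..4}" using n by auto
      hence "(\<lambda>x. \<phi> (nat n) (2 * x)) \<in> gen12" by (intro UnI1 CollectI exI[of _ "nat n"]) auto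
      thus ?thesis by (rule base) (use n scaled_phi(1)[of "nat n"] \<open>nat n \<in> {1..4}\<close> in simp)
    next
      case 2
      hence "nat n \<in> {5, 6}" using n by auto
      hence "(\<lambda>x. \<phi> (nat n) (2 * x - 1)) \<in> gen12" by (intro UnI2 CollectI exI[of _ "nat n"]) auto
      thus ?thesis by (rule base) (use n scaled_phi(3)[of "nat n"] \<open>nat n \<in> {5, 6}\<close> in simp)
    next
      case 3
      hence "nat (n - 6) \<in> {1..4}" using n by auto
      hence "(\<lambda>x. \<phi> (nat (n - 6)) (2 * x - 1)) \<in> gen12" by (intro UnI2 CollectI exI[of _ "nat (n - 6)"]) auto
      thus ?thesis by (rule base) (use n 3 scaled_phi(2)[of "nat (n - 6)"] \<open>nat (n - 6) \<in> {1..4}\<close> in simp)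
    qed
  qed
qed

lemma psi_12_space:
  "fspan {\<psi> 1, \<psi> 2} = {f \<in> cell. (\<forall>m\<in>{1..6}. l2ip f (\<phi> m) = 0) \<and> (\<forall>m\<in>{5, 6}. l2ip f (dilate 0 1 (\<phi> m)) = 0)}"
  "l2ip (\<psi> 1) (\<psi> 1) = 1" "l2ip (\<psi> 2) (\<psi> 2) = 1" "l2ip (\<psi> 1) (\<psi> 2) = 0"
proof -
  have b: "orthonormal_basis2 (\<psi> 1) (\<psi> 2)
      (cell \<ominus> (\<phi> ` {1..6} \<union> {\<lambda>x. \<phi> 5 (x - 1), \<lambda>x. \<phi> 6 (x - 1)}))"
    using wavelets unfolding wavelet_generators_def fspan_gen12 by blast
  thus "l2ip (\<psi> 1) (\<psi> 1) = 1" "l2ip (\<psi> 2) (\<psi> 2) = 1" "l2ip (\<psi> 1) (\<psi> 2) = 0"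
    by (auto simp: orthonormal_basis2_def l2_norm_eq_1_iff)
  show "fspan {\<psi> 1, \<psi> 2} = {f \<in> cell. (\<forall>m\<in>{1..6}. l2ip f (\<phi> m) = 0) \<and> (\<forall>m\<in>{5, 6}. l2ip f (dilate 0 1 (\<phi> m)) = 0)}"
    using b unfolding orthonormal_basis2_def l2_minus_def by (auto simp: dilate_0)
qed

lemma psi_12_cell: "l \<in> {1, 2} \<Longrightarrow> \<psi> l \<in> cell"
  and psi_12_inner_phi: "l \<in> {1, 2} \<Longrightarrow> m \<in> {1..6} \<Longrightarrow> l2ip (\<psi> l) (\<phi> m) = 0"
  and psi_12_inner_phi_shift: "l \<in> {1, 2} \<Longrightarrow> m \<in> {5, 6} \<Longrightarrow> l2ip (\<psi> l) (dilate 0 1 (\<phi> m)) = 0"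
proof -
  have "l \<in> {1, 2} \<Longrightarrow> \<psi> l \<in> fspan {\<psi> 1, \<psi> 2}" by (rule fspan_base) auto
  thus "l \<in> {1, 2} \<Longrightarrow> \<psi> l \<in> cell" "l \<in> {1, 2} \<Longrightarrow> m \<in> {1..6} \<Longrightarrow> l2ip (\<psi> l) (\<phi> m) = 0"
    "l \<in> {1, 2} \<Longrightarrow> m \<in> {5, 6} \<Longrightarrow> l2ip (\<psi> l) (dilate 0 1 (\<phi> m)) = 0"
    unfolding psi_12_space(1) by blast+
qed

lemma psi_56_space:
  "fspan {\<psi> 5, \<psi> 6} = {f \<in> two_cells. (\<forall>n\<in>{-7..6}. l2ip f (phiR \<phi> 0 n) = 0) \<and>
     (\<forall>l\<in>{1, 2}. l2ip f (dilate 0 (-1) (\<psi> l)) = 0) \<and> (\<forall>l\<in>{1..4}. l2ip f (\<psi> l) = 0)}"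
  "l2ip (\<psi> 5) (\<psi> 5) = 1" "l2ip (\<psi> 6) (\<psi> 6) = 1" "l2ip (\<psi> 5) (\<psi> 6) = 0"
proof -
  have b: "orthonormal_basis2 (\<psi> 5) (\<psi> 6) (two_cells
        \<ominus> (phiR \<phi> 0 ` {-7..6} \<union> {\<lambda>x. \<psi> 1 (x + 1), \<lambda>x. \<psi> 2 (x + 1)} \<union> \<psi> ` {1..4}))"
    using wavelets unfolding wavelet_generators_def two_cells_def by blast
  thus "l2ip (\<psi> 5) (\<psi> 5) = 1" "l2ip (\<psi> 6) (\<psi> 6) = 1" "l2ip (\<psi> 5) (\<psi> 6) = 0"
    by (auto simp: orthonormal_basis2_def l2_norm_eq_1_iff)
  show "fspan {\<psi> 5, \<psi> 6} = {f \<in> two_cells. (\<forall>n\<in>{-7..6}. l2ip f (phiR \<phi> 0 n) = 0) \<and>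
     (\<forall>l\<in>{1, 2}. l2ip f (dilate 0 (-1) (\<psi> l)) = 0) \<and> (\<forall>l\<in>{1..4}. l2ip f (\<psi> l) = 0)}"
    using b unfolding orthonormal_basis2_def l2_minus_def by (auto simp: dilate_0)
qed

lemma psi_56:
  assumes "l \<in> {5, 6}"
  shows "\<psi> l \<in> two_cells" "n \<in> {-7..6} \<Longrightarrow> l2ip (\<psi> l) (phiR \<phi> 0 n) = 0"
    "m \<in> {1, 2} \<Longrightarrow> l2ip (\<psi> l) (dilate 0 (-1) (\<psi> m)) = 0" "m \<in> {1..4} \<Longrightarrow> l2ip (\<psi> l) (\<psi> m) = 0"
proof -
  have "\<psi> l \<in> fspan {\<psi> 5, \<psi> 6}" using assms by (intro fspan_base) auto
  thus "\<psi> l \<in> two_cells" "n \<in> {-7..6} \<Longrightarrow> l2ip (\<psi> l) (phiR \<phi> 0 n) = 0"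
    "m \<in> {1, 2} \<Longrightarrow> l2ip (\<psi> l) (dilate 0 (-1) (\<psi> m)) = 0" "m \<in> {1..4} \<Longrightarrow> l2ip (\<psi> l) (\<psi> m) = 0"
    unfolding psi_56_space(1) by blast+
qed

section \<open>The wavelets \<open>\<psi> 3\<close>, \<open>\<psi> 4\<close>\<close>

lemma l2_inner_unshift: "l2ip f (dilate 0 k g) = l2ip (dilate 0 (- k) f) g"
  using l2_inner_shift[of "- k" f 0 g] by simp

text \<open>This is \<open>\<phi> (i + 4) (2 * x)\<close>, the level-\<open>1\<close> function
  straddling the origin; the factor undoes the normalization contained in
  \<open>phiR\<close>.\<close>

definition \<beta> :: "nat \<Rightarrow> real \<Rightarrow> real" where
  "\<beta> i = (\<lambda>x. (1 / 2 powr (1/2)) * phiR \<phi> 1 (int i - 2) x)"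

lemma h_fun_eq:
  assumes "i \<in> {1, 2}"
  shows "h_fun \<phi> i = (\<lambda>x. \<beta> i x - l2ip (\<beta> i) (\<phi> 5) * \<phi> 5 x - l2ip (\<beta> i) (\<phi> 6) * \<phi> 6 x)"
proof -
  have "(\<lambda>x. \<phi> (i + 4) (2 * x)) = \<beta> i" using assms scaled_phi(4)[of "i + 4"] by (auto simp: \<beta>_def)
  thus ?thesis by (simp add: h_fun_def Let_def)
qed

lemma \<beta>_square_integrable: "sqint (\<beta> i)"
  unfolding \<beta>_def by (intro square_integrable_cmult phiR_square_integrable)

lemma h_fun_inner:
  assumes "i \<in> {1, 2}" "sqint g"
  shows "l2ip (h_fun \<phi> i) g = l2ip (\<beta> i) g - l2ip (\<beta> i) (\<phi> 5) * l2ip (\<phi> 5) g - l2ip (\<beta> i) (\<phi> 6) * l2ip (\<phi> 6) g"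
  using assms(2) unfolding h_fun_eq[OF assms(1)]
  by (simp add: l2_inner_diff_left square_integrable_diff square_integrable_cmult l2_inner_cmult_left
      \<beta>_square_integrable phi_square_integrable)

lemma h_fun_two_cells: "i \<in> {1, 2} \<Longrightarrow> h_fun \<phi> i \<in> two_cells"
proof -
  assume i: "i \<in> {1, 2}"
  have "\<beta> i \<in> two_cells" unfolding \<beta>_def two_cells_def using i by (intro fspan_cmult fspan_base) auto
  thus "h_fun \<phi> i \<in> two_cells" unfolding h_fun_eq[OF i]
    using phi_level_1[of 5] phi_level_1[of 6] unfolding two_cells_def
    by (intro fspan_diff fspan_cmult) auto
qed

lemma \<beta>_orthogonal:
  assumes "i \<in> {1, 2}" "f \<in> fspan (phiR \<phi> 1 ` A)" "-1 \<notin> A" "0 \<notin> A"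
  shows "l2ip (\<beta> i) f = 0"
proof -
  have "phiR \<phi> 1 (int i - 2) \<in> fspan (phiR \<phi> 1 ` {-1, 0})"
    using assms(1) by (intro fspan_base) auto
  hence "l2ip (phiR \<phi> 1 (int i - 2)) f = 0"
    using assms by (intro fspan_phiR_orthogonal[of _ 1 "{-1, 0}" _ A]) auto
  thus ?thesis unfolding \<beta>_def l2_inner_cmult_left by simp
qed

text \<open>Among the level-\<open>0\<close> scaling functions only \<open>\<phi> 5\<close> and
  \<open>\<phi> 6\<close> can involve the level-\<open>1\<close> indices \<open>-1\<close> and
  \<open>0\<close> that carry \<open>\<beta>\<close>. Hence subtracting two projections already
  gives orthogonality to all translates.\<close>

lemma h_fun_inner_phi:
  assumes i: "i \<in> {1, 2}" and m: "m \<in> {1..6}"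
  shows "l2ip (h_fun \<phi> i) (dilate 0 k (\<phi> m)) = 0"
proof -
  have s: "sqint (dilate 0 k (\<phi> m))" by (intro square_integrable_dilate phi_square_integrable m)
  have p: "l2ip (\<phi> 5) (dilate 0 k (\<phi> m)) = (if m = 5 \<and> k = 0 then 1 else 0)"
    "l2ip (\<phi> 6) (dilate 0 k (\<phi> m)) = (if m = 6 \<and> k = 0 then 1 else 0)"
    using phi_inner[of 5 m k] phi_inner[of 6 m k] m by auto
  show ?thesis
  proof (cases "m \<in> {5, 6} \<and> k = 0")
    case True
    thus ?thesis unfolding h_fun_inner[OF i s] p by auto
  next
    case False
    have "l2ip (\<beta> i) (dilate 0 k (\<phi> m)) = 0"
    proof (cases "m \<le> 4")
      case True
      hence "dilate 0 k (\<phi> m) \<in> fspan (phiR \<phi> 1 ` {1 + 12 * k..10 + 12 * k})"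
        using m by (intro shift_level_1 phi_14_level_1) auto
      thus ?thesis by (rule \<beta>_orthogonal[OF i]) (auto; presburger)+
    next
      case m4: False
      hence "dilate 0 k (\<phi> m) \<in> fspan (phiR \<phi> 1 ` {-11 + 12 * k..10 + 12 * k})"
        using m by (intro shift_level_1 phi_56_level_1) auto
      thus ?thesis by (rule \<beta>_orthogonal[OF i]) (use False m m4 in auto)
    qed
    thus ?thesis unfolding h_fun_inner[OF i s] p using False by auto
  qed
qed

lemma psi_3: "\<psi> 3 = l2_normalize (h_fun \<phi> 1)"
  and psi_4: "\<psi> 4 = l2_normalize (\<lambda>x. h_fun \<phi> 2 x - l2ip (h_fun \<phi> 2) (\<psi> 3) * \<psi> 3 x)"
  using wavelets unfolding wavelet_generators_def by blast+

lemma psi_34_in_fspan: "l \<in> {3, 4} \<Longrightarrow> \<psi> l \<in> fspan {h_fun \<phi> 1, h_fun \<phi> 2}"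
proof -
  have 3: "\<psi> 3 \<in> fspan {h_fun \<phi> 1, h_fun \<phi> 2}" unfolding psi_3 by (intro fspan_normalize fspan_base) auto
  have "\<psi> 4 \<in> fspan {h_fun \<phi> 1, h_fun \<phi> 2}"
    unfolding psi_4 by (intro fspan_normalize fspan_diff fspan_cmult 3) (auto intro: fspan_base)
  thus "l \<in> {3, 4} \<Longrightarrow> \<psi> l \<in> fspan {h_fun \<phi> 1, h_fun \<phi> 2}" using 3 by auto
qed

lemma psi_34_orthogonal:
  assumes "l \<in> {3, 4}" "sqint f" "l2ip (h_fun \<phi> 1) f = 0" "l2ip (h_fun \<phi> 2) f = 0"
  shows "l2ip (\<psi> l) f = 0"
  by (rule fspan_orthogonal[OF psi_34_in_fspan[OF assms(1)]])
    (use assms h_fun_two_cells two_cells_square_integrable in auto)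

lemma psi_two_cells: "l \<in> {1..6} \<Longrightarrow> \<psi> l \<in> two_cells"
proof -
  have "\<psi> l \<in> two_cells" if "l \<in> {3, 4}"
    using psi_34_in_fspan[OF that] h_fun_two_cells unfolding two_cells_def
    by (elim fspan_trans) auto
  moreover assume "l \<in> {1..6}"
  hence "l \<in> {1, 2} \<or> l \<in> {3, 4} \<or> l \<in> {5, 6}" by auto
  ultimately show ?thesis using psi_12_cell cell_subset psi_56(1) by blast
qed

lemma psi_square_integrable: "l \<in> {1..6} \<Longrightarrow> sqint (\<psi> l)"
  using two_cells_square_integrable psi_two_cells by blast

text \<open>If \<open>\<psi> 3\<close> or \<open>\<psi> 4\<close> were zero, then \<open>21\<close> conditions would suffice to force an element of the
  \<open>22\<close>-dimensional space \<open>two_cells\<close> to vanish.\<close>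

lemma psi_34_nonzero:
  assumes "\<psi> 3 = (\<lambda>x. 0) \<or> \<psi> 4 = (\<lambda>x. 0)"
  shows False
proof -
  \<comment> \<open>\<open>y\<close> is the other one of the two: orthogonality to the zero function
    is automatic, so one condition replaces two.\<close>
  obtain y where y: "y \<in> {\<psi> 3, \<psi> 4}" "\<And>z g. z \<in> {\<psi> 3, \<psi> 4} \<Longrightarrow> l2ip g y = 0 \<Longrightarrow> l2ip g z = 0"
    using assms by (metis insertE insertI1 l2_inner_zero(2) singletonD insertI2)
  define Z where "Z = phiR \<phi> 0 ` {-7..6} \<union> {dilate 0 (-1) (\<psi> 1), dilate 0 (-1) (\<psi> 2), \<psi> 1, \<psi> 2} \<union> {\<psi> 5, \<psi> 6, y}"
  have "card Z \<le> card (phiR \<phi> 0 ` {-7..6::int}) + card {dilate 0 (-1) (\<psi> 1), dilate 0 (-1) (\<psi> 2), \<psi> 1, \<psi> 2}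
      + card {\<psi> 5, \<psi> 6, y}"
    unfolding Z_def by (rule order.trans[OF card_Un_le add_right_mono[OF card_Un_le]])
  also have "card (phiR \<phi> 0 ` {-7..6::int}) \<le> 14"
    using card_image_le[of "{-7..6::int}" "phiR \<phi> 0"] by simp
  also have "card {dilate 0 (-1) (\<psi> 1), dilate 0 (-1) (\<psi> 2), \<psi> 1, \<psi> 2} \<le> 4"
    by (simp add: card_insert_if)
  also have "card {\<psi> 5, \<psi> 6, y} \<le> 3"
    by (simp add: card_insert_if)
  finally have "card Z < card {-11..10::int}" by simp
  moreover have "finite Z" by (simp add: Z_def)
  ultimately obtain c where c: "\<exists>n\<in>{-11..10}. c n \<noteq> 0"
    "\<And>z. z \<in> Z \<Longrightarrow> (\<Sum>n\<in>{-11..10}. l2ip (phiR \<phi> 1 n) z * c n) = 0"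
    using underdetermined_system[of Z "{-11..10::int}" "\<lambda>z n. l2ip (phiR \<phi> 1 n) z"] by auto
  define f where "f = (\<lambda>x. \<Sum>n\<in>{-11..10}. c n * phiR \<phi> 1 n x)"
  have f: "f \<in> two_cells" unfolding f_def two_cells_def by (intro fspan_sum fspan_cmult fspan_base) auto
  have fz: "l2ip f z = 0" if "z \<in> Z" for z
  proof -
    have sy: "sqint y" using y(1) psi_square_integrable[of 3] psi_square_integrable[of 4] by auto
    have "sqint z" using that unfolding Z_def
      by (auto simp: sy phiR_square_integrable psi_square_integrable square_integrable_dilate)
    thus ?thesis using c(2)[OF that]
      by (simp add: f_def l2_inner_scaled_sum_left phiR_square_integrable mult.commute)
  qed
  have "l2ip f (\<psi> l) = 0" if "l \<in> {1..4}" for l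
  proof -
    have "l \<in> {1, 2} \<or> l \<in> {3, 4}" using that by auto
    thus ?thesis using fz y unfolding Z_def by auto
  qed
  hence "f \<in> fspan {\<psi> 5, \<psi> 6}"
    using f fz unfolding psi_56_space(1) Z_def by auto
  \<comment> \<open>\<open>f\<close> satisfies the conditions that define the span of
    \<open>\<psi> 5\<close>, \<open>\<psi> 6\<close> and is also orthogonal to both, although its
    coefficients are not all zero.\<close>
  then obtain a b where ab: "f = (\<lambda>x. a * \<psi> 5 x + b * \<psi> 6 x)" unfolding fspan_pair_iff by blast
  have "l2ip f (\<psi> 5) = a" "l2ip f (\<psi> 6) = b"
    unfolding ab using psi_56_space(2-4) psi_square_integrable[of 5] psi_square_integrable[of 6]
    by (simp_all add: l2_inner_add_left square_integrable_cmult l2_inner_cmult_left l2_inner_commute[of _ "\<psi> 6" "\<psi> 5"])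
  moreover have "l2ip f (\<psi> 5) = 0" "l2ip f (\<psi> 6) = 0" using fz by (auto simp: Z_def)
  ultimately have "f = (\<lambda>x. 0)" using ab by simp
  moreover obtain n where "n \<in> {-11..10}" "c n \<noteq> 0" using c(1) by blast
  moreover have "l2ip f (phiR \<phi> 1 n) = (if n \<in> {-11..10} then c n else 0)"
    by (rule orthonormal_lincomb_inner[OF phiR_square_integrable phiR_inner _ f_def]) simp
  ultimately show False by simp
qed

lemma psi_34_inner:
  "l2ip (\<psi> 3) (\<psi> 3) = 1" "l2ip (\<psi> 4) (\<psi> 4) = 1" "l2ip (\<psi> 3) (\<psi> 4) = 0"
proof -
  \<comment> \<open>A vanishing norm would make the quotient in \<open>l2_normalize\<close>
    identically \<open>0\<close>, as division by zero returns \<open>0\<close>.\<close>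
  have norm: "l2ip (l2_normalize f) (l2_normalize f) = 1" if "l2_normalize f \<noteq> (\<lambda>x. 0)" for f
    using that by (intro l2_inner_normalize_self) (auto simp: l2_normalize_def l2_norm_def)
  show 3: "l2ip (\<psi> 3) (\<psi> 3) = 1" unfolding psi_3 using psi_34_nonzero by (intro norm) (auto simp: psi_3)
  show "l2ip (\<psi> 4) (\<psi> 4) = 1" using psi_34_nonzero norm psi_4 by metis
  have s: "sqint (h_fun \<phi> 2)" using h_fun_two_cells two_cells_square_integrable by blast
  have "l2ip (\<lambda>x. h_fun \<phi> 2 x - l2ip (h_fun \<phi> 2) (\<psi> 3) * \<psi> 3 x) (\<psi> 3) = 0"
    using s 3 psi_square_integrable[of 3]
    by (simp add: l2_inner_diff_left square_integrable_cmult l2_inner_cmult_left)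
  hence "l2ip (\<psi> 4) (\<psi> 3) = 0" using l2_inner_normalize_left psi_4 by (metis div_0)
  thus "l2ip (\<psi> 3) (\<psi> 4) = 0" by (simp add: l2_inner_commute)
qed

lemma psi_inner_phi:
  assumes "l \<in> {1..6}" "m \<in> {1..6}"
  shows "l2ip (\<psi> l) (dilate 0 k (\<phi> m)) = 0"
proof -
  have disj: "l2ip f (dilate 0 k (\<phi> m)) = 0"
    if "supp_in (of_int a) 1 f" "1 \<le> (if m \<le> 4 then 0 else -1) + k \<or> 1 + k \<le> a" for f a
  proof (rule l2_inner_disjoint[OF that(1) supp_in_dilate[OF phi_supp_in[OF assms(2)]]])
    have "1 \<le> real_of_int ((if m \<le> 4 then 0 else -1) + k) \<or> real_of_int (1 + k) \<le> of_int a"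
      using that(2) by linarith
    thus "1 \<le> ((if m \<le> 4 then 0 else - 1) + real_of_int k) / 2 ^ 0 \<or> (1 + real_of_int k) / 2 ^ 0 \<le> of_int a"
      by (simp split: if_splits)
  qed
  consider "l \<in> {1, 2}" | "l \<in> {3, 4}" | "l \<in> {5, 6}" using assms(1) by force
  thus ?thesis
  proof cases
    case 1
    have s: "supp_in (of_int 0) 1 (\<psi> l)" using cell_supp_in[OF psi_12_cell[OF 1]] by simp
    have "m \<le> 4 \<or> m \<in> {5, 6}" using assms(2) by auto
    then consider "k = 0" | "k = 1" "m \<in> {5, 6}" | "1 \<le> (if m \<le> 4 then 0 else -1) + k \<or> 1 + k \<le> 0"
      by fastforce
    thus ?thesis
      using psi_12_inner_phi[OF 1 assms(2)] psi_12_inner_phi_shift[OF 1, of m] disj[OF s] by cases auto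
  next
    case 2
    thus ?thesis
      by (intro psi_34_orthogonal square_integrable_dilate phi_square_integrable h_fun_inner_phi assms) auto
  next
    case 3
    have s: "supp_in (of_int (-1)) 1 (\<psi> l)" using two_cells_supp_in[OF psi_56(1)[OF 3]] by simp
    \<comment> \<open>The indices \<open>-7..6\<close> list all level-\<open>0\<close> functions
      whose supports meet \<open>(-1, 1)\<close>; every other translate is disjoint from
      \<open>\<psi> l\<close>.\<close>
    consider "6 * (if m \<le> 4 then k else k - 1) + int m \<in> {-7..6}" | "1 \<le> (if m \<le> 4 then 0 else -1) + k \<or> 1 + k \<le> -1"
    proof -
      have "k \<in> {-1, 0} \<or> k = 1 \<and> m > 4 \<or> 1 \<le> (if m \<le> 4 then 0 else -1) + k \<or> 1 + k \<le> -1" by auto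
      thus ?thesis using assms(2) that by auto
    qed
    thus ?thesis
    proof cases
      case 1
      from psi_56(2)[OF 3 this] show ?thesis using assms(2) by (simp add: phiR_eq split: if_splits)
    next
      case 2
      thus ?thesis using disj[OF s] by simp
    qed
  qed
qed

text \<open>For \<open>k \<noteq> 0\<close> the translate involves level-\<open>1\<close> indices
  other than \<open>-1\<close> and \<open>0\<close>, so \<open>\<beta>\<close> does not see it; the
  projections subtracted in \<open>h_fun\<close> are covered by \<open>orth\<close>.\<close>

lemma h_fun_inner_shift:
  assumes i: "i \<in> {1, 2}" and f: "f \<in> two_cells" and k: "k \<noteq> 0"
    and orth: "\<And>m. m \<in> {5, 6} \<Longrightarrow> l2ip (dilate 0 k f) (\<phi> m) = 0"
  shows "l2ip (h_fun \<phi> i) (dilate 0 k f) = 0"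
proof -
  have s: "sqint (dilate 0 k f)" by (intro square_integrable_dilate two_cells_square_integrable f)
  have "l2ip (\<beta> i) (dilate 0 k f) = 0"
    by (rule \<beta>_orthogonal[OF i shift_level_1[OF f[unfolded two_cells_def]]]) (use k in auto)
  thus ?thesis unfolding h_fun_inner[OF i s] using orth[of 5] orth[of 6] by (simp add: l2_inner_commute)
qed

text \<open>Elements of \<open>cell\<close> avoid the straddling indices \<open>-1\<close> and
  \<open>0\<close> under every translation, so \<open>k = 0\<close> is allowed here.\<close>

lemma h_fun_inner_cell:
  assumes i: "i \<in> {1, 2}" and f: "f \<in> cell" and orth: "\<And>m. m \<in> {5, 6} \<Longrightarrow> l2ip (dilate 0 k f) (\<phi> m) = 0"
  shows "l2ip (h_fun \<phi> i) (dilate 0 k f) = 0"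
proof -
  have s: "sqint (dilate 0 k f)" by (intro square_integrable_dilate cell_square_integrable f)
  have "l2ip (\<beta> i) (dilate 0 k f) = 0"
    by (rule \<beta>_orthogonal[OF i shift_level_1[OF f[unfolded cell_def]]]) (auto; presburger)+
  thus ?thesis unfolding h_fun_inner[OF i s] using orth[of 5] orth[of 6] by (simp add: l2_inner_commute)
qed

text \<open>The two functions only overlap on one cell, so that they can be projected onto \<open>cell\<close>.
  There, everything orthogonal to \<open>\<phi> 1, \<dots>, \<phi> 4, \<psi> 1, \<psi> 2\<close> is a sum of projections of elements of
  \<open>span {\<phi> 5, \<phi> 6}\<close> and \<open>span {\<phi> 5 (\<cdot> - 1), \<phi> 6 (\<cdot> - 1)}\<close>, and these are orthogonal to each other.\<close>

lemma psi_56_inner_shift: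
  assumes f: "f \<in> {\<psi> 5, \<psi> 6}" and g: "g \<in> {\<psi> 5, \<psi> 6}"
  shows "l2ip f (dilate 0 1 g) = 0"
proof -
  define b where "b = phiR \<phi> 1"
  define P where "P = (\<lambda>u x. \<Sum>n\<in>{1..10}. l2ip u (b n) * b n x)"
  have sb: "sqint (b n)" for n by (simp add: b_def phiR_square_integrable)
  have P_cell: "P u \<in> cell" for u
    unfolding P_def cell_def b_def by (intro fspan_sum fspan_cmult fspan_base) auto
  have sP: "sqint (P u)" for u by (rule cell_square_integrable[OF P_cell])
  have Pb: "l2ip (P u) (b n) = (if n \<in> {1..10} then l2ip u (b n) else 0)" for u n
    by (rule orthonormal_lincomb_inner[where b = b and c = "\<lambda>n. l2ip u (b n)", OF sb _ _ P_def[THEN fun_cong]])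
      (auto simp: b_def phiR_inner)
  \<comment> \<open>If the two expansions share only indices of \<open>cell\<close>, the part
    removed from \<open>u\<close> by the projection is invisible to \<open>v\<close>.\<close>
  have P_id: "l2ip (P u) v = l2ip u v" if u: "u \<in> fspan (b ` A)" and v: "v \<in> fspan (b ` B)" and AB: "A \<inter> B \<subseteq> {1..10}" for u v A B
  proof -
    have su: "sqint u" and sv: "sqint v" using u v sb by (auto elim!: fspan_square_integrable)
    have "l2ip v (\<lambda>x. u x - P u x) = 0"
    proof (rule fspan_orthogonal[OF v])
      fix t assume "t \<in> b ` B"
      then obtain n where n: "t = b n" "n \<in> B" by blast
      have "l2ip (\<lambda>x. u x - P u x) (b n) = l2ip u (b n) - (if n \<in> {1..10} then l2ip u (b n) else 0)"
        by (simp add: l2_inner_diff_left su sP sb Pb)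
      moreover have "l2ip u (b n) = 0" if "n \<notin> {1..10}"
      proof (rule fspan_orthogonal[OF u])
        have "n \<notin> A" using \<open>n \<notin> {1..10}\<close> n(2) AB by blast
        thus "l2ip s (b n) = 0" if "s \<in> b ` A" for s
          using that by (auto simp: b_def phiR_inner)
      qed (use sb in auto)
      ultimately have "l2ip (\<lambda>x. u x - P u x) (b n) = 0" by auto
      thus "l2ip t (\<lambda>x. u x - P u x) = 0" by (simp add: n l2_inner_commute)
    qed (use sb su sP in \<open>auto intro: square_integrable_diff\<close>)
    thus ?thesis using su sv sP by (simp add: l2_inner_diff_right l2_inner_commute)
  qed
  have two: "u \<in> fspan (b ` {-11..10})" "dilate 0 1 u \<in> fspan (b ` {1..22})" if "u \<in> two_cells" for u
    using that shift_level_1[of u "-11" 10 1] by (simp_all add: two_cells_def b_def)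
  have P_two: "l2ip (P u) (dilate 0 1 v) = l2ip u (dilate 0 1 v)"
    "l2ip (P (dilate 0 1 v)) u = l2ip (dilate 0 1 v) u" if "u \<in> two_cells" "v \<in> two_cells" for u v
    by (rule P_id[OF two(1)[OF that(1)] two(2)[OF that(2)]] P_id[OF two(2)[OF that(2)] two(1)[OF that(1)]]; auto)+
  have P_cell_eq: "l2ip (P u) v = l2ip u v" if "u \<in> fspan (b ` A)" "v \<in> cell" for u v A
    by (rule P_id[OF that(1) that(2)[unfolded cell_def, folded b_def]]) auto
  have f2: "f \<in> two_cells" and g2: "g \<in> two_cells" using f g psi_56(1) by auto
  define f' where "f' = P f"
  define g' where "g' = P (dilate 0 1 g)"
  have fg: "l2ip f (dilate 0 1 g) = l2ip f' g'"
  proof -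
    have "l2ip f' g' = l2ip f' (dilate 0 1 g)"
      using P_cell_eq[OF two(2)[OF g2] P_cell, of f] by (simp add: f'_def g'_def l2_inner_commute)
    thus ?thesis using P_two(1)[OF f2 g2] by (simp add: f'_def)
  qed
  have p5: "\<phi> 5 \<in> two_cells" and p6: "\<phi> 6 \<in> two_cells" by (simp_all add: phi_level_1)
  \<comment> \<open>\<open>f'\<close> is split into its best approximation by the projected
    \<open>\<phi> 5\<close>, \<open>\<phi> 6\<close> and a remainder \<open>r\<close>, which will
    turn out to be zero.\<close>
  obtain x y where xy:
    "l2ip (\<lambda>t. f' t - (x * P (\<phi> 5) t + y * P (\<phi> 6) t)) (P (\<phi> 5)) = 0"
    "l2ip (\<lambda>t. f' t - (x * P (\<phi> 5) t + y * P (\<phi> 6) t)) (P (\<phi> 6)) = 0"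
    using l2_proj2_exists[of lborel "P (\<phi> 5)" "P (\<phi> 6)" f'] sP unfolding f'_def by blast
  define r where "r = (\<lambda>t. f' t - (x * P (\<phi> 5) t + y * P (\<phi> 6) t))"
  have r_cell: "r \<in> cell"
    using P_cell unfolding r_def f'_def cell_def by (intro fspan_diff fspan_add fspan_cmult)
  have r_inner: "l2ip r h = l2ip f' h - (x * l2ip (P (\<phi> 5)) h + y * l2ip (P (\<phi> 6)) h)" if "sqint h" for h
    unfolding r_def using that sP
    by (simp add: l2_inner_diff_left l2_inner_add_left square_integrable_add square_integrable_cmult l2_inner_cmult_left f'_def)
  have f_phi: "l2ip f (dilate 0 k (\<phi> m)) = 0" and g_phi: "l2ip g (dilate 0 k (\<phi> m)) = 0" if "m \<in> {1..6}" for k m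
    using psi_inner_phi[of 5 m k] psi_inner_phi[of 6 m k] that f g by auto
  have r_14: "l2ip r (\<phi> m) = 0" if m: "m \<in> {1..4}" for m
  proof -
    have c: "\<phi> m \<in> cell" using phi_14_level_1[OF m] by (simp add: cell_def)
    have "l2ip (\<phi> 5) (\<phi> m) = 0" "l2ip (\<phi> 6) (\<phi> m) = 0"
      using phi_inner[of 5 m 0] phi_inner[of 6 m 0] m by auto
    thus ?thesis using f_phi[of m 0] m
      by (simp add: r_inner phi_square_integrable f'_def P_cell_eq[OF two(1)[OF f2] c] P_cell_eq[OF two(1)[OF p5] c]
        P_cell_eq[OF two(1)[OF p6] c])
  qed
  have r_56: "l2ip r (\<phi> m) = 0" if m: "m \<in> {5, 6}" for m
  proof -
    have "l2ip (P (\<phi> m)) r = l2ip (\<phi> m) r" using m p5 p6 two(1) by (intro P_cell_eq[OF _ r_cell]) auto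
    moreover have "l2ip r (P (\<phi> m)) = 0" using m xy unfolding r_def by auto
    ultimately show ?thesis by (simp add: l2_inner_commute)
  qed
  \<comment> \<open>The subtracted part does no harm because \<open>\<phi> 5\<close> and
    \<open>\<phi> 6\<close> are orthogonal to their own unit translates. With this, \<open>r\<close>
    fulfils all conditions that define the span of \<open>\<psi> 1\<close>,
    \<open>\<psi> 2\<close>.\<close>
  have r_shift: "l2ip r (dilate 0 1 (\<phi> m)) = 0" if m: "m \<in> {5, 6}" for m
  proof -
    have m2: "\<phi> m \<in> two_cells" using m p5 p6 by auto
    have "l2ip (\<phi> 5) (dilate 0 1 (\<phi> m)) = 0" "l2ip (\<phi> 6) (dilate 0 1 (\<phi> m)) = 0"
      using phi_inner[of 5 m 1] phi_inner[of 6 m 1] m by auto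
    thus ?thesis using f_phi[of m 1] m
      by (subst r_inner) (auto simp: square_integrable_dilate phi_square_integrable f'_def P_two(1)[OF f2 m2]
        P_two(1)[OF p5 m2] P_two(1)[OF p6 m2])
  qed
  have "m \<in> {1..4} \<or> m \<in> {5, 6}" if "m \<in> {1..6}" for m :: nat using that by auto
  hence "r \<in> fspan {\<psi> 1, \<psi> 2}"
    unfolding psi_12_space(1) using r_cell r_14 r_56 r_shift by blast
  then obtain a b' where ab: "r = (\<lambda>t. a * \<psi> 1 t + b' * \<psi> 2 t)" unfolding fspan_pair_iff by blast
  \<comment> \<open>\<open>r\<close> lies in the span of \<open>\<psi> 1\<close>,
    \<open>\<psi> 2\<close> and is orthogonal to both, so it vanishes and \<open>f'\<close> is a
    combination of the projected \<open>\<phi> 5\<close>, \<open>\<phi> 6\<close>.\<close>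
  have "l2ip r (\<psi> l) = 0" if l: "l \<in> {1, 2}" for l
  proof -
    have c: "\<psi> l \<in> cell" by (rule psi_12_cell[OF l])
    have "l2ip f (\<psi> l) = 0" using f psi_56(4)[of _ l] l by auto
    moreover have "l2ip (\<phi> 5) (\<psi> l) = 0" "l2ip (\<phi> 6) (\<psi> l) = 0"
      using psi_12_inner_phi[OF l, of 5] psi_12_inner_phi[OF l, of 6]
      by (simp_all add: l2_inner_commute[of _ "\<psi> l"])
    ultimately show ?thesis
      by (simp add: r_inner cell_square_integrable[OF c] f'_def P_cell_eq[OF two(1)[OF f2] c]
        P_cell_eq[OF two(1)[OF p5] c] P_cell_eq[OF two(1)[OF p6] c])
  qed
  moreover have "l2ip r (\<psi> 1) = a" "l2ip r (\<psi> 2) = b'"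
    unfolding ab using psi_12_space(2-4) psi_square_integrable[of 1] psi_square_integrable[of 2]
    by (simp_all add: l2_inner_add_left square_integrable_cmult l2_inner_cmult_left l2_inner_commute[of _ "\<psi> 2" "\<psi> 1"])
  ultimately have "a = 0" "b' = 0" by auto
  hence "f' = (\<lambda>t. x * P (\<phi> 5) t + y * P (\<phi> 6) t)"
    using ab unfolding r_def by (simp add: fun_eq_iff)
  hence f': "l2ip f' g' = x * l2ip (P (\<phi> 5)) g' + y * l2ip (P (\<phi> 6)) g'"
    using sP by (simp add: l2_inner_add_left square_integrable_cmult l2_inner_cmult_left g'_def)
  have "l2ip (P (\<phi> m)) g' = 0" if m: "m \<in> {5, 6}" for m
  proof -
    have m2: "\<phi> m \<in> two_cells" using m p5 p6 by auto
    have "l2ip (P (\<phi> m)) g' = l2ip (\<phi> m) g'"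
      unfolding g'_def by (rule P_cell_eq[OF two(1)[OF m2] P_cell])
    also have "\<dots> = l2ip (dilate 0 1 g) (\<phi> m)"
      using P_two(2)[OF m2 g2] by (simp add: g'_def l2_inner_commute)
    also have "\<dots> = 0" using g_phi[of m "-1"] m by (auto simp: l2_inner_unshift[of g "-1"])
    finally show ?thesis .
  qed
  thus ?thesis unfolding fg f' by simp
qed

text \<open>Pairs with \<open>\<psi> 3\<close> or \<open>\<psi> 4\<close> reduce to
  \<open>h_fun\<close>; for \<open>\<psi> 5\<close>, \<open>\<psi> 6\<close> the construction
  prescribes all overlapping shifts of \<open>\<psi> 1\<close>, \<open>\<psi> 2\<close>. The one
  relation that is not prescribed is \<open>psi_56_inner_shift\<close>.\<close>

lemma psi_inner:
  assumes "l \<in> {1..6}" "m \<in> {1..6}"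
  shows "l2ip (\<psi> l) (dilate 0 k (\<psi> m)) = (if l = m \<and> k = 0 then 1 else 0)"
proof -
  have rev: "l2ip f (dilate 0 k g) = l2ip g (dilate 0 (- k) f)" for f g k
    using l2_inner_unshift[of f k g] by (simp add: l2_inner_commute)
  have disj: "l2ip f (dilate 0 k g) = 0"
    if "supp_in (of_int a) 1 f" "supp_in (of_int a') 1 g" "1 \<le> a' + k \<or> 1 + k \<le> a" for f g a a' k
  proof (rule l2_inner_disjoint[OF that(1) supp_in_dilate[OF that(2)]])
    have "1 \<le> real_of_int (a' + k) \<or> real_of_int (1 + k) \<le> of_int a" using that(3) by linarith
    thus "1 \<le> (real_of_int a' + real_of_int k) / 2 ^ 0 \<or> (1 + real_of_int k) / 2 ^ 0 \<le> of_int a" by simp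
  qed
  have s12: "supp_in (of_int 0) 1 (\<psi> l)" if "l \<in> {1, 2}" for l
    using cell_supp_in[OF psi_12_cell[OF that]] by simp
  have s56: "supp_in (of_int (-1)) 1 (\<psi> l)" if "l \<in> {1..6}" for l
    using two_cells_supp_in[OF psi_two_cells[OF that]] by simp
  have sq: "sqint (dilate 0 k (\<psi> l))" if "l \<in> {1..6}" for l k
    by (intro square_integrable_dilate psi_square_integrable that)
  have orth: "l2ip (dilate 0 k (\<psi> l)) (\<phi> m) = 0" if "l \<in> {1..6}" "m \<in> {5, 6}" for k l m
    using psi_inner_phi[of l m "- k"] that by (auto simp: l2_inner_unshift)
  have c12_12: "l2ip (\<psi> l) (dilate 0 k (\<psi> m)) = (if l = m \<and> k = 0 then 1 else 0)" if "l \<in> {1, 2}" "m \<in> {1, 2}" for k l m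
  proof (cases "k = 0")
    case True
    thus ?thesis using that psi_12_space(2-4) by (auto simp: l2_inner_commute[of _ "\<psi> 2" "\<psi> 1"])
  next
    case False
    hence "1 \<le> 0 + k \<or> 1 + k \<le> 0" by linarith
    thus ?thesis using disj[OF s12[OF that(1)] s12[OF that(2)], of k] False by auto
  qed
  have c34_12: "l2ip (\<psi> l) (dilate 0 k (\<psi> m)) = 0" if "l \<in> {3, 4}" "m \<in> {1, 2}" for k l m
    using that by (intro psi_34_orthogonal sq h_fun_inner_cell psi_12_cell orth) auto
  have c56_12: "l2ip (\<psi> l) (dilate 0 k (\<psi> m)) = 0" if "l \<in> {5, 6}" "m \<in> {1, 2}" for k l m
  proof -
    have l: "l \<in> {1..6}" using that by auto
    consider "k = 0" | "k = -1" | "1 \<le> 0 + k \<or> 1 + k \<le> -1" by linarith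
    thus ?thesis using psi_56(3,4)[OF that(1), of m] that disj[OF s56[OF l] s12[OF that(2)], of k] by cases auto
  qed
  have c34_k: "l2ip (\<psi> l) (dilate 0 k (\<psi> m)) = 0" if "l \<in> {3, 4}" "m \<in> {3..6}" "k \<noteq> 0" for k l m
    using that by (intro psi_34_orthogonal sq h_fun_inner_shift psi_two_cells orth) auto
  have c34_34: "l2ip (\<psi> l) (\<psi> m) = (if l = m then 1 else 0)" if "l \<in> {3, 4}" "m \<in> {3, 4}" for l m
    using that psi_34_inner by (auto simp: l2_inner_commute[of _ "\<psi> 4" "\<psi> 3"])
  have c56_34: "l2ip (\<psi> l) (dilate 0 k (\<psi> m)) = 0" if "l \<in> {5, 6}" "m \<in> {3, 4}" for k l m
  proof (cases "k = 0")
    case True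
    thus ?thesis using psi_56(4)[OF that(1), of m] that by auto
  next
    case False
    thus ?thesis unfolding rev[of "\<psi> l"] using that by (intro c34_k) auto
  qed
  have c56_56: "l2ip (\<psi> l) (dilate 0 k (\<psi> m)) = (if l = m \<and> k = 0 then 1 else 0)" if "l \<in> {5, 6}" "m \<in> {5, 6}" for k l m
  proof -
    have lm: "l \<in> {1..6}" "m \<in> {1..6}" using that by auto
    consider "k = 0" | "k = 1" | "k = -1" | "1 \<le> -1 + k \<or> 1 + k \<le> -1" by linarith
    thus ?thesis
    proof cases
      case 1
      thus ?thesis using that psi_56_space(2-4) by (auto simp: l2_inner_commute[of _ "\<psi> 6" "\<psi> 5"])
    next
      case 2
      thus ?thesis using that psi_56_inner_shift[of "\<psi> l" "\<psi> m"] by auto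
    next
      case 3
      thus ?thesis using that psi_56_inner_shift[of "\<psi> m" "\<psi> l"] rev[of "\<psi> l" k "\<psi> m"] by auto
    next
      case 4
      thus ?thesis using disj[OF s56[OF lm(1)] s56[OF lm(2)], of k] by auto
    qed
  qed
  have "l \<in> {1, 2} \<or> l \<in> {3, 4} \<or> l \<in> {5, 6}" "m \<in> {1, 2} \<or> m \<in> {3, 4} \<or> m \<in> {5, 6}" using assms by auto
  thus ?thesis
  proof (elim disjE)
    show ?thesis if "l \<in> {3, 4}" "m \<in> {3, 4}"
      using that c34_34[OF that] c34_k[of l m k] by (cases "k = 0") auto
  qed (use c12_12[of l m k] c34_12[of l m k] c56_12[of l m k] c56_34[of l m k] c56_56[of l m k]
      c34_12[of m l "- k"] c56_12[of m l "- k"] c56_34[of m l "- k"] rev[of "\<psi> l" k "\<psi> m"] in auto)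
qed

section \<open>Dilated wavelets and vanishing moments\<close>

lemma psiR_eq: "l \<in> {1..6} \<Longrightarrow> psiR \<psi> j (6 * k + int l) = dilate j (if l \<le> 2 then k else k + 1) (\<psi> l)"
proof -
  assume l: "l \<in> {1..6}"
  have "(6 * k + int l - 1) div 6 = k" "(6 * k + int l - 1) mod 6 = int l - 1"
    using l by (auto simp: div_pos_pos_trivial mod_pos_pos_trivial intro: int_div_pos_eq[where r = "int l - 1"] int_mod_pos_eq[where q = k])
  thus ?thesis using l by (auto simp: psiR_def Let_def nat_diff_distrib)
qed

lemma psiR_inner: "l2ip (psiR \<psi> j m) (psiR \<psi> j n) = (if m = n then 1 else 0)"
  by (rule indexed6_inner[where f = \<psi> and c = 2]) (auto simp: psi_inner psiR_eq)

lemma psiR_square_integrable: "sqint (psiR \<psi> j n)"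
  by (rule index6_cases[of n]) (auto simp: psiR_eq intro!: square_integrable_dilate psi_square_integrable)

lemma psi_in_level_1: "l \<in> {1..6} \<Longrightarrow> \<psi> l \<in> fspan (range (phiR \<phi> 1))"
  by (drule psi_two_cells) (auto simp: two_cells_def elim!: fspan_mono[rotated])

lemma dilate_psi_in_fspan: "l \<in> {1..6} \<Longrightarrow> dilate j k (\<psi> l) \<in> fspan (range (phiR \<phi> (Suc j)))"
  by (rule fspan_mono[OF _ fspan_dilate[OF psi_in_level_1]]) (auto simp: dilate_phiR Suc_eq_plus1 add.commute)

lemma dilate_psi_orthogonal:
  assumes "l \<in> {1..6}" "f \<in> fspan (range (phiR \<phi> j))"
  shows "l2ip (dilate j k (\<psi> l)) f = 0"
proof -
  have "l2ip s (dilate j k (\<psi> l)) = 0" if s: "s \<in> range (phiR \<phi> j)" for s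
  proof -
    obtain n where "s = phiR \<phi> j n" using s by blast
    moreover obtain k' m where "m \<in> {1..6}" "n = 6 * k' + int m" by (rule index6_cases)
    ultimately have m: "m \<in> {1..6}" "s = phiR \<phi> j (6 * k' + int m)" by simp_all
    let ?c = "if m \<le> 4 then k' else k' + 1"
    have "l2ip (dilate j k (\<psi> l)) s = l2ip (dilate j 0 (dilate 0 k (\<psi> l))) (dilate j 0 (dilate 0 ?c (\<phi> m)))"
      unfolding m(2) phiR_eq[OF m(1)] by (simp add: dilate_dilate)
    also have "\<dots> = 0" unfolding l2_inner_dilate l2_inner_shift by (rule psi_inner_phi[OF assms(1) m(1)])
    finally show ?thesis by (simp add: l2_inner_commute)
  qed
  hence "l2ip f (dilate j k (\<psi> l)) = 0"
    by (intro fspan_orthogonal[OF assms(2)] square_integrable_dilate psi_square_integrable assms)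
      (auto simp: phiR_square_integrable)
  thus ?thesis by (simp add: l2_inner_commute)
qed

lemma xi_1_in_fspan: "\<xi> (Suc j) n \<in> fspan (range (phiR \<phi> j))"
  using xi_in_fspan_phiR[of j n] by (rule fspan_mono[rotated]) auto

lemma psi_vanishing_moments:
  assumes l: "l \<in> {1..6}" and p: "degree p \<le> 3"
  shows "l2ip (poly p) (\<psi> l) = 0"
proof -
  \<comment> \<open>Rescaling turns the knots of \<open>\<xi> 1\<close> into integers. On the
    support of \<open>\<psi> l\<close> the polynomial then equals \<open>r\<close>, a combination of
    Hermite functions that belong to the level-\<open>0\<close> scaling space.\<close>
  define q where "q = pcompose p [:0, 1/2:]"
  have dq: "degree q \<le> 3" using p by (simp add: q_def degree_pcompose)
  define r where "r = (\<lambda>x. \<Sum>k\<in>{-2..2::int}. (poly q (of_int k) / 2 powr (1/2)) * \<xi> 1 (2 * k) x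
      + (poly (pderiv q) (of_int k) / 2 powr (1/2)) * \<xi> 1 (2 * k + 1) x)"
  have "poly p x * \<psi> l x = r x * \<psi> l x" for x
  proof (cases "-1 < x \<and> x < 1")
    case True
    have "poly p x = poly q (2 * x)" by (simp add: q_def poly_pcompose)
    also have "\<dots> = r x"
      using True by (subst hermite_reproduces_cubic[OF dq]) (auto simp: r_def xi_even xi_odd dilate_def)
    finally show ?thesis by simp
  next
    case False
    thus ?thesis using two_cells_supp_in[OF psi_two_cells[OF l]] by (auto simp: supp_in_def)
  qed
  hence "l2ip (poly p) (\<psi> l) = l2ip r (\<psi> l)" by (rule l2_inner_cong)
  also have "\<dots> = l2ip (dilate 0 0 (\<psi> l)) r" by (simp add: l2_inner_commute)
  also have "\<dots> = 0"
    unfolding r_def using xi_1_in_fspan[of 0, folded One_nat_def]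
    by (intro dilate_psi_orthogonal l fspan_sum fspan_add fspan_cmult) simp_all
  finally show ?thesis .
qed

lemma dilate_psi_vanishing_moments:
  assumes l: "l \<in> {1..6}" and p: "degree p \<le> 3"
  shows "l2ip (poly p) (dilate j k (\<psi> l)) = 0"
proof -
  define q where "q = smult (1 / 2 powr (real j / 2)) (pcompose p [:of_int k / 2 ^ j, 1 / 2 ^ j:])"
  have "degree q \<le> 3" using p by (simp add: q_def degree_pcompose)
  moreover have "poly p = dilate j k (poly q)"
    by (simp add: fun_eq_iff dilate_def q_def poly_pcompose field_simps flip: add_divide_distrib)
  ultimately show ?thesis using psi_vanishing_moments[OF l] by (simp add: l2_inner_dilate)
qed

end

section \<open>Restriction to the unit interval\<close>

lemma cut_lincomb: "cut (\<lambda>x. c * f x + g x) = (\<lambda>x. c * cut f x + cut g x)"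
  by (simp add: cut_def algebra_simps)

lemma cut_sum: "cut (\<lambda>x. \<Sum>i\<in>A. c i * f i x) = (\<lambda>x. \<Sum>i\<in>A. c i * cut (f i) x)"
  by (simp add: cut_def sum_distrib_right mult.assoc)

lemma cut_id: "supp_in 0 1 f \<Longrightarrow> cut f = f"
  unfolding supp_in_def cut_def fun_eq_iff by (force simp: indicator_def)

lemma supp_in_cut: "f 0 = 0 \<Longrightarrow> f 1 = 0 \<Longrightarrow> supp_in 0 1 (cut f)"
  unfolding supp_in_def cut_def by (auto simp: indicator_def less_le split: if_splits)

text \<open>The left side keeps \<open>[0, 1 / 2 ^ j]\<close>, the right side \<open>[0, 1]\<close>;
  the dilated function is zero in between because \<open>f\<close> vanishes beyond
  \<open>1\<close>.\<close>

lemma cut_dilate_left: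
  assumes "supp_in a 1 f"
  shows "dilate j 0 (cut f) = cut (dilate j 0 f)"
proof
  fix x :: real
  have "(0 \<le> x \<and> x \<le> 1) \<or> f (2 ^ j * x) = 0" if "0 \<le> 2 ^ j * x \<and> 2 ^ j * x \<le> 1"
  proof -
    have "0 \<le> x" by (rule ccontr) (use that mult_pos_neg[of "2 ^ j" x] in auto)
    moreover have "1 * x \<le> 2 ^ j * x" using \<open>0 \<le> x\<close> by (intro mult_right_mono) auto
    ultimately show ?thesis using that by linarith
  qed
  moreover have "(0 \<le> 2 ^ j * x \<and> 2 ^ j * x \<le> 1) \<or> f (2 ^ j * x) = 0" if "0 \<le> x" "x \<le> 1"
    using assms that unfolding supp_in_def by force
  ultimately show "dilate j 0 (cut f) x = cut (dilate j 0 f) x"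
    by (auto simp: dilate_def cut_def indicator_def)
qed

text \<open>The mirror image at the right end: \<open>dilate 0 1\<close> moves the left half of
  \<open>f\<close> into \<open>[0, 1]\<close>, and the shift \<open>2 ^ j - 1\<close> places that
  interval on the last cell of level \<open>j\<close>.\<close>

lemma cut_dilate_right:
  assumes "supp_in (-1) b f"
  shows "dilate j (2 ^ j - 1) (cut (dilate 0 1 f)) = cut (dilate j (2 ^ j) f)"
proof
  fix x :: real
  let ?y = "2 ^ j * x - (2 ^ j - 1)"
  have "0 \<le> x \<and> x \<le> 1" if "0 \<le> ?y \<and> ?y \<le> 1"
  proof -
    have "0 \<le> 2 ^ j * x" using that one_le_power[of "2::real" j, OF one_le_numeral] by linarith
    moreover have "2 ^ j * x \<le> 2 ^ j * 1" using that by linarith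
    moreover have "0 \<le> x" by (rule ccontr) (use calculation mult_pos_neg[of "2 ^ j" x] in auto)
    ultimately show ?thesis by simp
  qed
  moreover have "(0 \<le> ?y \<and> ?y \<le> 1) \<or> f (?y - 1) = 0" if "x \<le> 1"
  proof -
    have "2 ^ j * x \<le> 2 ^ j * 1" using that by (intro mult_left_mono) auto
    thus ?thesis using assms unfolding supp_in_def by force
  qed
  moreover have "?y - 1 = 2 ^ j * x - 2 ^ j" by simp
  ultimately show "dilate j (2 ^ j - 1) (cut (dilate 0 1 f)) x = cut (dilate j (2 ^ j) f) x"
    by (auto simp: dilate_def cut_def indicator_def)
qed

text \<open>Only the product has to live in \<open>[0, 1]\<close>, so the left and the right bound
  may come from different factors. A boundary function can thus be cut freely against anything that
  stays away from the cut.\<close>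

lemma l2_inner_cut:
  assumes "supp_in a b f" "supp_in c d g" "0 \<le> a \<or> 0 \<le> c" "b \<le> 1 \<or> d \<le> 1"
  shows "l2ip (cut f) (cut g) = l2ip f g"
proof (rule l2_inner_cong)
  fix x
  have "0 \<le> x \<and> x \<le> 1" if "f x * g x \<noteq> 0"
  proof -
    have "a < x \<and> x < b" "c < x \<and> x < d" using assms(1,2) that by (auto simp: supp_in_def)
    thus ?thesis using assms(3,4) by linarith
  qed
  thus "cut f x * cut g x = f x * g x" by (auto simp: cut_def indicator_def)
qed

locale spline_interval = spline_wavelets +
  fixes \<psi>L \<psi>R :: "nat \<Rightarrow> real \<Rightarrow> real"
  assumes boundary: "boundary_generators \<phi> \<psi> \<psi>L \<psi>R"
begin

definition u :: "real \<Rightarrow> real" where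
  "u = (\<lambda>x. \<phi> 6 0 * \<phi> 5 x - \<phi> 5 0 * \<phi> 6 x)"

text \<open>The halves of \<open>u\<close> on the two sides of the origin may have different norms,
  hence separate normalizations for the two ends of the interval. The cut is postponed, so that
  \<open>uL\<close> and \<open>uR\<close> remain functions on the line.\<close>

definition uL :: "real \<Rightarrow> real" where
  "uL = (\<lambda>x. (1 / l2_norm lborel (cut u)) * u x)"

definition uR :: "real \<Rightarrow> real" where
  "uR = (\<lambda>x. (1 / l2_norm lborel (cut (dilate 0 1 u))) * u x)"

lemma u_in_fspan: "u \<in> fspan {\<phi> 5, \<phi> 6}"
  unfolding u_def by (intro fspan_diff fspan_cmult fspan_base) auto

lemma u_C1_spline: "C1_spline 2 u"
  using u_in_fspan by (rule fspan_C1_spline) (auto intro: phi_C1_spline)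

lemma u_supp_in: "supp_in (-1) 1 u"
  using u_in_fspan by (rule fspan_supp_in) (auto intro: phi_56_supp_in)

lemma u_0: "u 0 = 0"
  by (simp add: u_def)

lemma phiL_eq: "phiL \<phi> = cut uL"
  by (simp add: phiL_def l2_normalize_def uL_def u_def cut_def fun_eq_iff)

lemma phiRt_eq: "phiRt \<phi> = cut (dilate 0 1 uR)"
  by (simp add: phiRt_def l2_normalize_def uR_def u_def cut_def dilate_0 fun_eq_iff)

text \<open>The slope of \<open>u\<close> at the origin is \<open>- \<phi> 5 0\<close> times that of
  \<open>\<phi> 6\<close>, which is nonzero; a function vanishing on one side would have slope
  \<open>0\<close>. Hence both halves of \<open>u\<close> can be normalized.\<close>

lemma u_not_one_sided: "\<not> supp_in (-1) 0 u" "\<not> supp_in 0 1 u"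
proof -
  obtain D where D: "(\<phi> 6 has_real_derivative D) (at 0)" "D \<noteq> 0" by (rule phi_6_derivative_0)
  have "(u has_real_derivative \<phi> 6 0 * 0 - \<phi> 5 0 * D) (at 0)"
    unfolding u_def by (intro DERIV_diff DERIV_cmult phi_5_derivative_0 D)
  moreover have "\<phi> 6 0 * 0 - \<phi> 5 0 * D \<noteq> 0" using D phi_5_0 by simp
  ultimately show "\<not> supp_in (-1) 0 u" "\<not> supp_in 0 1 u"
    using supp_in_derivative_zero[of "-1" 0 u _ 0] supp_in_derivative_zero[of 0 1 u _ 0] by blast+
qed

lemma cut_u_nonzero: "l2ip (cut u) (cut u) \<noteq> 0" "l2ip (cut (dilate 0 1 u)) (cut (dilate 0 1 u)) \<noteq> 0"
proof -
  have z: "f x = 0" if "l2ip (cut f) (cut f) = 0" "C1_spline 2 f" "sqint f" "0 < x" "x < 1" for f x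
  proof -
    have "continuous_on {0<..<1} (cut f) \<longleftrightarrow> continuous_on {0<..<1} f"
      by (intro continuous_on_cong) (auto simp: cut_def)
    hence "cut f x = 0"
      using l2_inner_null_continuous[OF square_integrable_cut[OF that(3)] that(1), of "{0<..<1}"]
        C1_spline_continuous[OF that(2)] that by auto
    thus ?thesis using that by (simp add: cut_def)
  qed
  have s: "C1_spline 2 u" "sqint u" "C1_spline 2 (dilate 0 1 u)" "sqint (dilate 0 1 u)"
    using u_C1_spline C1_spline_square_integrable[OF u_C1_spline u_supp_in] C1_spline_dilate[OF u_C1_spline, of 0 1]
    by (auto intro: square_integrable_dilate)
  show "l2ip (cut u) (cut u) \<noteq> 0"
  proof
    assume 0: "l2ip (cut u) (cut u) = 0"
    have "supp_in (-1) 0 u" unfolding supp_in_def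
    proof (intro allI impI)
      fix x assume x: "u x \<noteq> 0"
      hence "-1 < x \<and> x < 1" using u_supp_in by (auto simp: supp_in_def)
      moreover have "\<not> 0 < x \<or> \<not> x < 1" using z[OF 0 s(1,2), of x] x by auto
      ultimately show "-1 < x \<and> x < 0" using x u_0 by (cases "x = 0") auto
    qed
    thus False using u_not_one_sided by blast
  qed
  show "l2ip (cut (dilate 0 1 u)) (cut (dilate 0 1 u)) \<noteq> 0"
  proof
    assume 0: "l2ip (cut (dilate 0 1 u)) (cut (dilate 0 1 u)) = 0"
    have "supp_in 0 1 u" unfolding supp_in_def
    proof (intro allI impI)
      fix x assume x: "u x \<noteq> 0"
      hence "-1 < x \<and> x < 1" using u_supp_in by (auto simp: supp_in_def)
      moreover have "\<not> 0 < x + 1 \<or> \<not> x + 1 < 1" using z[OF 0 s(3,4), of "x + 1"] x by (auto simp: dilate_0)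
      ultimately show "0 < x \<and> x < 1" using x u_0 by (cases "x = 0") auto
    qed
    thus False using u_not_one_sided by blast
  qed
qed

lemma phiL_norm: "l2ip (phiL \<phi>) (phiL \<phi>) = 1" "l2ip (phiRt \<phi>) (phiRt \<phi>) = 1"
proof -
  have "cut (\<lambda>x. \<phi> 6 0 * \<phi> 5 (x - 1) - \<phi> 5 0 * \<phi> 6 (x - 1)) = cut (dilate 0 1 u)"
    by (simp add: u_def dilate_0)
  thus "l2ip (phiL \<phi>) (phiL \<phi>) = 1" "l2ip (phiRt \<phi>) (phiRt \<phi>) = 1"
    unfolding phiL_def phiRt_def u_def[symmetric] by (auto intro!: l2_inner_normalize_self cut_u_nonzero)
qed

lemma uL_uR: "f \<in> {uL, uR} \<Longrightarrow> f \<in> fspan {\<phi> 5, \<phi> 6} \<and> supp_in (-1) 1 f \<and> f 0 = 0"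
proof -
  have "f \<in> fspan {\<phi> 5, \<phi> 6} \<and> supp_in (-1) 1 f \<and> f 0 = 0" if "f = (\<lambda>x. c * u x)" for c f
    using fspan_cmult[OF u_in_fspan, of c] supp_in_lincomb[OF u_supp_in supp_in_zero, of c] u_0 that by simp
  thus "f \<in> {uL, uR} \<Longrightarrow> f \<in> fspan {\<phi> 5, \<phi> 6} \<and> supp_in (-1) 1 f \<and> f 0 = 0"
    unfolding uL_def uR_def by blast
qed

text \<open>Each endpoint is straddled by a pair \<open>\<phi> 5\<close>, \<open>\<phi> 6\<close>,
  of which one combination vanishes at the endpoint. With the functions of indices \<open>1\<close>
  to \<open>6 * 2 ^ j - 2\<close> in the interior this makes \<open>6 * 2 ^ j\<close> in
  all.\<close>

definition phiI :: "nat \<Rightarrow> int \<Rightarrow> real \<Rightarrow> real" where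
  "phiI j n = (if n = 1 then cut (dilate j 0 uL) else if n = 6 * 2 ^ j then cut (dilate j (2 ^ j) uR)
     else phiR \<phi> j (n - 1))"

lemma dilate_phi_56:
  assumes "f \<in> fspan {\<phi> 5, \<phi> 6}"
  shows "dilate j k f \<in> fspan (phiR \<phi> j ` {6 * k - 1..6 * k})"
  using fspan_dilate[OF assms, of j k]
proof (rule fspan_mono[rotated])
  have "dilate j k (\<phi> 5) = phiR \<phi> j (6 * k - 1)" "dilate j k (\<phi> 6) = phiR \<phi> j (6 * k)"
    using phiR_eq[of 5 j "k - 1"] phiR_eq[of 6 j "k - 1"] by simp_all
  thus "dilate j k ` {\<phi> 5, \<phi> 6} \<subseteq> phiR \<phi> j ` {6 * k - 1..6 * k}" by auto
qed

lemma supp_in_dilate_1: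
  "supp_in (-1) 1 f \<Longrightarrow> supp_in ((-1 + of_int k) / 2 ^ j) ((1 + of_int k) / 2 ^ j) (dilate j k f)"
  by (rule supp_in_dilate)

lemma supp_in_left: "supp_in (-1) 1 f \<Longrightarrow> supp_in (- 1 / 2 ^ j) (1 / 2 ^ j) (dilate j 0 f)"
  using supp_in_dilate_1[of f 0 j] by simp

lemma supp_in_right: "supp_in (-1) 1 f \<Longrightarrow> supp_in (1 - 1 / 2 ^ j) (1 + 1 / 2 ^ j) (dilate j (2 ^ j) f)"
  using supp_in_dilate_1[of f "2 ^ j" j] by (simp add: field_simps)

lemma dilate_endpoints:
  assumes "supp_in (-1) 1 f" "f 0 = 0"
  shows "dilate j 0 f 0 = 0" "dilate j 0 f 1 = 0" "dilate j (2 ^ j) f 0 = 0" "dilate j (2 ^ j) f 1 = 0"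
proof -
  have z: "f (2 ^ j) = 0" "f (- (2 ^ j)) = 0"
    using one_le_power[of "2::real" j, OF one_le_numeral] by (auto intro: supp_in_outside[OF assms(1)])
  show "dilate j 0 f 0 = 0" "dilate j 0 f 1 = 0" "dilate j (2 ^ j) f 0 = 0" "dilate j (2 ^ j) f 1 = 0"
    using assms(2) z by (simp_all add: dilate_def)
qed

lemma l2_inner_cut_left_inner:
  assumes "supp_in (-1) 1 f" "supp_in 0 1 g"
  shows "l2ip (cut (dilate j 0 f)) g = l2ip (dilate j 0 f) g"
  using l2_inner_cut[OF supp_in_left[OF assms(1), of j] assms(2)] cut_id[OF assms(2)] by simp

lemma l2_inner_cut_right_inner:
  assumes "supp_in (-1) 1 f" "supp_in 0 1 g"
  shows "l2ip (cut (dilate j (2 ^ j) f)) g = l2ip (dilate j (2 ^ j) f) g"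
  using l2_inner_cut[OF supp_in_right[OF assms(1), of j] assms(2)] cut_id[OF assms(2)] by simp

lemma l2_inner_cut_left_right:
  assumes "supp_in (-1) 1 f" "supp_in (-1) 1 g"
  shows "l2ip (cut (dilate j 0 f)) (cut (dilate j (2 ^ j) g)) = l2ip (dilate j 0 f) (dilate j (2 ^ j) g)"
  using one_le_power[of "2::real" j, OF one_le_numeral]
  by (intro l2_inner_cut[OF supp_in_left[OF assms(1)] supp_in_right[OF assms(2)]]) auto

lemma phiR_supp_in_01: "1 \<le> n \<Longrightarrow> n \<le> 6 * 2 ^ j - 2 \<Longrightarrow> supp_in 0 1 (phiR \<phi> j n)"
  using phiR_supp_in[of 0 n "2 ^ j" j] by simp

lemma phiI_inner:
  assumes "m \<in> {1..6 * 2 ^ j}" "n \<in> {1..6 * 2 ^ j}"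
  shows "l2ip (phiI j m) (phiI j n) = (if m = n then 1 else 0)"
proof -
  have N: "(1::int) < 6 * 2 ^ j" using one_le_power[of "2::int" j, OF one_le_numeral] by linarith
  have uL: "uL \<in> fspan {\<phi> 5, \<phi> 6}" "supp_in (-1) 1 uL" and uR: "uR \<in> fspan {\<phi> 5, \<phi> 6}" "supp_in (-1) 1 uR"
    using uL_uR by auto
  have s: "phiR \<phi> j n \<in> fspan (phiR \<phi> j ` {1..6 * 2 ^ j - 2})" "supp_in 0 1 (phiR \<phi> j n)"
    if "n \<in> {1..6 * 2 ^ j - 2}" for n
    using that by (auto intro: fspan_base phiR_supp_in_01)
  have LL: "l2ip (cut (dilate j 0 uL)) (cut (dilate j 0 uL)) = 1"
    using phiL_norm(1) unfolding phiL_eq cut_dilate_left[OF uL(2), symmetric] l2_inner_dilate .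
  have RR: "l2ip (cut (dilate j (2 ^ j) uR)) (cut (dilate j (2 ^ j) uR)) = 1"
    using phiL_norm(2) unfolding phiRt_eq cut_dilate_right[OF uR(2), symmetric] l2_inner_dilate .
  have LR: "l2ip (cut (dilate j 0 uL)) (cut (dilate j (2 ^ j) uR)) = 0"
    unfolding l2_inner_cut_left_right[OF uL(2) uR(2)]
    by (rule fspan_phiR_orthogonal[OF dilate_phi_56[OF uL(1)] dilate_phi_56[OF uR(1)]]) (use N in auto)
  have LI: "l2ip (cut (dilate j 0 uL)) (phiR \<phi> j n) = 0" if n: "n \<in> {1..6 * 2 ^ j - 2}" for n
    unfolding l2_inner_cut_left_inner[OF uL(2) s(2)[OF n]]
    by (rule fspan_phiR_orthogonal[OF dilate_phi_56[OF uL(1)] s(1)[OF n]]) auto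
  have RI: "l2ip (cut (dilate j (2 ^ j) uR)) (phiR \<phi> j n) = 0" if n: "n \<in> {1..6 * 2 ^ j - 2}" for n
    unfolding l2_inner_cut_right_inner[OF uR(2) s(2)[OF n]]
    by (rule fspan_phiR_orthogonal[OF dilate_phi_56[OF uR(1)] s(1)[OF n]]) auto
  have c: "k = 1 \<or> k = 6 * 2 ^ j \<or> (k \<noteq> 1 \<and> k \<noteq> 6 * 2 ^ j \<and> k - 1 \<in> {1..6 * 2 ^ j - 2})" if "k \<in> {1..6 * 2 ^ j}" for k :: int
    using that by auto
  have RL: "l2ip (cut (dilate j (2 ^ j) uR)) (cut (dilate j 0 uL)) = 0"
    by (subst l2_inner_commute) (rule LR)
  have I: "l2ip (phiR \<phi> j n) (cut (dilate j 0 uL)) = 0" "l2ip (phiR \<phi> j n) (cut (dilate j (2 ^ j) uR)) = 0"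
    if n: "n \<in> {1..6 * 2 ^ j - 2}" for n
    by (subst l2_inner_commute, rule LI[OF n], subst l2_inner_commute, rule RI[OF n])
  show ?thesis
    using c[OF assms(1)] c[OF assms(2)] N
    by (elim disjE) (simp_all add: phiI_def LL RR LR RL LI RI I phiR_inner)
qed

section \<open>Spline spaces on \<open>[0, 1]\<close> with zero boundary values\<close>

definition Vint :: "nat \<Rightarrow> (real \<Rightarrow> real) set" where
  "Vint j = {cut f |f. f \<in> fspan (range (phiR \<phi> j)) \<and> f 0 = 0 \<and> f 1 = 0}"

lemma VintI: "f \<in> fspan (range (phiR \<phi> j)) \<Longrightarrow> f 0 = 0 \<Longrightarrow> f 1 = 0 \<Longrightarrow> cut f \<in> Vint j"
  by (auto simp: Vint_def)

lemma Vint_Suc: "f \<in> Vint j \<Longrightarrow> f \<in> Vint (Suc j)"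
  unfolding Vint_def using phiR_refine by (auto elim!: fspan_trans)

lemma Vint_mono: "f \<in> Vint i \<Longrightarrow> i \<le> j \<Longrightarrow> f \<in> Vint j"
  by (induction j) (auto simp: le_Suc_eq intro: Vint_Suc)

lemma Vint_supp_in: "f \<in> Vint j \<Longrightarrow> supp_in 0 1 f"
  by (auto simp: Vint_def intro: supp_in_cut)

lemma Vint_square_integrable: "f \<in> Vint j \<Longrightarrow> sqint f"
  unfolding Vint_def by (auto intro!: square_integrable_cut elim!: fspan_square_integrable simp: phiR_square_integrable)

lemma Vint_C1_spline:
  assumes "f \<in> Vint j"
  obtains g where "C1_spline (2 + j) g" "\<And>x. 0 \<le> x \<Longrightarrow> x \<le> 1 \<Longrightarrow> f x = g x"
proof -
  from assms obtain g where g: "g \<in> fspan (range (phiR \<phi> j))" "f = cut g" by (auto simp: Vint_def)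
  have "C1_spline (2 + j) g" using g(1) by (rule fspan_C1_spline) (use phiR_C1_spline in blast)
  thus ?thesis using that g(2) by (auto simp: cut_def)
qed

lemma cut_phiR_outside:
  assumes "n \<le> -2 \<or> n \<ge> 6 * 2 ^ j + 1"
  shows "cut (phiR \<phi> j n) = (\<lambda>x. 0)" "phiR \<phi> j n 0 = 0" "phiR \<phi> j n 1 = 0"
proof -
  have "supp_in (of_int (n div 6 - 1) / 2 ^ j) 0 (phiR \<phi> j n) \<or> supp_in 1 (of_int (n div 6 + 2) / 2 ^ j) (phiR \<phi> j n)"
    using assms phiR_supp_in[of "n div 6 - 1" n 0 j] phiR_supp_in[of "2 ^ j" n "n div 6 + 2" j]
    by (auto; presburger)
  then obtain a b where "supp_in a 0 (phiR \<phi> j n) \<or> supp_in 1 b (phiR \<phi> j n)" by blast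
  hence z: "phiR \<phi> j n x = 0" if "0 \<le> x" "x \<le> 1" for x using that unfolding supp_in_def by force
  show "cut (phiR \<phi> j n) = (\<lambda>x. 0)" "phiR \<phi> j n 0 = 0" "phiR \<phi> j n 1 = 0"
    using z by (auto simp: cut_def indicator_def fun_eq_iff)
qed

lemma phi_boundary_index:
  "phiR \<phi> j (-1) = dilate j 0 (\<phi> 5)" "phiR \<phi> j 0 = dilate j 0 (\<phi> 6)"
  "phiR \<phi> j (6 * 2 ^ j - 1) = dilate j (2 ^ j) (\<phi> 5)" "phiR \<phi> j (6 * 2 ^ j) = dilate j (2 ^ j) (\<phi> 6)"
  using phiR_eq[of 5 j "-1"] phiR_eq[of 6 j "-1"] phiR_eq[of 5 j "2 ^ j - 1"] phiR_eq[of 6 j "2 ^ j - 1"]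
  by simp_all

lemma phi_boundary_values:
  assumes "l \<in> {5, 6}"
  shows "dilate j 0 (\<phi> l) 0 = 2 powr (real j / 2) * \<phi> l 0" "dilate j 0 (\<phi> l) 1 = 0"
    "dilate j (2 ^ j) (\<phi> l) 0 = 0" "dilate j (2 ^ j) (\<phi> l) 1 = 2 powr (real j / 2) * \<phi> l 0"
proof -
  have z: "\<phi> l (2 ^ j) = 0" "\<phi> l (- (2 ^ j)) = 0"
    using one_le_power[of "2::real" j, OF one_le_numeral] by (auto intro: supp_in_outside[OF phi_56_supp_in[OF assms]])
  show "dilate j 0 (\<phi> l) 0 = 2 powr (real j / 2) * \<phi> l 0" "dilate j 0 (\<phi> l) 1 = 0"
    "dilate j (2 ^ j) (\<phi> l) 0 = 0" "dilate j (2 ^ j) (\<phi> l) 1 = 2 powr (real j / 2) * \<phi> l 0"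
    using z by (simp_all add: dilate_def)
qed

text \<open>The conditions \<open>f 0 = 0\<close> and \<open>f 1 = 0\<close> are not inherited by
  the generators of a span, so the induction runs over all \<open>f\<close>, and cut copies of
  \<open>\<phi> 5\<close> at the two ends carry the boundary values. The factor
  \<open>\<kappa>\<close> gives these copies the value \<open>1\<close> at their endpoint.\<close>

lemma cut_phiR_decomposition:
  assumes "f \<in> fspan (range (phiR \<phi> j))"
  defines "\<kappa> \<equiv> 1 / (2 powr (real j / 2) * \<phi> 5 0)"
  shows "(\<lambda>x. cut f x - (f 0 * \<kappa> * cut (dilate j 0 (\<phi> 5)) x + f 1 * \<kappa> * cut (dilate j (2 ^ j) (\<phi> 5)) x))
    \<in> fspan (phiI j ` {1..6 * 2 ^ j})"
proof -
  define L where "L = cut (dilate j 0 (\<phi> 5))"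
  define R where "R = cut (dilate j (2 ^ j) (\<phi> 5))"
  define S where "S = fspan (phiI j ` {1..6 * 2 ^ j})"
  have N: "(1::int) < 6 * 2 ^ j" using one_le_power[of "2::int" j, OF one_le_numeral] by linarith
  have \<kappa>: "2 powr (real j / 2) * \<phi> l 0 * \<kappa> = \<phi> l 0 / \<phi> 5 0" for l by (simp add: \<kappa>_def)
  have I: "phiI j n \<in> S" if "n \<in> {1..6 * 2 ^ j}" for n
    unfolding S_def using that by (intro fspan_base imageI)
  \<comment> \<open>By the definition of \<open>u\<close>, \<open>\<phi> 6\<close> differs from
    \<open>\<phi> 6 0 / \<phi> 5 0\<close> times \<open>\<phi> 5\<close> by a multiple of
    \<open>u\<close>, which after dilating and cutting is a multiple of
    \<open>phiI j 1\<close>.\<close>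
  have L6: "(\<lambda>x. cut (dilate j 0 (\<phi> 6)) x - \<phi> 6 0 / \<phi> 5 0 * L x) \<in> S"
  proof -
    have eq: "(\<lambda>x. cut (dilate j 0 (\<phi> 6)) x - \<phi> 6 0 / \<phi> 5 0 * L x) =
        (\<lambda>x. (- l2_norm lborel (cut u) / \<phi> 5 0) * phiI j 1 x)"
      using cut_u_nonzero(1) phi_5_0
      by (auto simp: phiI_def uL_def u_def L_def cut_def dilate_def fun_eq_iff field_simps l2_norm_def)
    show ?thesis unfolding eq S_def by (intro fspan_cmult fspan_base imageI) (use N in simp)
  qed
  have R6: "(\<lambda>x. cut (dilate j (2 ^ j) (\<phi> 6)) x - \<phi> 6 0 / \<phi> 5 0 * R x) \<in> S"
  proof -
    have eq: "(\<lambda>x. cut (dilate j (2 ^ j) (\<phi> 6)) x - \<phi> 6 0 / \<phi> 5 0 * R x) =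
        (\<lambda>x. (- l2_norm lborel (cut (dilate 0 1 u)) / \<phi> 5 0) * phiI j (6 * 2 ^ j) x)"
      using cut_u_nonzero(2) phi_5_0 N
      by (auto simp: phiI_def uR_def u_def R_def cut_def dilate_def fun_eq_iff field_simps l2_norm_def)
    show ?thesis unfolding eq S_def by (intro fspan_cmult fspan_base imageI) (use N in simp)
  qed
  have gen: "(\<lambda>x. cut g x - (g 0 * \<kappa> * L x + g 1 * \<kappa> * R x)) \<in> S" if g: "g = phiR \<phi> j n" for g n
  proof -
    have z: "(\<lambda>x. 0) \<in> S" unfolding S_def by (rule fspan_zero)
    consider "n \<le> -2 \<or> n \<ge> 6 * 2 ^ j + 1" | "n = -1" | "n = 0" | "1 \<le> n" "n \<le> 6 * 2 ^ j - 2"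
      | "n = 6 * 2 ^ j - 1" | "n = 6 * 2 ^ j" by linarith
    thus ?thesis
    proof cases
      case 1
      thus ?thesis using z by (simp add: g cut_phiR_outside)
    next
      case 2
      hence "g = dilate j 0 (\<phi> 5)" by (simp add: g phi_boundary_index)
      thus ?thesis using z phi_5_0 by (simp add: phi_boundary_values \<kappa> L_def)
    next
      case 3
      hence "g = dilate j 0 (\<phi> 6)" by (simp add: g phi_boundary_index)
      thus ?thesis using L6 by (simp add: phi_boundary_values \<kappa>)
    next
      case 4
      hence s: "supp_in 0 1 g" unfolding g by (intro phiR_supp_in_01)
      hence "g 0 = 0" "g 1 = 0" by (auto intro: supp_in_outside)
      moreover have "g = phiI j (n + 1)" using 4 by (simp add: g phiI_def)
      hence "g \<in> S" using I[of "n + 1"] 4 by simp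
      hence "cut g \<in> S" by (simp only: cut_id[OF s])
      ultimately show ?thesis by simp
    next
      case 5
      hence "g = dilate j (2 ^ j) (\<phi> 5)" by (simp add: g phi_boundary_index)
      thus ?thesis using z phi_5_0 by (simp add: phi_boundary_values \<kappa> R_def)
    next
      case 6
      hence "g = dilate j (2 ^ j) (\<phi> 6)" by (simp add: g phi_boundary_index)
      thus ?thesis using R6 by (simp add: phi_boundary_values \<kappa>)
    qed
  qed
  have "(\<lambda>x. cut f x - (f 0 * \<kappa> * L x + f 1 * \<kappa> * R x)) \<in> S"
    using assms(1)
  proof (induction rule: fspan_induct)
    case zero
    show ?case using fspan_zero by (simp add: S_def cut_def)
  next
    case (step c g h)
    then obtain n where "g = phiR \<phi> j n" by blast
    note S = fspan_add[OF fspan_cmult[OF gen[OF this, unfolded S_def], of c] step(3)[unfolded S_def]]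
    have eq: "(\<lambda>x. cut (\<lambda>x. c * g x + h x) x - ((c * g 0 + h 0) * \<kappa> * L x + (c * g 1 + h 1) * \<kappa> * R x)) =
        (\<lambda>x. c * (cut g x - (g 0 * \<kappa> * L x + g 1 * \<kappa> * R x)) + (cut h x - (h 0 * \<kappa> * L x + h 1 * \<kappa> * R x)))"
      unfolding cut_lincomb by (simp add: fun_eq_iff algebra_simps)
    show ?case unfolding eq S_def by (rule S)
  qed
  thus ?thesis unfolding S_def L_def R_def .
qed

lemma Vint_in_fspan_phiI: "f \<in> Vint j \<Longrightarrow> f \<in> fspan (phiI j ` {1..6 * 2 ^ j})"
  unfolding Vint_def using cut_phiR_decomposition by fastforce

lemma phiI_in_Vint: "n \<in> {1..6 * 2 ^ j} \<Longrightarrow> phiI j n \<in> Vint j"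
proof -
  assume n: "n \<in> {1..6 * 2 ^ j}"
  have b: "cut (dilate j k f) \<in> Vint j" if "f \<in> {uL, uR}" "k = 0 \<or> k = 2 ^ j" for k f
  proof (rule VintI)
    show "dilate j k f \<in> fspan (range (phiR \<phi> j))"
      using dilate_phi_56[of f j k] uL_uR[OF that(1)] by (auto elim!: fspan_mono[rotated])
    show "dilate j k f 0 = 0" "dilate j k f 1 = 0"
      using dilate_endpoints[of f j] uL_uR[OF that(1)] that(2) by auto
  qed
  have "phiR \<phi> j (n - 1) \<in> Vint j" if "n \<noteq> 1" "n \<noteq> 6 * 2 ^ j"
  proof -
    have s: "supp_in 0 1 (phiR \<phi> j (n - 1))" using n that by (intro phiR_supp_in_01) auto
    hence "phiR \<phi> j (n - 1) 0 = 0" "phiR \<phi> j (n - 1) 1 = 0" by (auto intro: supp_in_outside)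
    thus ?thesis using VintI[of "phiR \<phi> j (n - 1)" j] by (simp add: cut_id[OF s] fspan_base)
  qed
  thus ?thesis using b by (auto simp: phiI_def)
qed

section \<open>The wavelets on the interval\<close>

lemma boundary_wavelet_left:
  assumes "i \<in> {1, 2}"
  obtains g where "g \<in> fspan (\<psi> ` {3..6})" "g 0 = 0" "\<psi>L i = cut g" "l2ip (phiL \<phi>) (cut g) = 0"
proof -
  have "\<psi>L i \<in> fspan {\<psi>L 1, \<psi>L 2}" using assms by (intro fspan_base) auto
  also have "fspan {\<psi>L 1, \<psi>L 2} = {g. \<exists>b :: nat \<Rightarrow> real. g = (\<lambda>x. \<Sum>j=1..4. b j * cut (\<psi> (j + 2)) x) \<and>
           (\<Sum>j=1..4. b j * \<psi> (j + 2) 0) = 0 \<and> l2_inner lborel (phiL \<phi>) g = 0}"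
    using boundary unfolding boundary_generators_def orthonormal_basis2_def by blast
  finally obtain b :: "nat \<Rightarrow> real" where b: "\<psi>L i = (\<lambda>x. \<Sum>j=1..4. b j * cut (\<psi> (j + 2)) x)"
    "(\<Sum>j=1..4. b j * \<psi> (j + 2) 0) = 0" "l2ip (phiL \<phi>) (\<psi>L i) = 0" by blast
  have "(\<lambda>x. \<Sum>j=1..4. b j * \<psi> (j + 2) x) \<in> fspan (\<psi> ` {3..6})"
    by (intro fspan_sum fspan_cmult fspan_base imageI) auto
  thus ?thesis using b that[of "\<lambda>x. \<Sum>j=1..4. b j * \<psi> (j + 2) x"] by (simp add: cut_sum)
qed

lemma boundary_wavelet_right:
  assumes "i \<in> {1, 2}"
  obtains g where "g \<in> fspan (\<psi> ` {3..6})" "g 0 = 0" "\<psi>R i = cut (dilate 0 1 g)" "l2ip (phiRt \<phi>) (cut (dilate 0 1 g)) = 0"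
proof -
  have "\<psi>R i \<in> fspan {\<psi>R 1, \<psi>R 2}" using assms by (intro fspan_base) auto
  also have "fspan {\<psi>R 1, \<psi>R 2} = {g. \<exists>c :: nat \<Rightarrow> real. g = (\<lambda>x. \<Sum>j=1..4. c j * cut (\<lambda>y. \<psi> (j + 2) (y - 1)) x) \<and>
           (\<Sum>j=1..4. c j * \<psi> (j + 2) 0) = 0 \<and> l2_inner lborel (phiRt \<phi>) g = 0}"
    using boundary unfolding boundary_generators_def orthonormal_basis2_def by blast
  finally obtain b :: "nat \<Rightarrow> real" where b: "\<psi>R i = (\<lambda>x. \<Sum>j=1..4. b j * cut (\<lambda>y. \<psi> (j + 2) (y - 1)) x)"
    "(\<Sum>j=1..4. b j * \<psi> (j + 2) 0) = 0" "l2ip (phiRt \<phi>) (\<psi>R i) = 0" by blast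
  have "(\<lambda>x. \<Sum>j=1..4. b j * \<psi> (j + 2) x) \<in> fspan (\<psi> ` {3..6})"
    by (intro fspan_sum fspan_cmult fspan_base imageI) auto
  moreover have "cut (dilate 0 1 (\<lambda>x. \<Sum>j=1..4. b j * \<psi> (j + 2) x)) = (\<lambda>x. \<Sum>j=1..4. b j * cut (\<lambda>y. \<psi> (j + 2) (y - 1)) x)"
    unfolding cut_sum[symmetric] by (simp add: dilate_0)
  ultimately show ?thesis using b that[of "\<lambda>x. \<Sum>j=1..4. b j * \<psi> (j + 2) x"] by simp
qed

lemma psi_36:
  assumes "g \<in> fspan (\<psi> ` {3..6})"
  shows "supp_in (-1) 1 g" "dilate j k g \<in> fspan (psiR \<psi> j ` {6 * k - 3..6 * k})"
    "dilate j k g \<in> fspan (range (phiR \<phi> (Suc j)))" "f \<in> fspan (range (phiR \<phi> j)) \<Longrightarrow> l2ip (dilate j k g) f = 0"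
proof -
  show "supp_in (-1) 1 g" using assms by (rule fspan_supp_in) (auto intro!: two_cells_supp_in psi_two_cells)
  have "dilate j k (\<psi> l) \<in> psiR \<psi> j ` {6 * k - 3..6 * k}" if "l \<in> {3..6}" for l
    using psiR_eq[of l j "k - 1"] that by (intro image_eqI[of _ _ "6 * k - 6 + int l"]) (auto simp: algebra_simps)
  thus "dilate j k g \<in> fspan (psiR \<psi> j ` {6 * k - 3..6 * k})"
    by (intro fspan_mono[OF _ fspan_dilate[OF assms]]) auto
  show "dilate j k g \<in> fspan (range (phiR \<phi> (Suc j)))"
    using fspan_dilate[OF assms] by (rule fspan_trans) (auto intro: dilate_psi_in_fspan)
  show "l2ip (dilate j k g) f = 0" if f: "f \<in> fspan (range (phiR \<phi> j))"
    by (rule fspan_orthogonal[OF fspan_dilate[OF assms]])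
      (auto intro!: square_integrable_dilate psi_square_integrable fspan_square_integrable[OF f] dilate_psi_orthogonal f
        simp: phiR_square_integrable)
qed

text \<open>The bound stops before the indices \<open>6 * 2 ^ j - 3\<close> to
  \<open>6 * 2 ^ j\<close>, which belong to \<open>\<psi> 3\<close>, ..., \<open>\<psi> 6\<close>
  centred at the right endpoint.\<close>

lemma psiR_supp_in_01:
  assumes "1 \<le> n" "n \<le> 6 * 2 ^ j - 4"
  shows "supp_in 0 1 (psiR \<psi> j n)"
proof -
  obtain k l where l: "l \<in> {1..6}" "n = 6 * k + int l" by (rule index6_cases)
  have k: "0 \<le> k" "(if l \<le> 2 then k + 1 else k + 2) \<le> 2 ^ j" using assms l by auto
  have kr: "0 \<le> real_of_int k" "of_int (if l \<le> 2 then k + 1 else k + 2) \<le> (2::real) ^ j"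
    using k by (simp, metis of_int_le_iff of_int_numeral of_int_power)
  show ?thesis
  proof (cases "l \<le> 2")
    case True
    hence "supp_in 0 1 (\<psi> l)" using l by (intro cell_supp_in psi_12_cell) auto
    from supp_in_dilate[OF this, of k j] show ?thesis
      unfolding l(2) psiR_eq[OF l(1)] using True kr
      by (auto elim!: supp_in_mono simp: field_simps)
  next
    case False
    have "supp_in (-1) 1 (\<psi> l)" by (rule two_cells_supp_in[OF psi_two_cells[OF l(1)]])
    from supp_in_dilate[OF this, of "k + 1" j] show ?thesis
      unfolding l(2) psiR_eq[OF l(1)] using False kr
      by (auto elim!: supp_in_mono simp: field_simps)
  qed
qed

abbreviation psiI :: "nat \<times> int \<Rightarrow> real \<Rightarrow> real" where
  "psiI \<equiv> psi1 \<phi> \<psi> \<psi>L \<psi>R"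

lemma psiI_scaling: "k \<in> {-5..0} \<Longrightarrow> psiI (j, k) = phiI 0 (k + 6)"
proof -
  assume "k \<in> {-5..0}"
  hence "k = -5 \<or> k = 0 \<or> (1 \<le> k + 5 \<and> k + 5 \<le> 4)" by auto
  thus ?thesis
  proof (elim disjE)
    assume k: "1 \<le> k + 5 \<and> k + 5 \<le> 4"
    define m where "m = nat (k + 5)"
    have m: "k = int m - 5" "m \<in> {1..4}" using k by (auto simp: m_def)
    hence "\<phi> m = phiR \<phi> 0 (int m)" "nat (k + 6) = m + 1" using phiR_eq[of m 0 0] by auto
    thus ?thesis using m by (auto simp: psi1_def phi0_def phiI_def)
  next
    assume "k = 0"
    thus ?thesis using cut_dilate_right[of 1 uR 0] uL_uR[of uR]
      by (simp add: psi1_def phi0_def phiI_def phiRt_eq)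
  qed (simp add: psi1_def phi0_def phiI_def phiL_eq)
qed

text \<open>The boundary cases provide the uncut \<open>g\<close> on the line, where orthogonality
  is known, together with the facts on \<open>\<psi>L\<close> and \<open>\<psi>R\<close> for those
  products in which the cut does matter.\<close>

lemma psiI_cases [consumes 1, case_names left inner right]:
  assumes "k \<in> {1..6 * 2 ^ j}"
  obtains g where "k \<in> {1, 2}" "g \<in> fspan (\<psi> ` {3..6})" "g 0 = 0" "psiI (j, k) = cut (dilate j 0 g)" "\<psi>L (nat k) = cut g"
      "l2ip (phiL \<phi>) (cut g) = 0"
  | "3 \<le> k" "k \<le> 6 * 2 ^ j - 2" "psiI (j, k) = psiR \<psi> j (k - 2)" "supp_in 0 1 (psiR \<psi> j (k - 2))"
  | g where "k \<in> {6 * 2 ^ j - 1, 6 * 2 ^ j}" "g \<in> fspan (\<psi> ` {3..6})" "g 0 = 0" "psiI (j, k) = cut (dilate j (2 ^ j) g)"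
      "\<psi>R (nat (k - 6 * 2 ^ j + 2)) = cut (dilate 0 1 g)" "l2ip (phiRt \<phi>) (cut (dilate 0 1 g)) = 0"
proof -
  have N: "(6::int) \<le> 6 * 2 ^ j" using one_le_power[of "2::int" j, OF one_le_numeral] by linarith
  consider "k \<in> {1, 2}" | "3 \<le> k" "k \<le> 6 * 2 ^ j - 2" | "k \<in> {6 * 2 ^ j - 1, 6 * 2 ^ j}"
    using assms by fastforce
  thus ?thesis
  proof cases
    case 1
    obtain g where g: "g \<in> fspan (\<psi> ` {3..6})" "g 0 = 0" "\<psi>L (nat k) = cut g" "l2ip (phiL \<phi>) (cut g) = 0"
      using 1 by (auto intro: boundary_wavelet_left[of "nat k"])
    have "psiI (j, k) = cut (dilate j 0 g)"
      using 1 g cut_dilate_left[OF psi_36(1)[OF g(1)]] by (auto simp: psi1_def)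
    thus ?thesis using that(1) 1 g by blast
  next
    case 2
    hence "psiI (j, k) = psiR \<psi> j (k - 2)" by (simp add: psi1_def)
    thus ?thesis using that(2) 2 psiR_supp_in_01[of "k - 2" j] by simp
  next
    case 3
    let ?i = "nat (k - 6 * 2 ^ j + 2)"
    obtain g where g: "g \<in> fspan (\<psi> ` {3..6})" "g 0 = 0" "\<psi>R ?i = cut (dilate 0 1 g)" "l2ip (phiRt \<phi>) (cut (dilate 0 1 g)) = 0"
      using 3 by (auto intro: boundary_wavelet_right[of ?i])
    have "k = 6 * 2 ^ j - 1 \<or> k = 6 * 2 ^ j" using 3 by blast
    hence "\<not> k \<le> 0" "\<not> k \<le> 2" "\<not> k \<le> 6 * 2 ^ j - 2" using N by linarith+
    hence "psiI (j, k) = dilate j (2 ^ j - 1) (\<psi>R ?i)" by (simp only: psi1_def prod.case if_False)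
    hence "psiI (j, k) = cut (dilate j (2 ^ j) g)"
      using g(3) cut_dilate_right[OF psi_36(1)[OF g(1)], of j] by simp
    thus ?thesis using that(3) 3 g by blast
  qed
qed

lemma psiI_in_Vint: "k \<in> {1..6 * 2 ^ j} \<Longrightarrow> psiI (j, k) \<in> Vint (Suc j)"
proof (induction rule: psiI_cases)
  case (left g)
  show ?case unfolding left(4) using psi_36(1,3)[OF left(2)] dilate_endpoints[of g j] left(3) by (intro VintI) auto
next
  case (right g)
  show ?case unfolding right(4) using psi_36(1,3)[OF right(2)] dilate_endpoints[of g j] right(3) by (intro VintI) auto
next
  case inner
  obtain n l where l: "l \<in> {1..6}" "k - 2 = 6 * n + int l" by (rule index6_cases)
  have "psiR \<psi> j (k - 2) \<in> fspan (range (phiR \<phi> (Suc j)))"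
    unfolding l(2) psiR_eq[OF l(1)] by (rule dilate_psi_in_fspan[OF l(1)])
  moreover have "psiR \<psi> j (k - 2) 0 = 0" "psiR \<psi> j (k - 2) 1 = 0" using inner(4) by (auto intro: supp_in_outside)
  ultimately show ?case using VintI cut_id[OF inner(4)] inner(3) by metis
qed

text \<open>Orthogonality is inherited from the line unless both functions are cut at the same end.
  For a boundary wavelet and the boundary scaling function of its own end it is the condition
  imposed in the construction.\<close>

lemma psiI_orthogonal_phiI:
  assumes "k \<in> {1..6 * 2 ^ j}" "n \<in> {1..6 * 2 ^ j}"
  shows "l2ip (psiI (j, k)) (phiI j n) = 0"
proof -
  have N: "(6::int) \<le> 6 * 2 ^ j" using one_le_power[of "2::int" j, OF one_le_numeral] by linarith
  have uL: "uL \<in> fspan {\<phi> 5, \<phi> 6}" "supp_in (-1) 1 uL" and uR: "uR \<in> fspan {\<phi> 5, \<phi> 6}" "supp_in (-1) 1 uR"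
    using uL_uR by auto
  have V: "dilate j i f \<in> fspan (range (phiR \<phi> j))" if "f \<in> fspan {\<phi> 5, \<phi> 6}" for f i
    using dilate_phi_56[OF that, of j i] by (auto elim!: fspan_mono[rotated])
  have R: "phiR \<phi> j i \<in> fspan (range (phiR \<phi> j))" for i by (rule fspan_base) auto
  consider "n = 1" "phiI j n = cut (dilate j 0 uL)" | "n = 6 * 2 ^ j" "phiI j n = cut (dilate j (2 ^ j) uR)"
    | "phiI j n = phiR \<phi> j (n - 1)" "supp_in 0 1 (phiR \<phi> j (n - 1))"
  proof -
    have "supp_in 0 1 (phiR \<phi> j (n - 1))" if "n \<noteq> 1" "n \<noteq> 6 * 2 ^ j"
      using assms(2) that by (intro phiR_supp_in_01) auto
    thus ?thesis using that N by (cases "n = 1"; cases "n = 6 * 2 ^ j") (auto simp: phiI_def)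
  qed
  note n = this
  show ?thesis using assms(1)
  proof (cases rule: psiI_cases)
    case (left g)
    note g = psi_36[OF left(2)]
    from n show ?thesis
    proof cases
      case 1
      have "l2ip (dilate j 0 (cut g)) (dilate j 0 (cut uL)) = l2ip (cut g) (cut uL)" by (rule l2_inner_dilate)
      also have "\<dots> = 0" using left(6) by (simp add: phiL_eq l2_inner_commute)
      finally show ?thesis
        unfolding 1(2) left(4) cut_dilate_left[OF uL(2), symmetric] cut_dilate_left[OF g(1), symmetric] .
    next
      case 2
      show ?thesis unfolding 2(2) left(4) l2_inner_cut_left_right[OF g(1) uR(2)] by (rule g(4)[OF V[OF uR(1)]])
    next
      case 3
      show ?thesis unfolding 3(1) left(4) l2_inner_cut_left_inner[OF g(1) 3(2)] by (rule g(4)[OF R])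
    qed
  next
    case inner
    obtain i l where l: "l \<in> {1..6}" "k - 2 = 6 * i + int l" by (rule index6_cases)
    have o: "l2ip (psiR \<psi> j (k - 2)) f = 0" if "f \<in> fspan (range (phiR \<phi> j))" for f
      unfolding l(2) psiR_eq[OF l(1)] by (rule dilate_psi_orthogonal[OF l(1) that])
    from n show ?thesis
      using l2_inner_cut_left_inner[OF uL(2) inner(4), of j] l2_inner_cut_right_inner[OF uR(2) inner(4), of j]
        o[OF V[OF uL(1)], of 0] o[OF V[OF uR(1)], of "2 ^ j"] o[OF R]
      by cases (simp_all add: inner(3) l2_inner_commute[of _ "psiR \<psi> j (k - 2)"])
  next
    case (right g)
    note g = psi_36[OF right(2)]
    from n show ?thesis
    proof cases
      case 1
      show ?thesis unfolding 1(2) right(4) l2_inner_commute[of _ "cut (dilate j (2 ^ j) g)"] l2_inner_cut_left_right[OF uL(2) g(1)]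
        by (subst l2_inner_commute) (rule g(4)[OF V[OF uL(1)]])
    next
      case 2
      have "l2ip (dilate j (2 ^ j - 1) (cut (dilate 0 1 g))) (dilate j (2 ^ j - 1) (cut (dilate 0 1 uR))) =
          l2ip (cut (dilate 0 1 g)) (cut (dilate 0 1 uR))" by (rule l2_inner_dilate)
      also have "\<dots> = 0" using right(6) by (simp add: phiRt_eq l2_inner_commute)
      finally show ?thesis
        unfolding 2(2) right(4) cut_dilate_right[OF uR(2), symmetric] cut_dilate_right[OF g(1), symmetric] .
    next
      case 3
      show ?thesis unfolding 3(1) right(4) l2_inner_cut_right_inner[OF g(1) 3(2)] by (rule g(4)[OF R])
    qed
  qed
qed

lemma psiI_orthogonal_Vint:
  assumes "k \<in> {1..6 * 2 ^ j}" "f \<in> Vint i" "i \<le> j"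
  shows "l2ip (psiI (j, k)) f = 0"
proof -
  have "f \<in> fspan (phiI j ` {1..6 * 2 ^ j})" using Vint_in_fspan_phiI Vint_mono assms(2,3) by blast
  hence "l2ip f (psiI (j, k)) = 0"
  proof (rule fspan_orthogonal)
    show "l2ip s (psiI (j, k)) = 0" if "s \<in> phiI j ` {1..6 * 2 ^ j}" for s
      using that psiI_orthogonal_phiI[OF assms(1)] by (auto simp: l2_inner_commute[of _ _ "psiI (j, k)"])
  qed (auto intro: Vint_square_integrable[OF phiI_in_Vint] Vint_square_integrable[OF psiI_in_Vint[OF assms(1)]])
  thus ?thesis by (simp add: l2_inner_commute)
qed

lemma boundary_wavelet_inner:
  assumes "i \<in> {1, 2}" "i' \<in> {1, 2}"
  shows "l2ip (\<psi>L i) (\<psi>L i') = (if i = i' then 1 else 0)" "l2ip (\<psi>R i) (\<psi>R i') = (if i = i' then 1 else 0)"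
  using boundary assms unfolding boundary_generators_def orthonormal_basis2_def
  by (auto simp: l2_norm_eq_1_iff l2_inner_commute[of _ "\<psi>L 2" "\<psi>L 1"] l2_inner_commute[of _ "\<psi>R 2" "\<psi>R 1"])

lemma fspan_psiR_orthogonal:
  assumes "f \<in> fspan (psiR \<psi> j ` A)" "g \<in> fspan (psiR \<psi> j ` B)" "A \<inter> B = {}"
  shows "l2ip f g = 0"
  using assms by (intro fspan_orthogonal2[OF assms(1,2)]) (auto simp: psiR_square_integrable psiR_inner)

text \<open>Two wavelets at the same end are both cut there, and their relation comes from the
  orthonormal pair chosen in the construction. All other pairs reduce to disjoint index sets of
  \<open>psiR\<close> on the line.\<close>

lemma psiI_inner_same_level:
  assumes "k \<in> {1..6 * 2 ^ j}" "k' \<in> {1..6 * 2 ^ j}"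
  shows "l2ip (psiI (j, k)) (psiI (j, k')) = (if k = k' then 1 else 0)"
proof -
  have N: "(6::int) \<le> 6 * 2 ^ j" using one_le_power[of "2::int" j, OF one_le_numeral] by linarith
  have R: "psiR \<psi> j (k - 2) \<in> fspan (psiR \<psi> j ` {1..6 * 2 ^ j - 4})" if "3 \<le> k" "k \<le> 6 * 2 ^ j - 2" for k
    using that by (intro fspan_base imageI) auto
  have LI: "l2ip (cut (dilate j 0 g)) (psiR \<psi> j (k - 2)) = 0"
    if "g \<in> fspan (\<psi> ` {3..6})" "3 \<le> k" "k \<le> 6 * 2 ^ j - 2" "supp_in 0 1 (psiR \<psi> j (k - 2))" for g k
    unfolding l2_inner_cut_left_inner[OF psi_36(1)[OF that(1)] that(4)]
    by (rule fspan_psiR_orthogonal[OF psi_36(2)[OF that(1)] R[OF that(2,3)]]) auto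
  have RI: "l2ip (cut (dilate j (2 ^ j) g)) (psiR \<psi> j (k - 2)) = 0"
    if "g \<in> fspan (\<psi> ` {3..6})" "3 \<le> k" "k \<le> 6 * 2 ^ j - 2" "supp_in 0 1 (psiR \<psi> j (k - 2))" for g k
    unfolding l2_inner_cut_right_inner[OF psi_36(1)[OF that(1)] that(4)]
    by (rule fspan_psiR_orthogonal[OF psi_36(2)[OF that(1)] R[OF that(2,3)]]) auto
  have LR: "l2ip (cut (dilate j 0 g)) (cut (dilate j (2 ^ j) g')) = 0"
    if "g \<in> fspan (\<psi> ` {3..6})" "g' \<in> fspan (\<psi> ` {3..6})" for g g'
    unfolding l2_inner_cut_left_right[OF psi_36(1)[OF that(1)] psi_36(1)[OF that(2)]]
  proof (rule fspan_psiR_orthogonal[OF psi_36(2)[OF that(1)] psi_36(2)[OF that(2)]])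
    have "x < y" if "x \<in> {6 * 0 - 3..6 * 0}" "y \<in> {6 * 2 ^ j - 3..6 * 2 ^ j}" for x y :: int
      using that N unfolding atLeastAtMost_iff by linarith
    thus "{6 * 0 - 3..6 * 0} \<inter> {6 * 2 ^ j - 3..6 * 2 ^ j} = ({} :: int set)" by blast
  qed
  show ?thesis
  proof (use assms(1) in \<open>cases rule: psiI_cases\<close>)
    case (left g)
    show ?thesis
    proof (use assms(2) in \<open>cases rule: psiI_cases\<close>)
      case (left g')
      have "l2ip (psiI (j, k)) (psiI (j, k')) = l2ip (\<psi>L (nat k)) (\<psi>L (nat k'))"
        using \<open>k \<in> {1, 2}\<close> left(1) by (auto simp: psi1_def l2_inner_dilate)
      thus ?thesis using boundary_wavelet_inner(1)[of "nat k" "nat k'"] \<open>k \<in> {1, 2}\<close> left(1) by auto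
    next
      case inner
      thus ?thesis using LI[OF left(2) inner(1,2,4)] left(1,4) inner by auto
    next
      case (right g')
      moreover have "k \<noteq> k'" using left(1) right(1) N by (elim insertE emptyE) linarith+
      ultimately show ?thesis using LR[OF left(2) right(2)] left(4) by simp
    qed
  next
    case inner
    show ?thesis
    proof (use assms(2) in \<open>cases rule: psiI_cases\<close>)
      case (left g')
      thus ?thesis using LI[OF left(2) inner(1,2,4)] inner by (auto simp: l2_inner_commute[of _ "psiR \<psi> j (k - 2)"])
    next
      case inner': inner
      thus ?thesis using inner(3) by (simp add: psiR_inner)
    next
      case (right g')
      thus ?thesis using RI[OF right(2) inner(1,2,4)] inner by (auto simp: l2_inner_commute[of _ "psiR \<psi> j (k - 2)"])
    qed
  next
    case (right g)
    show ?thesis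
    proof (use assms(2) in \<open>cases rule: psiI_cases\<close>)
      case (left g')
      moreover have "k \<noteq> k'" using left(1) right(1) N by (elim insertE emptyE) linarith+
      ultimately show ?thesis using LR[OF left(2) right(2)] right(4)
        by (simp add: l2_inner_commute[of _ "cut (dilate j (2 ^ j) g)"])
    next
      case inner
      thus ?thesis using RI[OF right(2) inner(1,2,4)] right(1,4) inner by auto
    next
      case right': (right g')
      have "l2ip (psiI (j, k)) (psiI (j, k')) = l2ip (\<psi>R (nat (k - 6 * 2 ^ j + 2))) (\<psi>R (nat (k' - 6 * 2 ^ j + 2)))"
        unfolding right(4,5) right'(4,5)
        unfolding cut_dilate_right[OF psi_36(1)[OF right(2)], symmetric] cut_dilate_right[OF psi_36(1)[OF right'(2)], symmetric]
        by (rule l2_inner_dilate)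
      thus ?thesis
        using boundary_wavelet_inner(2)[of "nat (k - 6 * 2 ^ j + 2)" "nat (k' - 6 * 2 ^ j + 2)"] right(1) right'(1) by auto
    qed
  qed
qed

lemma index1_cases:
  assumes "(j, k) \<in> index1"
  shows "(j = 0 \<and> k \<in> {-5..0}) \<or> k \<in> {1..6 * 2 ^ j}"
  using assms by (auto simp: index1_def split: if_splits)

lemma psiI_level: "(j, k) \<in> index1 \<Longrightarrow> psiI (j, k) \<in> Vint (Suc j)"
  using psiI_in_Vint[of k j] psiI_scaling[of k 0] phiI_in_Vint[of "k + 6" 0] Vint_Suc
  by (auto dest!: index1_cases)

lemma psiI_orthonormal:
  assumes "p \<in> index1" "q \<in> index1"
  shows "l2ip (psiI p) (psiI q) = (if p = q then 1 else 0)"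
proof -
  \<comment> \<open>The lower function lies in some \<open>Vint i\<close> with
    \<open>i \<le> j'\<close>, to which the wavelets of level \<open>j'\<close> are orthogonal. The
    alternative \<open>k \<le> 0\<close> treats the scaling functions, which lie in
    \<open>Vint 0\<close> but share level \<open>0\<close> with the first wavelets.\<close>
  have lt: "l2ip (psiI (j, k)) (psiI (j', k')) = 0" if "(j, k) \<in> index1" "k' \<in> {1..6 * 2 ^ j'}" "j < j' \<or> k \<le> 0" for j k j' k'
  proof -
    have "\<exists>i\<le>j'. psiI (j, k) \<in> Vint i"
    proof (cases "k \<le> 0")
      case True
      hence "psiI (j, k) = phiI 0 (k + 6)" "k + 6 \<in> {1..6}" using index1_cases[OF that(1)] by (auto intro: psiI_scaling)
      thus ?thesis using phiI_in_Vint[of "k + 6" 0] by auto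
    next
      case False
      thus ?thesis using psiI_level[OF that(1)] that(3) by (intro exI[of _ "Suc j"]) auto
    qed
    thus ?thesis using psiI_orthogonal_Vint[OF that(2)] l2_inner_commute by metis
  qed
  obtain j k j' k' where p: "p = (j, k)" and q: "q = (j', k')" by (metis prod.exhaust)
  note c = index1_cases[OF assms(1)[unfolded p]] index1_cases[OF assms(2)[unfolded q]]
  consider "k \<le> 0" "k' \<le> 0" | "k \<le> 0" "k' > 0" | "k > 0" "k' \<le> 0" | "k > 0" "k' > 0" "j = j'"
    | "k > 0" "k' > 0" "j < j'" | "k > 0" "k' > 0" "j' < j" by linarith
  thus ?thesis
  proof cases
    case 1
    thus ?thesis using c phiI_inner[of "k + 6" 0 "k' + 6"] by (auto simp: p q psiI_scaling)
  next
    case 2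
    thus ?thesis using lt[of j k k' j'] assms c by (auto simp: p q)
  next
    case 3
    thus ?thesis using lt[of j' k' k j] assms c by (auto simp: p q l2_inner_commute[of _ "psiI (j, k)"])
  next
    case 4
    thus ?thesis using psiI_inner_same_level[of k j k'] c by (auto simp: p q)
  next
    case 5
    thus ?thesis using lt[of j k k' j'] assms c by (auto simp: p q)
  next
    case 6
    thus ?thesis using lt[of j' k' k j] assms c by (auto simp: p q l2_inner_commute[of _ "psiI (j, k)"])
  qed
qed

lemma psiI_square_integrable: "p \<in> index1 \<Longrightarrow> sqint (psiI p)"
  using psiI_level Vint_square_integrable by (cases p) blast

lemma psiI_supp_in: "p \<in> index1 \<Longrightarrow> supp_in 0 1 (psiI p)"
  using psiI_level Vint_supp_in by (cases p) blast

section \<open>Counting the functions below a level\<close>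

definition index_upto :: "nat \<Rightarrow> (nat \<times> int) set" where
  "index_upto J = {p \<in> index1. fst p \<le> J}"

text \<open>Level \<open>0\<close> has six scaling functions and six wavelets; each further level
  adds as many functions as there are below it. The result equals the number
  \<open>6 * 2 ^ Suc J\<close> of functions \<open>phiI (Suc J)\<close>.\<close>

lemma card_index_upto: "finite (index_upto J) \<and> card (index_upto J) = 12 * 2 ^ J"
proof (induction J)
  case 0
  have "index_upto 0 = {0} \<times> {-5..6}" by (auto simp: index_upto_def index1_def)
  thus ?case by (simp add: card_cartesian_product)
next
  case (Suc J)
  have "index_upto (Suc J) = index_upto J \<union> {Suc J} \<times> {1..6 * 2 ^ Suc J}"
    by (auto simp: index_upto_def index1_def le_Suc_eq)
  moreover have "index_upto J \<inter> {Suc J} \<times> {1..6 * 2 ^ Suc J} = {}" by (auto simp: index_upto_def)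
  moreover have "nat (6 * 2 ^ Suc J) = 12 * 2 ^ J" by (simp add: nat_mult_distrib nat_power_eq)
  ultimately show ?case using Suc by (simp add: card_Un_disjoint card_cartesian_product)
qed

lemma phiI_approximation:
  assumes "n \<in> {1..6 * 2 ^ Suc J}"
  shows "l2_norm lborel (\<lambda>x. phiI (Suc J) n x - (\<Sum>p\<in>index_upto J. l2ip (phiI (Suc J) n) (psiI p) * psiI p x)) = 0"
proof (rule orthonormal_same_card[where J = "{1..6 * 2 ^ Suc J}" and f = "phiI (Suc J)"])
  have "nat (6 * 2 ^ Suc J) = 12 * 2 ^ J" by (simp add: nat_mult_distrib nat_power_eq)
  thus "finite (index_upto J)" "card (index_upto J) = card {1..6 * 2 ^ Suc J::int}"
    using card_index_upto[of J] by simp_all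
  show "psiI p \<in> fspan (phiI (Suc J) ` {1..6 * 2 ^ Suc J})" if "p \<in> index_upto J" for p
    using that psiI_level[of "fst p" "snd p"] Vint_mono[of "psiI p" "Suc (fst p)" "Suc J"]
    by (intro Vint_in_fspan_phiI) (auto simp: index_upto_def)
  show "sqint (phiI (Suc J) m)" if "m \<in> {1..6 * 2 ^ Suc J}" for m
    by (rule Vint_square_integrable[OF phiI_in_Vint[OF that]])
  show "l2ip (phiI (Suc J) m) (phiI (Suc J) m') = (if m = m' then 1 else 0)"
    if "m \<in> {1..6 * 2 ^ Suc J}" "m' \<in> {1..6 * 2 ^ Suc J}" for m m'
    using that by (rule phiI_inner)
  show "n \<in> {1..6 * 2 ^ Suc J}" by (rule assms)
qed (auto simp: index_upto_def psiI_orthonormal intro: psiI_square_integrable)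

end

section \<open>Density\<close>

text \<open>Stated with the squared distance, which keeps square roots out of the estimates.\<close>

definition approximable :: "'a measure \<Rightarrow> 'i set \<Rightarrow> ('i \<Rightarrow> 'a \<Rightarrow> real) \<Rightarrow> ('a \<Rightarrow> real) \<Rightarrow> bool" where
  "approximable M I e f \<longleftrightarrow> (\<forall>\<epsilon>>0. \<exists>F c. finite F \<and> F \<subseteq> I \<and>
     l2_inner M (\<lambda>x. f x - (\<Sum>i\<in>F. c i * e i x)) (\<lambda>x. f x - (\<Sum>i\<in>F. c i * e i x)) < \<epsilon>)"

text \<open>Nonnegativity of the square of \<open>a * f x - g x\<close> bounds the mixed term; this
  replaces the triangle inequality.\<close>

lemma l2_inner_lincomb_le:
  assumes "square_integrable M f" "square_integrable M g"
  shows "l2_inner M (\<lambda>x. a * f x + g x) (\<lambda>x. a * f x + g x) \<le> 2 * a\<^sup>2 * l2_inner M f f + 2 * l2_inner M g g"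
proof -
  have s: "square_integrable M (\<lambda>x. a * f x)" by (rule square_integrable_cmult[OF assms(1)])
  have "0 \<le> l2_inner M (\<lambda>x. a * f x - g x) (\<lambda>x. a * f x - g x)" by simp
  hence "2 * (a * l2_inner M f g) \<le> a * (a * l2_inner M f f) + l2_inner M g g"
    using assms s
    by (simp add: l2_inner_diff_left l2_inner_diff_right square_integrable_diff l2_inner_cmult_left l2_inner_cmult_right
        l2_inner_commute[of M g f] right_diff_distrib)
  thus ?thesis using assms s
    by (simp add: l2_inner_add_left l2_inner_add_right square_integrable_add l2_inner_cmult_left l2_inner_cmult_right
        l2_inner_commute[of M g f] power2_eq_square distrib_left)
qed

lemma approximable_cong:
  assumes "\<And>x. x \<in> space M \<Longrightarrow> f x = g x" "approximable M I e f"
  shows "approximable M I e g"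
proof -
  have "l2_inner M (\<lambda>x. f x - s x) (\<lambda>x. f x - s x) = l2_inner M (\<lambda>x. g x - s x) (\<lambda>x. g x - s x)" for s
    by (intro l2_inner_cong) (simp add: assms(1))
  thus ?thesis using assms(2) unfolding approximable_def by simp
qed

context
  fixes M :: "'a measure" and I :: "'i set" and e :: "'i \<Rightarrow> 'a \<Rightarrow> real"
  assumes se: "\<And>i. i \<in> I \<Longrightarrow> square_integrable M (e i)"
begin

lemma square_integrable_remainder:
  assumes "square_integrable M f" "F \<subseteq> I"
  shows "square_integrable M (\<lambda>x. f x - (\<Sum>i\<in>F. c i * e i x))"
proof (intro square_integrable_diff square_integrable_sum square_integrable_cmult assms(1))
  show "square_integrable M (e i)" if "i \<in> F" for i using se assms(2) that by blast
qed

lemma approximable_zero: "approximable M I e (\<lambda>x. 0)"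
  unfolding approximable_def by (auto intro: exI[of _ "{}"])

lemma approximable_lincomb:
  assumes f: "approximable M I e f" "square_integrable M f" and g: "approximable M I e g" "square_integrable M g"
  shows "approximable M I e (\<lambda>x. a * f x + g x)"
  unfolding approximable_def
proof (intro allI impI)
  fix \<epsilon> :: real assume \<epsilon>: "\<epsilon> > 0"
  \<comment> \<open>The summand \<open>1\<close> keeps the divisor positive when
    \<open>a = 0\<close>.\<close>
  have a: "0 < 4 * (a\<^sup>2 + 1)" by (simp add: add_nonneg_pos)
  let ?R = "\<lambda>f F c x. f x - (\<Sum>i\<in>F. c i * e i x)"
  obtain F c where F: "finite F" "F \<subseteq> I" "l2_inner M (?R f F c) (?R f F c) < \<epsilon> / (4 * (a\<^sup>2 + 1))"
    using f(1) \<epsilon> a unfolding approximable_def by (meson divide_pos_pos)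
  obtain G d where G: "finite G" "G \<subseteq> I" "l2_inner M (?R g G d) (?R g G d) < \<epsilon> / 4"
    using g(1) \<epsilon> unfolding approximable_def by (meson divide_pos_pos zero_less_numeral)
  define k where "k = (\<lambda>i. a * (if i \<in> F then c i else 0) + (if i \<in> G then d i else 0))"
  have "(\<Sum>i\<in>F \<union> G. k i * e i x) = a * (\<Sum>i\<in>F. c i * e i x) + (\<Sum>i\<in>G. d i * e i x)" for x
  proof -
    have "(\<Sum>i\<in>F \<union> G. (if i \<in> F then c i else 0) * e i x) = (\<Sum>i\<in>F. c i * e i x)"
      "(\<Sum>i\<in>F \<union> G. (if i \<in> G then d i else 0) * e i x) = (\<Sum>i\<in>G. d i * e i x)"
      using F(1) G(1) by (intro sum.mono_neutral_cong_right; auto)+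
    moreover have "(\<Sum>i\<in>F \<union> G. k i * e i x) = a * (\<Sum>i\<in>F \<union> G. (if i \<in> F then c i else 0) * e i x)
        + (\<Sum>i\<in>F \<union> G. (if i \<in> G then d i else 0) * e i x)"
      unfolding k_def distrib_right sum.distrib sum_distrib_left mult.assoc ..
    ultimately show ?thesis by simp
  qed
  hence eq: "(\<lambda>x. a * f x + g x - (\<Sum>i\<in>F \<union> G. k i * e i x)) = (\<lambda>x. a * ?R f F c x + ?R g G d x)"
    by (simp add: fun_eq_iff algebra_simps)
  have "l2_inner M (\<lambda>x. a * ?R f F c x + ?R g G d x) (\<lambda>x. a * ?R f F c x + ?R g G d x)
      \<le> 2 * a\<^sup>2 * l2_inner M (?R f F c) (?R f F c) + 2 * l2_inner M (?R g G d) (?R g G d)"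
    by (intro l2_inner_lincomb_le square_integrable_remainder f g F G)
  also have "\<dots> < \<epsilon>"
  proof -
    have "2 * a\<^sup>2 * l2_inner M (?R f F c) (?R f F c) \<le> 2 * a\<^sup>2 * (\<epsilon> / (4 * (a\<^sup>2 + 1)))"
      using F(3) by (intro mult_left_mono) auto
    also have "\<dots> \<le> \<epsilon> / 2" using a \<epsilon> by (simp add: field_simps)
    finally show ?thesis using G(3) by linarith
  qed
  finally show "\<exists>F c. finite F \<and> F \<subseteq> I \<and> l2_inner M (\<lambda>x. a * f x + g x - (\<Sum>i\<in>F. c i * e i x))
      (\<lambda>x. a * f x + g x - (\<Sum>i\<in>F. c i * e i x)) < \<epsilon>"
    using F G eq by (intro exI[of _ "F \<union> G"] exI[of _ k]) auto
qed

lemma approximable_sum: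
  assumes "\<And>j. j \<in> A \<Longrightarrow> approximable M I e (f j) \<and> square_integrable M (f j)"
  shows "approximable M I e (\<lambda>x. \<Sum>j\<in>A. c j * f j x)"
  using assms
proof (induction A rule: infinite_finite_induct)
  case (insert j A)
  have "square_integrable M (\<lambda>x. \<Sum>j\<in>A. c j * f j x)"
    using insert.prems by (intro square_integrable_sum square_integrable_cmult) auto
  thus ?case using insert approximable_lincomb[of "f j" "\<lambda>x. \<Sum>j\<in>A. c j * f j x" "c j"] by simp
qed (simp_all add: approximable_zero)

lemma approximable_limit:
  assumes g: "square_integrable M g"
    and lim: "\<And>\<epsilon>. \<epsilon> > 0 \<Longrightarrow> \<exists>h. square_integrable M h \<and> approximable M I e h \<and>
      l2_inner M (\<lambda>x. g x - h x) (\<lambda>x. g x - h x) < \<epsilon>"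
  shows "approximable M I e g"
  unfolding approximable_def
proof (intro allI impI)
  fix \<epsilon> :: real assume \<epsilon>: "\<epsilon> > 0"
  let ?R = "\<lambda>f F c x. f x - (\<Sum>i\<in>F. c i * e i x)"
  obtain h where h: "square_integrable M h" "approximable M I e h" "l2_inner M (\<lambda>x. g x - h x) (\<lambda>x. g x - h x) < \<epsilon> / 4"
    using lim[of "\<epsilon> / 4"] \<epsilon> by auto
  obtain F c where F: "finite F" "F \<subseteq> I" "l2_inner M (?R h F c) (?R h F c) < \<epsilon> / 4"
    using h(2) \<epsilon> unfolding approximable_def by (meson divide_pos_pos zero_less_numeral)
  have eq: "?R g F c = (\<lambda>x. 1 * (g x - h x) + ?R h F c x)" by (simp add: fun_eq_iff)
  have "l2_inner M (?R g F c) (?R g F c) \<le> 2 * 1\<^sup>2 * l2_inner M (\<lambda>x. g x - h x) (\<lambda>x. g x - h x)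
      + 2 * l2_inner M (?R h F c) (?R h F c)"
    unfolding eq by (intro l2_inner_lincomb_le square_integrable_diff square_integrable_remainder g h F)
  also have "\<dots> < \<epsilon>" using h(3) F(3) by simp
  finally show "\<exists>F c. finite F \<and> F \<subseteq> I \<and> l2_inner M (?R g F c) (?R g F c) < \<epsilon>" using F by blast
qed

text \<open>Dominated convergence for the squared distances: both functions are bounded by
  \<open>w\<close>, so their difference is bounded by \<open>2 * w\<close>.\<close>

lemma approximable_dominated:
  assumes h: "\<And>n. approximable M I e (h n)" "\<And>n. h n \<in> borel_measurable M"
    and w: "square_integrable M w" "\<And>n x. x \<in> space M \<Longrightarrow> \<bar>h n x\<bar> \<le> w x"
    and g: "g \<in> borel_measurable M" "\<And>x. x \<in> space M \<Longrightarrow> \<bar>g x\<bar> \<le> w x"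
    and lim: "\<And>x. x \<in> space M \<Longrightarrow> (\<lambda>n. h n x) \<longlonglongrightarrow> g x"
  shows "approximable M I e g"
proof (rule approximable_limit)
  have bound: "square_integrable M f" if "f \<in> borel_measurable M" "\<And>x. x \<in> space M \<Longrightarrow> \<bar>f x\<bar> \<le> w x" for f
    unfolding square_integrable_def
  proof (rule conjI[OF that(1)], rule Bochner_Integration.integrable_bound)
    show "integrable M (\<lambda>x. (w x)\<^sup>2)" using w(1) by (simp add: square_integrable_def)
    show "AE x in M. norm ((f x)\<^sup>2) \<le> norm ((w x)\<^sup>2)"
    proof (rule AE_I2)
      fix x assume "x \<in> space M"
      hence "\<bar>f x\<bar>\<^sup>2 \<le> (w x)\<^sup>2" using that(2) by (intro power_mono) auto
      thus "norm ((f x)\<^sup>2) \<le> norm ((w x)\<^sup>2)" by simp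
    qed
  qed (use that(1) in measurable)
  show sg: "square_integrable M g" by (rule bound[OF g])
  fix \<epsilon> :: real assume \<epsilon>: "\<epsilon> > 0"
  have "(\<lambda>n. LINT x|M. (g x - h n x)\<^sup>2) \<longlonglongrightarrow> (LINT x|M. 0)"
  proof (rule integral_dominated_convergence)
    show "integrable M (\<lambda>x. 4 * (w x)\<^sup>2)" using w(1) by (simp add: square_integrable_def)
    show "AE x in M. (\<lambda>n. (g x - h n x)\<^sup>2) \<longlonglongrightarrow> 0"
    proof (rule AE_I2)
      fix x assume "x \<in> space M"
      have "(\<lambda>n. (g x - h n x)\<^sup>2) \<longlonglongrightarrow> (g x - g x)\<^sup>2"
        by (intro tendsto_intros lim \<open>x \<in> space M\<close>)
      thus "(\<lambda>n. (g x - h n x)\<^sup>2) \<longlonglongrightarrow> 0" by simp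
    qed
    show "AE x in M. norm ((g x - h n x)\<^sup>2) \<le> 4 * (w x)\<^sup>2" for n
    proof (rule AE_I2)
      fix x assume x: "x \<in> space M"
      have "\<bar>g x - h n x\<bar> \<le> 2 * w x" using w(2)[OF x, of n] g(2)[OF x] by linarith
      hence "\<bar>g x - h n x\<bar>\<^sup>2 \<le> (2 * w x)\<^sup>2" by (intro power_mono) auto
      thus "norm ((g x - h n x)\<^sup>2) \<le> 4 * (w x)\<^sup>2" by (simp add: power_mult_distrib)
    qed
  qed (use g(1) h(2) in measurable)
  hence "\<forall>\<^sub>F n in sequentially. (LINT x|M. (g x - h n x)\<^sup>2) < \<epsilon>"
    using \<epsilon> by (intro order_tendstoD(2)[where y = "LINT x|M. 0"]) auto
  then obtain n where "(LINT x|M. (g x - h n x)\<^sup>2) < \<epsilon>" by (auto simp: eventually_sequentially)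
  thus "\<exists>h. square_integrable M h \<and> approximable M I e h \<and> l2_inner M (\<lambda>x. g x - h x) (\<lambda>x. g x - h x) < \<epsilon>"
    using h(1) bound[OF h(2) w(2)] by (intro exI[of _ "h n"]) (simp add: l2_inner_def power2_eq_square)
qed

text \<open>The sets with approximable indicators contain \<open>E\<close> and are closed under
  complements and disjoint unions, so the pi-lambda theorem gives all measurable sets; the
  complement uses \<open>space M \<in> E\<close>. Simple functions bounded by
  \<open>2 * \<bar>f x\<bar>\<close> then reach \<open>f\<close>.\<close>

lemma approximable_all:
  assumes "finite_measure M" and E: "sets M = sigma_sets (space M) E" "Int_stable E" "E \<subseteq> Pow (space M)" "space M \<in> E"
    and ind: "\<And>X. X \<in> E \<Longrightarrow> approximable M I e (indicator X)"
    and f: "square_integrable M f"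
  shows "approximable M I e f"
proof -
  interpret finite_measure M by fact
  have si: "square_integrable M (indicator X)" if "X \<in> sets M" for X
  proof -
    have "(\<lambda>x. (indicator X x :: real)\<^sup>2) = indicator X" by (auto simp: indicator_def)
    thus ?thesis using that unfolding square_integrable_def
      by (simp add: integrable_real_indicator less_top[symmetric])
  qed
  have sets: "approximable M I e (indicator X)" if "X \<in> sets M" for X
    using E(2,3) that[unfolded E(1)]
  proof (induction rule: sigma_sets_induct_disjoint)
    case (basic X)
    thus ?case by (rule ind)
  next
    case empty
    show ?case using approximable_zero by simp
  next
    case (compl X)
    have "approximable M I e (\<lambda>x. -1 * indicator X x + indicator (space M) x)"
      using compl(1) E(1)
      by (intro approximable_lincomb[OF compl(2) _ ind[OF E(4)]] si) auto
    thus ?case by (rule approximable_cong[rotated]) (auto simp: indicator_def)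
  next
    case (union A)
    have A: "A i \<in> sets M" for i using union(2) E(1) by auto
    have "approximable M I e (\<lambda>x. \<Sum>i<n. 1 * indicator (A i) x)" for n
      using union A by (intro approximable_sum) (auto intro: si)
    hence ap: "approximable M I e (indicator (\<Union>i<n. A i))" for n
      by (rule approximable_cong[rotated])
        (use union(1) in \<open>simp add: indicator_UN_disjoint disjoint_family_on_def\<close>)
    show ?case
    proof (rule approximable_dominated[OF ap])
      show "square_integrable M (\<lambda>x. 1)" by (simp add: square_integrable_def)
      show "(\<lambda>n. indicator (\<Union>i<n. A i) x) \<longlonglongrightarrow> (indicator (\<Union>i. A i) x :: real)" for x
        by (rule LIMSEQ_indicator_UN)
    qed (use A in \<open>auto simp: indicator_def\<close>)
  qed
  have fm: "f \<in> borel_measurable M" using f by (simp add: square_integrable_def)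
  obtain s where "\<forall>i. simple_function M (s i)" "\<forall>x\<in>space M. (\<lambda>i. s i x) \<longlonglongrightarrow> f x"
    "\<forall>i. \<forall>x\<in>space M. dist (s i x) 0 \<le> 2 * dist (f x) 0"
    using borel_measurable_implies_sequence_metric[OF fm, of 0] by blast
  hence s: "\<And>i. simple_function M (s i)" "\<And>x. x \<in> space M \<Longrightarrow> (\<lambda>i. s i x) \<longlonglongrightarrow> f x"
    "\<And>i x. x \<in> space M \<Longrightarrow> \<bar>s i x\<bar> \<le> 2 * \<bar>f x\<bar>"
    by (auto simp: dist_real_def)
  show ?thesis
  proof (rule approximable_dominated[of s "\<lambda>x. 2 * \<bar>f x\<bar>"])
    show "approximable M I e (s n)" for n
    proof (rule approximable_cong)
      show "approximable M I e (\<lambda>x. \<Sum>y\<in>s n ` space M. y * indicator (s n -` {y} \<inter> space M) x)"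
        using simple_functionD(2)[OF s(1)] by (intro approximable_sum) (auto intro!: sets si)
      show "(\<Sum>y\<in>s n ` space M. y * indicator (s n -` {y} \<inter> space M) x) = s n x" if "x \<in> space M" for x
      proof -
        have "s n x = (\<Sum>y\<in>s n ` space M. indicator (s n -` {y} \<inter> space M) x *\<^sub>R y)"
          by (rule simple_function_indicator_representation_banach[OF s(1) that])
        also have "\<dots> = (\<Sum>y\<in>s n ` space M. y * indicator (s n -` {y} \<inter> space M) x)"
          by (intro sum.cong) (auto simp: mult.commute)
        finally show ?thesis by (rule sym)
      qed
    qed
    show "square_integrable M (\<lambda>x. 2 * \<bar>f x\<bar>)"
      using f borel_measurable_abs[OF fm] by (intro square_integrable_cmult) (simp add: square_integrable_def)
    show "s n \<in> borel_measurable M" for n by (rule borel_measurable_simple_function[OF s(1)])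
  qed (use s fm in auto)
qed

end

section \<open>Approximation on the interval\<close>

abbreviation unit_measure :: "real measure" where
  "unit_measure \<equiv> restrict_space lborel {0<..<1}"

lemma space_unit_measure [simp]: "space unit_measure = {0<..<1}"
  by (simp add: space_restrict_space)

lemma finite_measure_unit: "finite_measure unit_measure"
  by (rule finite_measureI) (simp add: emeasure_restrict_space space_restrict_space)

lemma square_integrable_unit:
  assumes "sqint f"
  shows "square_integrable unit_measure f"
proof -
  have "integrable lborel (\<lambda>x. indicator {0<..<1} x *\<^sub>R (f x)\<^sup>2)"
    using assms by (intro integrable_mult_indicator) (auto simp: square_integrable_def)
  moreover have "f \<in> borel_measurable unit_measure"
    using assms by (intro measurable_restrict_space1) (simp add: square_integrable_def)
  ultimately show ?thesis by (simp add: square_integrable_def integrable_restrict_space)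
qed

lemma l2_inner_unit:
  assumes "supp_in 0 1 g"
  shows "l2_inner unit_measure f g = l2ip f g"
proof -
  have "(\<lambda>x. indicator {0<..<1} x *\<^sub>R (f x * g x)) = (\<lambda>x. f x * g x)"
    using assms by (auto simp: supp_in_def indicator_def fun_eq_iff)
  thus ?thesis by (simp add: l2_inner_def integral_restrict_space)
qed

lemma sets_unit_measure:
  "sets unit_measure = sigma_sets {0<..<1} (range (\<lambda>a. {0<..<1} \<inter> {..<a}))"
proof -
  have b: "sets borel = sigma_sets UNIV (range (lessThan :: real \<Rightarrow> real set))"
    by (subst borel_Iio) simp
  have "{0<..<1::real} \<in> sigma_sets UNIV (range lessThan)" unfolding b[symmetric] by simp
  from sigma_sets_Int[OF this] show ?thesis
    by (simp add: sets_restrict_space b image_image)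
qed

text \<open>The index bounds keep every bump inside \<open>[0, 1]\<close> and to the left of
  \<open>a\<close>. The mesh has level \<open>J + 2\<close> because Hermite functions of that level
  are spanned by the scaling functions of level \<open>Suc J\<close>.\<close>

definition step_approx :: "real \<Rightarrow> nat \<Rightarrow> real \<Rightarrow> real" where
  "step_approx a J x = (\<Sum>k | 1 \<le> k \<and> k \<le> 2 ^ (J + 2) - 1 \<and> of_int k < a * 2 ^ (J + 2) - 1.
     xi_gen 1 (2 ^ (J + 2) * x - of_int k))"

lemma finite_step_index: "finite {k::int. 1 \<le> k \<and> k \<le> 2 ^ (J + 2) - 1 \<and> of_int k < a * 2 ^ (J + 2) - (1::real)}"
  by (rule finite_subset[of _ "{1..2 ^ (J + 2) - 1}"]) auto

text \<open>Only the knots \<open>\<lfloor>y\<rfloor>\<close> and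
  \<open>\<lfloor>y\<rfloor> + 1\<close> contribute, and on \<open>[0, 1)\<close> the two bumps add
  up to \<open>1\<close>.\<close>

lemma xi_gen_partition:
  assumes "finite K"
  shows "0 \<le> (\<Sum>k\<in>K. xi_gen 1 (y - of_int k))" "(\<Sum>k\<in>K. xi_gen 1 (y - of_int k)) \<le> 1"
    "\<lfloor>y\<rfloor> \<in> K \<Longrightarrow> \<lfloor>y\<rfloor> + 1 \<in> K \<Longrightarrow> (\<Sum>k\<in>K. xi_gen 1 (y - of_int k)) = 1"
proof -
  have nn: "0 \<le> xi_gen 1 x" for x by (auto simp: xi_gen_def)
  show "0 \<le> (\<Sum>k\<in>K. xi_gen 1 (y - of_int k))" by (intro sum_nonneg nn)
  define m where "m = \<lfloor>y\<rfloor>"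
  define t where "t = y - of_int m"
  have t: "0 \<le> t" "t < 1" unfolding t_def m_def by linarith+
  have z: "xi_gen 1 (y - of_int k) = 0" if "k \<notin> {m, m + 1}" for k
  proof (rule supp_in_outside[OF supp_in_xi_gen])
    have "k \<le> m - 1 \<or> k \<ge> m + 2" using that by auto
    hence "real_of_int k \<le> of_int m - 1 \<or> real_of_int k \<ge> of_int m + 2" by linarith
    thus "y - of_int k \<le> - 1 \<or> 1 \<le> y - of_int k" using t by (auto simp: t_def)
  qed
  have two: "(\<Sum>k\<in>{m, m + 1}. xi_gen 1 (y - of_int k)) = 1"
  proof -
    have "xi_gen 1 t + xi_gen 1 (t - 1) = 1"
      using t by (simp add: xi_gen_def power2_eq_square algebra_simps)
    thus ?thesis by (simp add: t_def algebra_simps)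
  qed
  have "(\<Sum>k\<in>K. xi_gen 1 (y - of_int k)) = (\<Sum>k\<in>K \<inter> {m, m + 1}. xi_gen 1 (y - of_int k))"
    using assms z by (intro sum.mono_neutral_right) auto
  also have "\<dots> \<le> (\<Sum>k\<in>{m, m + 1}. xi_gen 1 (y - of_int k))"
    by (intro sum_mono2 nn) auto
  finally show "(\<Sum>k\<in>K. xi_gen 1 (y - of_int k)) \<le> 1" using two by simp
  assume "\<lfloor>y\<rfloor> \<in> K" "\<lfloor>y\<rfloor> + 1 \<in> K"
  hence "(\<Sum>k\<in>K. xi_gen 1 (y - of_int k)) = (\<Sum>k\<in>{m, m + 1}. xi_gen 1 (y - of_int k))"
    using assms z by (intro sum.mono_neutral_right) (auto simp: m_def)
  thus "(\<Sum>k\<in>K. xi_gen 1 (y - of_int k)) = 1" using two by simp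
qed

lemma step_approx_bounds: "0 \<le> step_approx a J x" "step_approx a J x \<le> 1"
  unfolding step_approx_def by (intro xi_gen_partition finite_step_index)+

lemma step_approx_tendsto:
  assumes x: "0 < x" "x < 1"
  shows "(\<lambda>J. step_approx a J x) \<longlonglongrightarrow> indicator {..<a} x"
proof (rule tendsto_eventually)
  show "\<forall>\<^sub>F J in sequentially. step_approx a J x = indicator {..<a} x"
  proof (cases "x < a")
    case False
    have "step_approx a J x = 0" for J
      unfolding step_approx_def
    proof (rule sum.neutral, clarify)
      fix k :: int assume k: "of_int k < a * 2 ^ (J + 2) - (1::real)"
      have "a * 2 ^ (J + 2) \<le> x * 2 ^ (J + 2)" using False by (intro mult_right_mono) auto
      hence "1 \<le> 2 ^ (J + 2) * x - of_int k" using k by (subst mult.commute) linarith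
      thus "xi_gen 1 (2 ^ (J + 2) * x - of_int k) = 0" by (intro supp_in_outside[OF supp_in_xi_gen]) simp
    qed
    thus ?thesis using False by simp
  next
    case True
    \<comment> \<open>The distance of \<open>x\<close> to \<open>0\<close>, \<open>1\<close> and
      \<open>a\<close>. From \<open>J0\<close> on, \<open>x\<close> is more than two mesh widths
      away from all three, so both neighbouring knots belong to the index set and the value is
      exactly \<open>1\<close>.\<close>
    define c where "c = min x (min (1 - x) (a - x))"
    have c: "c > 0" using x True by (simp add: c_def)
    obtain J0 where J0: "2 / c < 2 ^ J0" using real_arch_pow[of 2 "2 / c"] by auto
    have "step_approx a J x = 1" if "J \<ge> J0" for J
      unfolding step_approx_def
    proof (rule xi_gen_partition(3)[OF finite_step_index])
      define N where "N = (2::real) ^ (J + 2)"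
      have Ni: "N = of_int (2 ^ (J + 2))" by (simp add: N_def)
      have "(2::real) ^ J0 \<le> N" unfolding N_def using that by (intro power_increasing) auto
      hence "2 / c < N" using J0 by linarith
      hence "2 < N * c" using c by (simp add: field_simps)
      moreover have "N * c \<le> N * x" "N * c \<le> N * (1 - x)" "N * c \<le> N * (a - x)"
        by (intro mult_left_mono; simp add: c_def N_def)+
      ultimately have b: "2 < N * x" "N * x < N - 2" "N * x < a * N - 2" by (simp_all add: algebra_simps)
      have fl: "of_int \<lfloor>N * x\<rfloor> \<le> N * x" "N * x < of_int \<lfloor>N * x\<rfloor> + 1" by linarith+
      have "(1::real) \<le> of_int \<lfloor>N * x\<rfloor>" using fl b by linarith
      moreover have "of_int (\<lfloor>N * x\<rfloor> + 1) \<le> N - 1" unfolding of_int_add of_int_1 using fl b by linarith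
      ultimately have "1 \<le> \<lfloor>N * x\<rfloor>" "\<lfloor>N * x\<rfloor> + 1 \<le> 2 ^ (J + 2) - 1"
        unfolding Ni by linarith+
      moreover have "of_int \<lfloor>N * x\<rfloor> < a * N - 1" using fl b by linarith
      moreover have "of_int (\<lfloor>N * x\<rfloor> + 1) < a * N - 1" unfolding of_int_add of_int_1 using fl b by linarith
      ultimately have *: "1 \<le> \<lfloor>N * x\<rfloor>" "\<lfloor>N * x\<rfloor> + 1 \<le> 2 ^ (J + 2) - 1"
        "of_int \<lfloor>N * x\<rfloor> < a * N - 1" "of_int (\<lfloor>N * x\<rfloor> + 1) < a * N - 1" by blast+
      thus "\<lfloor>2 ^ (J + 2) * x\<rfloor> \<in> {k. 1 \<le> k \<and> k \<le> 2 ^ (J + 2) - 1 \<and> of_int k < a * 2 ^ (J + 2) - 1}"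
        "\<lfloor>2 ^ (J + 2) * x\<rfloor> + 1 \<in> {k. 1 \<le> k \<and> k \<le> 2 ^ (J + 2) - 1 \<and> of_int k < a * 2 ^ (J + 2) - 1}"
        using * unfolding N_def mem_Collect_eq by (intro conjI; linarith)+
    qed
    thus ?thesis using True by (auto simp: eventually_sequentially)
  qed
qed

context spline_interval
begin

lemma step_approx_Vint:
  "step_approx a J \<in> fspan (phiI (Suc J) ` {1..6 * 2 ^ Suc J})"
proof -
  have "(\<lambda>x. xi_gen 1 (2 ^ (J + 2) * x - of_int k)) \<in> fspan (phiI (Suc J) ` {1..6 * 2 ^ Suc J})"
    if k: "1 \<le> k" "k \<le> 2 ^ (J + 2) - 1" for k :: int
  proof (rule Vint_in_fspan_phiI)
    let ?f = "\<lambda>x. xi_gen 1 (2 ^ (J + 2) * x - of_int k)"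
    have eq: "?f = (\<lambda>x. (1 / 2 powr (real (J + 2) / 2)) * \<xi> (J + 2) (2 * k) x)"
      by (simp add: xi_even dilate_def)
    have "?f \<in> fspan (range (phiR \<phi> (Suc J)))"
      unfolding eq using xi_1_in_fspan[of "Suc J" "2 * k"] by (intro fspan_cmult) simp
    moreover have s: "supp_in 0 1 ?f"
      unfolding supp_in_def
    proof (intro allI impI)
      fix x assume "?f x \<noteq> 0"
      moreover define N where "N = (2::real) ^ (J + 2)"
      ultimately have *: "-1 < N * x - of_int k" "N * x - of_int k < 1"
        using supp_in_xi_gen[of 1] by (auto simp: supp_in_def)
      have "real_of_int 1 \<le> of_int k" "real_of_int k \<le> of_int (2 ^ (J + 2) - 1)" using k by (simp_all only: of_int_le_iff)
      hence "1 \<le> real_of_int k" "real_of_int k \<le> N - 1" by (simp_all add: N_def)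
      hence "0 < N * x" "N * x < N * 1" using * by linarith+
      moreover have "N > 0" by (simp add: N_def)
      ultimately show "0 < x \<and> x < 1" by (simp add: zero_less_mult_iff)
    qed
    moreover have "?f 0 = 0" "?f 1 = 0" using supp_in_outside[OF s, of 0] supp_in_outside[OF s, of 1] by auto
    ultimately show "?f \<in> Vint (Suc J)" using VintI[of ?f "Suc J"] cut_id[OF s] by simp
  qed
  hence "(\<lambda>x. step_approx a J x) \<in> fspan (phiI (Suc J) ` {1..6 * 2 ^ Suc J})"
    unfolding step_approx_def by (intro fspan_sum) auto
  thus ?thesis by simp
qed

definition step_coeff :: "real \<Rightarrow> nat \<Rightarrow> nat \<times> int \<Rightarrow> real" where
  "step_coeff a J p = l2ip (step_approx a J) (psiI p)"

definition step_sum :: "real \<Rightarrow> nat \<Rightarrow> real \<Rightarrow> real" where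
  "step_sum a J = (\<lambda>x. \<Sum>p\<in>index_upto J. step_coeff a J p * psiI p x)"

lemma index_upto_subset: "index_upto J \<subseteq> index1"
  by (auto simp: index_upto_def)

lemma step_sum_square_integrable: "sqint (step_sum a J)"
  unfolding step_sum_def using index_upto_subset
  by (intro square_integrable_sum square_integrable_cmult psiI_square_integrable) auto

lemma step_approx_square_integrable: "sqint (step_approx a J)"
  using step_approx_Vint by (rule fspan_square_integrable) (auto intro: Vint_square_integrable[OF phiI_in_Vint])

lemma step_approx_supp_in: "supp_in 0 1 (step_approx a J)"
  using step_approx_Vint by (rule fspan_supp_in) (auto intro: Vint_supp_in[OF phiI_in_Vint])

lemma step_sum_supp_in: "supp_in 0 1 (step_sum a J)"
proof -
  have "step_sum a J \<in> fspan (psiI ` index1)"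
    unfolding step_sum_def using index_upto_subset by (intro fspan_sum fspan_cmult fspan_base) auto
  thus ?thesis by (rule fspan_supp_in) (auto intro: psiI_supp_in)
qed

text \<open>\<open>phiI_approximation\<close> holds only up to null functions, so linearity over the
  span is carried through the squared norm by \<open>l2_inner_lincomb_le\<close> rather than
  pointwise.\<close>

lemma step_sum_exact:
  "l2ip (\<lambda>x. step_approx a J x - step_sum a J x) (\<lambda>x. step_approx a J x - step_sum a J x) = 0"
proof -
  define r where "r = (\<lambda>f x. f x - (\<Sum>p\<in>index_upto J. l2ip f (psiI p) * psiI p x))"
  have sp: "sqint (psiI p)" if "p \<in> index_upto J" for p
    using that index_upto_subset by (auto intro: psiI_square_integrable)
  have sr: "sqint (r f)" if "sqint f" for f
    unfolding r_def by (intro square_integrable_diff square_integrable_sum square_integrable_cmult sp that)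
  have sV: "sqint f" if "f \<in> fspan (phiI (Suc J) ` {1..6 * 2 ^ Suc J})" for f
    using that by (rule fspan_square_integrable) (auto intro: Vint_square_integrable[OF phiI_in_Vint])
  have "l2ip (r f) (r f) = 0" if "f \<in> fspan (phiI (Suc J) ` {1..6 * 2 ^ Suc J})" for f
    using that
  proof (induction rule: fspan_induct)
    case zero
    show ?case by (simp add: r_def)
  next
    case (step c g h)
    have g: "sqint g" by (intro sV fspan_base step)
    have h: "sqint h" by (intro sV step)
    obtain n where "g = phiI (Suc J) n" "n \<in> {1..6 * 2 ^ Suc J}" using step(1) by blast
    hence "l2ip (r g) (r g) = 0"
      using phiI_approximation[of n J] unfolding r_def l2_norm_def by simp
    moreover have "r (\<lambda>x. c * g x + h x) = (\<lambda>x. c * r g x + r h x)"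
      using g h sp unfolding r_def
      by (simp add: l2_inner_add_left square_integrable_cmult l2_inner_cmult_left fun_eq_iff algebra_simps
          sum.distrib sum_distrib_left cong: sum.cong)
    ultimately have "l2ip (r (\<lambda>x. c * g x + h x)) (r (\<lambda>x. c * g x + h x)) \<le> 0"
      using l2_inner_lincomb_le[OF sr[OF g] sr[OF h], of c] step(3) by simp
    thus ?case by (intro antisym l2_inner_self_nonneg)
  qed
  from this[OF step_approx_Vint] show ?thesis
    by (simp add: r_def step_sum_def step_coeff_def)
qed

text \<open>A null difference makes the two functions interchangeable in inner products. The fact is
  recorded in this form because inner products multiply over the coordinates.\<close>

lemma step_inner:
  "l2_inner unit_measure (step_approx a J) (step_sum a J) = l2_inner unit_measure (step_approx a J) (step_approx a J)"
  "l2_inner unit_measure (step_sum a J) (step_sum a J) = l2_inner unit_measure (step_approx a J) (step_approx a J)"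
proof -
  note s = step_approx_square_integrable[of a J] step_sum_square_integrable[of a J]
  have z: "l2ip (\<lambda>x. step_approx a J x - step_sum a J x) g = 0" for g
    by (rule l2_inner_null_left[OF square_integrable_diff[OF s] step_sum_exact])
  have "l2ip (step_approx a J) (step_approx a J) = l2ip (step_sum a J) (step_approx a J)"
    "l2ip (step_approx a J) (step_sum a J) = l2ip (step_sum a J) (step_sum a J)"
    using z[of "step_approx a J"] z[of "step_sum a J"] s by (simp_all add: l2_inner_diff_left)
  thus "l2_inner unit_measure (step_approx a J) (step_sum a J) = l2_inner unit_measure (step_approx a J) (step_approx a J)"
    "l2_inner unit_measure (step_sum a J) (step_sum a J) = l2_inner unit_measure (step_approx a J) (step_approx a J)"
    by (simp_all add: l2_inner_unit step_approx_supp_in step_sum_supp_in l2_inner_commute)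
qed

end

section \<open>Tensor products\<close>

interpretation unit_product: product_sigma_finite "\<lambda>_::nat. unit_measure"
  using finite_measure.axioms(1)[OF finite_measure_unit] by (simp add: product_sigma_finite_def finite_measure_def)

lemma space_cube_measure: "space (cube_measure d) = cube d"
  by (simp add: cube_measure_def cube_def space_PiM)

lemma finite_measure_cube: "finite_measure (cube_measure d)"
proof (rule finite_measureI)
  have "emeasure (cube_measure d) (\<Pi>\<^sub>E i\<in>{1..d}. {0<..<1}) = (\<Prod>i=1..d. emeasure unit_measure {0<..<1})"
    unfolding cube_measure_def by (intro unit_product.emeasure_PiM) (auto simp: sets_restrict_space intro!: image_eqI[of _ _ "{0<..<1}"])
  also have "\<dots> \<noteq> \<infinity>" by (simp add: emeasure_restrict_space)
  finally show "emeasure (cube_measure d) (space (cube_measure d)) \<noteq> \<infinity>"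
    by (simp add: space_cube_measure cube_def)
qed

lemma square_integrable_tensor:
  assumes "\<And>i. i \<in> {1..d} \<Longrightarrow> square_integrable unit_measure (f i)"
  shows "square_integrable (cube_measure d) (\<lambda>x. \<Prod>i=1..d. f i (x i))"
  unfolding square_integrable_def cube_measure_def
proof
  show "(\<lambda>x. \<Prod>i=1..d. f i (x i)) \<in> borel_measurable (Pi\<^sub>M {1..d} (\<lambda>_. unit_measure))"
  proof (rule borel_measurable_prod)
    fix i assume i: "i \<in> {1..d}"
    have "f i \<in> borel_measurable unit_measure" using assms[OF i] by (simp add: square_integrable_def)
    from measurable_compose[OF measurable_component_singleton[OF i] this]
    show "(\<lambda>x. f i (x i)) \<in> borel_measurable (Pi\<^sub>M {1..d} (\<lambda>_. unit_measure))" .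
  qed
  have "integrable (Pi\<^sub>M {1..d} (\<lambda>_. unit_measure)) (\<lambda>x. \<Prod>i=1..d. (f i (x i))\<^sup>2)"
    using assms by (intro unit_product.product_integrable_prod) (auto simp: square_integrable_def)
  thus "integrable (Pi\<^sub>M {1..d} (\<lambda>_. unit_measure)) (\<lambda>x. (\<Prod>i=1..d. f i (x i))\<^sup>2)"
    by (simp add: prod_power_distrib)
qed

lemma l2_inner_tensor:
  assumes "\<And>i. i \<in> {1..d} \<Longrightarrow> integrable unit_measure (\<lambda>x. f i x * g i x)"
  shows "l2_inner (cube_measure d) (\<lambda>x. \<Prod>i=1..d. f i (x i)) (\<lambda>x. \<Prod>i=1..d. g i (x i)) =
    (\<Prod>i=1..d. l2_inner unit_measure (f i) (g i))"
  using unit_product.product_integral_prod[of "{1..d}" "\<lambda>i x. f i x * g i x"] assms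
  by (simp add: l2_inner_def cube_measure_def prod.distrib)

text \<open>Boxes bounded from above are chosen as generators since they are closed under
  intersection, by taking minima, and their indicators are products of the limits of
  \<open>step_approx\<close>.\<close>

lemma sets_cube_measure:
  "sets (cube_measure d) = sigma_sets (cube d) (range (\<lambda>a. {x \<in> cube d. \<forall>i\<in>{1..d}. x i < a i}))"
proof -
  let ?E = "range (\<lambda>a. {0<..<1} \<inter> {..<a}) :: real set set"
  let ?P = "{{f \<in> \<Pi>\<^sub>E i\<in>{1..d}. {0<..<1}. \<forall>i\<in>j. f i \<in> A i} |A j. j \<in> {{1..d}} \<and> A \<in> Pi j (\<lambda>_. ?E)}"
  have E: "?E \<subseteq> Pow {0<..<1}" by auto
  have "sets (cube_measure d) = sets (Pi\<^sub>M {1..d} (\<lambda>_. sigma {0<..<1} ?E))"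
    unfolding cube_measure_def by (intro sets_PiM_cong) (simp_all only: sets_unit_measure sets_measure_of[OF E])
  also have "\<dots> = sets (sigma (\<Pi>\<^sub>E i\<in>{1..d}. {0<..<1}) ?P)"
  proof (rule sets_PiM_sigma)
    \<comment> \<open>The covering of each factor by countably many generators; the bound
      \<open>2\<close> already gives the whole interval.\<close>
    have "{0<..<1} = \<Union>{{0<..<1} \<inter> {..<2::real}}" by auto
    thus "\<exists>S\<subseteq>?E. countable S \<and> {0<..<1} = \<Union>S" by (intro exI[of _ "{{0<..<1} \<inter> {..<2}}"]) auto
  qed auto
  also have "\<dots> = sigma_sets (cube d) ?P"
    unfolding cube_def by (intro sets_measure_of) auto
  also have "?P = range (\<lambda>a. {x \<in> cube d. \<forall>i\<in>{1..d}. x i < a i})"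
  proof (intro equalityI subsetI)
    fix X assume "X \<in> ?P"
    then obtain A where A: "A \<in> {1..d} \<rightarrow> ?E" "X = {f \<in> \<Pi>\<^sub>E i\<in>{1..d}. {0<..<1}. \<forall>i\<in>{1..d}. f i \<in> A i}" by blast
    have "\<forall>i\<in>{1..d}. \<exists>a. A i = {0<..<1} \<inter> {..<a}"
    proof
      fix i assume "i \<in> {1..d}"
      from funcset_mem[OF A(1) this] show "\<exists>a. A i = {0<..<1} \<inter> {..<a}" by blast
    qed
    from bchoice[OF this] obtain a where a: "\<forall>i\<in>{1..d}. A i = {0<..<1} \<inter> {..<a i}" by blast
    have "X = {x \<in> cube d. \<forall>i\<in>{1..d}. x i < a i}"
      unfolding A(2) cube_def using a by (auto simp: PiE_iff)
    thus "X \<in> range (\<lambda>a. {x \<in> cube d. \<forall>i\<in>{1..d}. x i < a i})" by blast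
  next
    fix X assume "X \<in> range (\<lambda>a. {x \<in> cube d. \<forall>i\<in>{1..d}. x i < a i})"
    then obtain a where "X = {x \<in> cube d. \<forall>i\<in>{1..d}. x i < a i}" by blast
    hence "X = {f \<in> \<Pi>\<^sub>E i\<in>{1..d}. {0<..<1}. \<forall>i\<in>{1..d}. f i \<in> {0<..<1} \<inter> {..<a i}}"
      by (auto simp: cube_def PiE_iff)
    thus "X \<in> ?P" by (intro CollectI exI[of _ "\<lambda>i. {0<..<1} \<inter> {..<a i}"] exI[of _ "{1..d}"]) auto
  qed
  finally show ?thesis .
qed

context spline_interval
begin

abbreviation psiT :: "nat \<Rightarrow> (nat \<Rightarrow> nat \<times> int) \<Rightarrow> (nat \<Rightarrow> real) \<Rightarrow> real" where
  "psiT \<equiv> psi_tensor \<phi> \<psi> \<psi>L \<psi>R"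

lemma psiI_unit: "p \<in> index1 \<Longrightarrow> square_integrable unit_measure (psiI p)"
  by (intro square_integrable_unit psiI_square_integrable)

lemma tensor_index_component: "l \<in> tensor_index d \<Longrightarrow> i \<in> {1..d} \<Longrightarrow> l i \<in> index1"
  by (auto simp: tensor_index_def)

lemma psiT_square_integrable: "l \<in> tensor_index d \<Longrightarrow> square_integrable (cube_measure d) (psiT d l)"
  unfolding psi_tensor_def by (intro square_integrable_tensor psiI_unit tensor_index_component)

lemma psiT_inner:
  assumes "l \<in> tensor_index d" "l' \<in> tensor_index d"
  shows "l2_inner (cube_measure d) (psiT d l) (psiT d l') = (if l = l' then 1 else 0)"
proof -
  note c = tensor_index_component[OF assms(1)] tensor_index_component[OF assms(2)]
  have "l2_inner (cube_measure d) (psiT d l) (psiT d l') = (\<Prod>i=1..d. l2_inner unit_measure (psiI (l i)) (psiI (l' i)))"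
    unfolding psi_tensor_def by (intro l2_inner_tensor square_integrable_mult psiI_unit c)
  also have "\<dots> = (\<Prod>i=1..d. if l i = l' i then 1 else 0)"
    using c by (intro prod.cong) (simp_all add: l2_inner_unit psiI_supp_in psiI_orthonormal)
  also have "\<dots> = (if l = l' then 1 else 0)"
  proof (cases "l = l'")
    case False
    then obtain i where "i \<in> {1..d}" "l i \<noteq> l' i"
      using assms unfolding tensor_index_def by (meson PiE_ext)
    thus ?thesis using False by (auto intro!: prod_zero)
  qed simp
  finally show ?thesis .
qed

text \<open>A product of finite sums expands into finitely many \<open>psiT\<close>. Its distance to
  the product of the \<open>step_approx\<close> is zero, as the three inner products in the expanded
  square coincide factor by factor.\<close>

lemma step_tensor_approximable:
  "approximable (cube_measure d) (tensor_index d) (psiT d) (\<lambda>x. \<Prod>i=1..d. step_approx (a i) J (x i))"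
proof -
  let ?M = "cube_measure d"
  define F where "F = {1..d} \<rightarrow>\<^sub>E index_upto J"
  define c where "c = (\<lambda>l. \<Prod>i=1..d. step_coeff (a i) J (l i))"
  define f where "f = (\<lambda>x::nat \<Rightarrow> real. \<Prod>i=1..d. step_approx (a i) J (x i))"
  define g where "g = (\<lambda>x::nat \<Rightarrow> real. \<Prod>i=1..d. step_sum (a i) J (x i))"
  have fin: "finite (index_upto J)" using card_index_upto by blast
  have F: "finite F" "F \<subseteq> tensor_index d"
    using index_upto_subset fin unfolding F_def tensor_index_def by (auto intro!: finite_PiE)
  have g: "g = (\<lambda>x. \<Sum>l\<in>F. c l * psiT d l x)"
    unfolding g_def step_sum_def F_def c_def psi_tensor_def
    by (subst prod_sum_PiE) (simp_all add: fin prod.distrib)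
  note s = square_integrable_unit[OF step_approx_square_integrable] square_integrable_unit[OF step_sum_square_integrable]
  have sf: "square_integrable ?M f" and sg: "square_integrable ?M g"
    unfolding f_def g_def by (intro square_integrable_tensor s)+
  have "l2_inner ?M f g = l2_inner ?M f f" "l2_inner ?M g g = l2_inner ?M f f"
    unfolding f_def g_def by (subst (1 2) l2_inner_tensor; simp add: square_integrable_mult s step_inner)+
  hence "l2_inner ?M (\<lambda>x. f x - g x) (\<lambda>x. f x - g x) = 0"
    using sf sg by (simp add: l2_inner_diff_left l2_inner_diff_right square_integrable_diff l2_inner_commute[of ?M g f])
  thus ?thesis unfolding approximable_def f_def[symmetric] using F unfolding g
    by (intro allI impI exI[of _ F] exI[of _ c]) simp
qed

lemma psiT_approximable:
  assumes "square_integrable (cube_measure d) f"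
  shows "approximable (cube_measure d) (tensor_index d) (psiT d) f"
proof -
  let ?M = "cube_measure d"
  let ?box = "\<lambda>a. {x \<in> cube d. \<forall>i\<in>{1..d}. x i < a i}"
  interpret finite_measure ?M by (rule finite_measure_cube)
  show ?thesis
  proof (rule approximable_all[OF psiT_square_integrable finite_measure_cube, where E = "range ?box"])
    show "sets ?M = sigma_sets (space ?M) (range ?box)" by (simp add: sets_cube_measure space_cube_measure)
    show "Int_stable (range ?box)"
    proof (rule Int_stableI)
      fix X Y assume "X \<in> range ?box" "Y \<in> range ?box"
      then obtain a b where "X = ?box a" "Y = ?box b" by blast
      hence "X \<inter> Y = ?box (\<lambda>i. min (a i) (b i))" by auto
      thus "X \<inter> Y \<in> range ?box" by (rule range_eqI[where x = "\<lambda>i. min (a i) (b i)"])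
    qed
    show "range ?box \<subseteq> Pow (space ?M)" by (auto simp: space_cube_measure)
    have "space ?M = ?box (\<lambda>_. 1)" by (auto simp: space_cube_measure cube_def)
    thus "space ?M \<in> range ?box" by (rule range_eqI[where x = "\<lambda>_. 1"])
    show "square_integrable ?M f" by fact
    fix X assume X: "X \<in> range ?box"
    then obtain a where a: "X = ?box a" by blast
    show "approximable ?M (tensor_index d) (psiT d) (indicator X)"
    proof (rule approximable_dominated[OF psiT_square_integrable step_tensor_approximable[where a = a]])
      show "square_integrable ?M (\<lambda>x. 1)" by (simp add: square_integrable_def)
      have "square_integrable ?M (\<lambda>x. \<Prod>i=1..d. step_approx (a i) n (x i))" for n
        by (intro square_integrable_tensor square_integrable_unit step_approx_square_integrable)
      thus "(\<lambda>x. \<Prod>i=1..d. step_approx (a i) n (x i)) \<in> borel_measurable ?M" for n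
        by (simp add: square_integrable_def)
      show "\<bar>\<Prod>i=1..d. step_approx (a i) n (x i)\<bar> \<le> 1" for n x
        by (auto simp: abs_prod step_approx_bounds intro!: prod_le_1)
      have "X \<in> sets ?M" unfolding sets_cube_measure using X by (intro sigma_sets.Basic)
      thus "indicator X \<in> borel_measurable ?M" by simp
      show "\<bar>indicator X x\<bar> \<le> (1::real)" for x by (simp add: indicator_def)
      fix x assume x: "x \<in> space ?M"
      have "(\<lambda>n. \<Prod>i=1..d. step_approx (a i) n (x i)) \<longlonglongrightarrow> (\<Prod>i=1..d. indicator {..<a i} (x i))"
        using x by (intro tendsto_prod step_approx_tendsto) (auto simp: space_cube_measure cube_def)
      also have "(\<Prod>i=1..d. indicator {..<a i} (x i)) = (indicator X x :: real)"
        using x unfolding a by (auto simp: indicator_def space_cube_measure intro: prod_zero)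
      finally show "(\<lambda>n. \<Prod>i=1..d. step_approx (a i) n (x i)) \<longlonglongrightarrow> indicator X x" .
    qed
  qed
qed

lemma orthogonal_basis_psiT: "orthogonal_basis (cube_measure d) (tensor_index d) (psiT d)"
  unfolding orthogonal_basis_def
proof (intro conjI ballI allI impI)
  fix l assume l: "l \<in> tensor_index d"
  show "square_integrable (cube_measure d) (psiT d l)" by (rule psiT_square_integrable[OF l])
  show "l2_norm (cube_measure d) (psiT d l) \<noteq> 0" using psiT_inner[OF l l] by (simp add: l2_norm_def)
  show "l2_inner (cube_measure d) (psiT d l) (psiT d l') = 0" if "l' \<in> tensor_index d" "l \<noteq> l'" for l'
    using psiT_inner[OF l that(1)] that(2) by simp
next
  fix f and \<epsilon> :: real assume f: "square_integrable (cube_measure d) f" and \<epsilon>: "\<epsilon> > 0"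
  obtain F c where F: "finite F" "F \<subseteq> tensor_index d"
    "l2_inner (cube_measure d) (\<lambda>x. f x - (\<Sum>i\<in>F. c i * psiT d i x)) (\<lambda>x. f x - (\<Sum>i\<in>F. c i * psiT d i x)) < \<epsilon>\<^sup>2"
    using psiT_approximable[OF f] \<epsilon> unfolding approximable_def by (meson zero_less_power)
  hence "l2_norm (cube_measure d) (\<lambda>x. f x - (\<Sum>i\<in>F. c i * psiT d i x)) < \<epsilon>"
    unfolding l2_norm_def using \<epsilon> by (intro real_less_lsqrt) auto
  thus "\<exists>F c. finite F \<and> F \<subseteq> tensor_index d \<and> l2_norm (cube_measure d) (\<lambda>x. f x - (\<Sum>i\<in>F. c i * psiT d i x)) < \<epsilon>"
    using F by blast
qed

end

section \<open>Splines, vanishing moments and supports\<close>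

lemma C1_spline_cubic_spline:
  assumes "C1_spline N g" "\<And>x. 0 \<le> x \<Longrightarrow> x \<le> 1 \<Longrightarrow> s x = g x"
  shows "cubic_spline s"
proof -
  define t where "t = map (\<lambda>m. real m / 2 ^ N) [0..<Suc (2 ^ N)]"
  have len: "length t = Suc (2 ^ N)" by (simp add: t_def)
  have nth: "t ! m = real m / 2 ^ N" if "m \<le> 2 ^ N" for m
    using that nth_map[of m "[0..<Suc (2 ^ N)]" "\<lambda>m. real m / 2 ^ N"] by (simp add: t_def del: upt_Suc)
  have ne: "t \<noteq> []" using len by auto
  have "hd t = 0" "last t = 1" using nth[of 0] nth[of "2 ^ N"] len ne by (simp_all add: hd_conv_nth last_conv_nth)
  moreover have "sorted_wrt (<) t"
    unfolding sorted_wrt_iff_nth_less len by (auto simp: nth divide_strict_right_mono)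
  moreover have "\<exists>p. degree p \<le> 3 \<and> (\<forall>x\<in>{t ! m..t ! Suc m}. s x = poly p x)" if m: "Suc m < length t" for m
  proof -
    have tm: "t ! m = of_int (int m) / 2 ^ N" "t ! Suc m = of_int (int m + 1) / 2 ^ N"
      using m by (simp_all add: len nth)
    obtain p where p: "degree p \<le> 3" "\<forall>x\<in>{of_int (int m) / 2 ^ N..of_int (int m + 1) / 2 ^ N}. g x = poly p x"
      using assms(1) unfolding C1_spline_def by blast
    have "real (Suc m) \<le> real (2 ^ N)" using m unfolding len by (intro of_nat_mono) simp
    hence "t ! Suc m \<le> 1" using nth[of "Suc m"] m by (simp add: len)
    moreover have "0 \<le> t ! m" by (simp add: tm)
    ultimately have "s x = g x" if "x \<in> {t ! m..t ! Suc m}" for x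
      using that by (intro assms(2)) auto
    hence "s x = poly p x" if "x \<in> {t ! m..t ! Suc m}" for x
      using that p(2) unfolding tm by simp
    thus ?thesis using p(1) by blast
  qed
  ultimately show ?thesis using ne unfolding cubic_spline_def by blast
qed

lemma square_integrable_monomial: "square_integrable unit_measure (\<lambda>x. x ^ n)"
proof -
  interpret finite_measure unit_measure by (rule finite_measure_unit)
  have m: "(\<lambda>x. x ^ n :: real) \<in> borel_measurable unit_measure" by (intro measurable_restrict_space1) simp
  have "integrable unit_measure (\<lambda>x. (x ^ n)\<^sup>2)"
  proof (rule integrable_const_bound[of _ 1])
    show "AE x in unit_measure. norm ((x ^ n)\<^sup>2) \<le> 1"
      by (rule AE_I2) (auto simp: abs_power2 power_le_one)
    show "(\<lambda>x. (x ^ n)\<^sup>2) \<in> borel_measurable unit_measure" using m by (rule borel_measurable_power)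
  qed
  thus ?thesis using m by (simp add: square_integrable_def)
qed

context spline_interval
begin

lemma psiI_C1_spline:
  assumes "p \<in> index1"
  obtains N g where "C1_spline N g" "\<And>x. 0 \<le> x \<Longrightarrow> x \<le> 1 \<Longrightarrow> psiI p x = g x"
proof -
  have "psiI p \<in> Vint (Suc (fst p))" using assms by (cases p) (auto intro: psiI_level)
  thus ?thesis using Vint_C1_spline that by blast
qed

lemma psiT_tensor_cubic_spline:
  assumes "l \<in> tensor_index d"
  shows "tensor_cubic_spline d (psiT d l)"
  unfolding tensor_cubic_spline_def
proof (intro exI[of _ "\<lambda>i. psiI (l i)"] conjI ballI)
  fix i assume "i \<in> {1..d}"
  then obtain N g where "C1_spline N g" "\<And>x. 0 \<le> x \<Longrightarrow> x \<le> 1 \<Longrightarrow> psiI (l i) x = g x"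
    using psiI_C1_spline[OF tensor_index_component[OF assms]] by blast
  thus "cubic_spline (psiI (l i))" by (rule C1_spline_cubic_spline)
qed (simp add: psi_tensor_def)

text \<open>The cut functions need not be differentiable at \<open>0\<close> and \<open>1\<close>,
  so they are replaced by the uncut splines \<open>g\<close>, which agree with them on
  \<open>[0, 1]\<close>. A partial derivative then acts on a single factor of the product.\<close>

lemma psiT_C1_on_cube:
  assumes "l \<in> tensor_index d"
  shows "C1_on_cube d (psiT d l)"
proof -
  have "\<exists>g g'. (\<forall>x. 0 \<le> x \<longrightarrow> x \<le> 1 \<longrightarrow> psiI (l i) x = g x) \<and> continuous_on UNIV g' \<and>
      (\<forall>x. (g has_real_derivative g' x) (at x)) \<and> continuous_on UNIV g" if "i \<in> {1..d}" for i
    using psiI_C1_spline[OF tensor_index_component[OF assms that]] C1_spline_continuous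
    unfolding C1_spline_def C1_fun_def by metis
  then obtain g g' where eq: "\<And>i x. i \<in> {1..d} \<Longrightarrow> 0 \<le> x \<Longrightarrow> x \<le> 1 \<Longrightarrow> psiI (l i) x = g i x"
    and g': "\<And>i. i \<in> {1..d} \<Longrightarrow> continuous_on UNIV (g' i)"
    and g: "\<And>i. i \<in> {1..d} \<Longrightarrow> continuous_on UNIV (g i)"
    and D: "\<And>i x. i \<in> {1..d} \<Longrightarrow> (g i has_real_derivative g' i x) (at x)" by metis
  have cont: "continuous_on (cube d) (\<lambda>x. f (x i))" if "continuous_on UNIV f" for f :: "real \<Rightarrow> real" and i :: nat
    by (rule continuous_on_compose2[OF that continuous_on_subset[OF continuous_on_product_coordinates]]) auto
  have T: "psiT d l x = (\<Prod>i=1..d. g i (x i))" if "x \<in> cube d" for x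
    unfolding psi_tensor_def using that by (intro prod.cong) (auto simp: eq cube_def PiE_iff less_imp_le)
  define f' where "f' = (\<lambda>i x. (\<Prod>k\<in>{1..d} - {i}. g k (x k)) * g' i (x i))"
  have "continuous_on (cube d) (\<lambda>x. \<Prod>i=1..d. g i (x i))" by (intro continuous_on_prod cont g)
  hence "continuous_on (cube d) (psiT d l)" using T by (simp cong: continuous_on_cong)
  moreover have "continuous_on (cube d) (f' i)" if "i \<in> {1..d}" for i
    unfolding f'_def using that by (intro continuous_on_mult continuous_on_prod cont g g') auto
  moreover have "((\<lambda>t. psiT d l (x(i := t))) has_real_derivative f' i x) (at (x i))"
    if i: "i \<in> {1..d}" and x: "x \<in> cube d" for i x
  proof -
    have "((\<lambda>t. (\<Prod>k\<in>{1..d} - {i}. g k (x k)) * g i t) has_real_derivative f' i x) (at (x i))"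
      unfolding f'_def by (intro DERIV_cmult D i)
    \<comment> \<open>The two-sided derivative only sees a neighbourhood of \<open>x i\<close>,
      which may be taken inside the open unit interval.\<close>
    moreover have "\<forall>\<^sub>F t in nhds (x i). psiT d l (x(i := t)) = (\<Prod>k\<in>{1..d} - {i}. g k (x k)) * g i t"
    proof (rule eventually_mono[OF eventually_nhds_in_open[of "{0<..<1}"]])
      show "x i \<in> {0<..<1}" using i x by (auto simp: cube_def PiE_iff)
      fix t :: real assume "t \<in> {0<..<1}"
      hence "x(i := t) \<in> cube d" using i x by (auto simp: cube_def PiE_iff extensional_def)
      hence "psiT d l (x(i := t)) = (\<Prod>k=1..d. g k ((x(i := t)) k))" by (rule T)
      also have "\<dots> = g i t * (\<Prod>k\<in>{1..d} - {i}. g k ((x(i := t)) k))" using i by (subst prod.remove[of _ i]) auto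
      also have "(\<Prod>k\<in>{1..d} - {i}. g k ((x(i := t)) k)) = (\<Prod>k\<in>{1..d} - {i}. g k (x k))" by (intro prod.cong) auto
      finally show "psiT d l (x(i := t)) = (\<Prod>k\<in>{1..d} - {i}. g k (x k)) * g i t"
        by (simp only: mult.commute)
    qed simp
    ultimately show ?thesis by (subst DERIV_cong_ev[OF refl _ refl])
  qed
  ultimately show ?thesis unfolding C1_on_cube_def by blast
qed

lemma psiI_inner_moments:
  assumes "p \<in> index1" "3 \<le> snd p" "snd p \<le> 6 * 2 ^ fst p - 2" "a < 4"
  shows "l2_inner unit_measure (\<lambda>x. x ^ a) (psiI p) = 0"
proof -
  obtain j k where p: "p = (j, k)" by (cases p)
  obtain n m where m: "m \<in> {1..6}" "k - 2 = 6 * n + int m" by (rule index6_cases)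
  have "psiI p = psiR \<psi> j (k - 2)" using assms by (simp add: p psi1_def)
  also have "\<dots> = dilate j (if m \<le> 2 then n else n + 1) (\<psi> m)" unfolding m(2) by (rule psiR_eq[OF m(1)])
  moreover have "degree (monom (1::real) a) \<le> 3" using assms(4) by (simp add: degree_monom_eq)
  moreover have "(\<lambda>x. x ^ a) = poly (monom (1::real) a)" by (simp add: fun_eq_iff poly_monom)
  ultimately have "l2ip (\<lambda>x. x ^ a) (psiI p) = 0"
    using dilate_psi_vanishing_moments[OF m(1)] by simp
  thus ?thesis using l2_inner_unit[OF psiI_supp_in[OF assms(1)]] by simp
qed

lemma psiT_vanishing_moments:
  assumes d: "d \<ge> 1" and l: "l \<in> tensor_index d" and p: "p \<in> polys_deg_less d 4"
    and inner: "\<And>i. i \<in> {1..d} \<Longrightarrow> 3 \<le> snd (l i) \<and> snd (l i) \<le> 6 * 2 ^ fst (l i) - 2"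
  shows "l2_inner (cube_measure d) p (psiT d l) = 0"
proof -
  let ?A = "{\<alpha>. \<alpha> \<in> {1..d} \<rightarrow>\<^sub>E UNIV \<and> (\<Sum>i=1..d. \<alpha> i) < (4::nat)}"
  obtain c where c: "p = (\<lambda>x. \<Sum>\<alpha>\<in>?A. c \<alpha> * (\<Prod>i=1..d. x i ^ \<alpha> i))"
    using p unfolding polys_deg_less_def by blast
  have "l2_inner (cube_measure d) p (psiT d l) =
      (\<Sum>\<alpha>\<in>?A. c \<alpha> * l2_inner (cube_measure d) (\<lambda>x. \<Prod>i=1..d. x i ^ \<alpha> i) (psiT d l))"
    unfolding c
    by (intro l2_inner_scaled_sum_left square_integrable_tensor square_integrable_monomial psiT_square_integrable[OF l])
  also have "\<dots> = 0"
  proof (rule sum.neutral, rule ballI)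
    fix \<alpha> assume \<alpha>: "\<alpha> \<in> ?A"
    \<comment> \<open>One vanishing factor suffices. Coordinate \<open>1\<close> exists because
      \<open>d \<ge> 1\<close>, and its exponent is at most the total degree.\<close>
    have 1: "1 \<in> {1..d}" using d by simp
    have "\<alpha> 1 \<le> (\<Sum>i=1..d. \<alpha> i)" by (rule member_le_sum[OF 1]) auto
    hence "l2_inner unit_measure (\<lambda>x. x ^ \<alpha> 1) (psiI (l 1)) = 0"
      using \<alpha> inner[OF 1] tensor_index_component[OF l 1] by (intro psiI_inner_moments) auto
    moreover have "l2_inner (cube_measure d) (\<lambda>x. \<Prod>i=1..d. x i ^ \<alpha> i) (psiT d l) =
        (\<Prod>i=1..d. l2_inner unit_measure (\<lambda>x. x ^ \<alpha> i) (psiI (l i)))"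
      unfolding psi_tensor_def
      by (intro l2_inner_tensor square_integrable_mult square_integrable_monomial psiI_unit tensor_index_component[OF l])
    ultimately show "c \<alpha> * l2_inner (cube_measure d) (\<lambda>x. \<Prod>i=1..d. x i ^ \<alpha> i) (psiT d l) = 0"
      using 1 prod_zero[of "{1..d}" "\<lambda>i. l2_inner unit_measure (\<lambda>x. x ^ \<alpha> i) (psiI (l i))"] by auto
  qed
  finally show ?thesis .
qed

text \<open>The \<open>2\<close> is the length of \<open>(-1, 1)\<close>, which contains the
  supports of all generators; cutting only shrinks a support. The scaling functions have level
  \<open>0\<close> and live in \<open>(0, 1)\<close>.\<close>

lemma psiI_small_support:
  assumes "p \<in> index1"
  obtains a where "supp_in a (a + 2 / 2 ^ fst p) (psiI p)"
proof -
  obtain j k where p: "p = (j, k)" by (cases p)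
  have cut: "supp_in a b (cut f)" if "supp_in a b f" for a b f
    using that by (auto simp: supp_in_def cut_def)
  have w: "- 1 / 2 ^ j + 2 / 2 ^ j = 1 / (2 ^ j :: real)" "1 - 1 / 2 ^ j + 2 / 2 ^ j = 1 + 1 / (2 ^ j :: real)"
    by (simp_all add: field_simps)
  have "\<exists>a. supp_in a (a + 2 / 2 ^ j) (psiI (j, k))"
    using index1_cases[OF assms[unfolded p]]
  proof
    assume "j = 0 \<and> k \<in> {-5..0}"
    moreover have "supp_in 0 2 (psiI p)" by (rule supp_in_mono[OF psiI_supp_in[OF assms]]) auto
    ultimately show ?thesis using p by (intro exI[of _ 0]) simp
  next
    assume "k \<in> {1..6 * 2 ^ j}"
    thus ?thesis
    proof (cases rule: psiI_cases)
      case (left g)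
      thus ?thesis using cut[OF supp_in_left[OF psi_36(1)[OF left(2)], of j]] w(1) by metis
    next
      case (right g)
      thus ?thesis using cut[OF supp_in_right[OF psi_36(1)[OF right(2)], of j]] w(2) by metis
    next
      case inner
      obtain n m where m: "m \<in> {1..6}" "k - 2 = 6 * n + int m" by (rule index6_cases)
      let ?c = "if m \<le> 2 then n else n + 1"
      have "supp_in ((-1 + of_int ?c) / 2 ^ j) ((1 + of_int ?c) / 2 ^ j) (psiI (j, k))"
        unfolding inner(3) m(2) psiR_eq[OF m(1)] by (intro supp_in_dilate two_cells_supp_in psi_two_cells m)
      moreover have "(1 + of_int ?c) / 2 ^ j = (-1 + of_int ?c) / 2 ^ j + 2 / (2 ^ j :: real)"
        by (simp flip: add_divide_distrib)
      ultimately show ?thesis by metis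
    qed
  qed
  thus ?thesis using that p by auto
qed

text \<open>The support lies in a closed box with all sides equal to the longest one, that of the
  coordinate of lowest level. Its diagonal is the side times \<open>sqrt d\<close>.\<close>

lemma psiT_diam:
  assumes d: "d \<ge> 1" and l: "l \<in> tensor_index d"
  shows "euclidean_diam d (supp d (psiT d l)) \<le> 2 * sqrt (real d) * 2 powr (- real (min_level d l))"
proof -
  define r where "r = 2 * 2 powr (- real (min_level d l))"
  have r: "r \<ge> 0" by (simp add: r_def)
  have "\<exists>a. supp_in a (a + r) (psiI (l i))" if i: "i \<in> {1..d}" for i
  proof -
    obtain a where a: "supp_in a (a + 2 / 2 ^ fst (l i)) (psiI (l i))"
      using psiI_small_support[OF tensor_index_component[OF l i]] .
    have "min_level d l \<le> fst (l i)" unfolding min_level_def using i by (intro Min_le) auto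
    hence "(2::real) ^ min_level d l \<le> 2 ^ fst (l i)" by (intro power_increasing) auto
    hence "2 / 2 ^ fst (l i) \<le> r" by (simp add: r_def powr_minus powr_realpow field_simps)
    thus ?thesis using supp_in_mono[OF a, of a "a + r"] by auto
  qed
  then obtain a where a: "\<And>i. i \<in> {1..d} \<Longrightarrow> supp_in (a i) (a i + r) (psiI (l i))" by metis
  define B where "B = {x :: nat \<Rightarrow> real. \<forall>i\<in>{1..d}. a i \<le> x i \<and> x i \<le> a i + r}"
  \<comment> \<open>\<open>supp\<close> takes the closure among all functions on the naturals;
    \<open>B\<close> only restricts the coordinates \<open>1..d\<close> and is an intersection of
    closed half-spaces there.\<close>
  have "closed B"
  proof -
    have "B = (\<Inter>i\<in>{1..d}. {x. a i \<le> x i} \<inter> {x. x i \<le> a i + r})" by (auto simp: B_def)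
    thus ?thesis by (simp add: closed_INT closed_Int closed_Collect_le)
  qed
  moreover have "{x \<in> cube d. psiT d l x \<noteq> 0} \<subseteq> B"
  proof
    fix x assume "x \<in> {x \<in> cube d. psiT d l x \<noteq> 0}"
    hence "psiI (l i) (x i) \<noteq> 0" if "i \<in> {1..d}" for i using that by (auto simp: psi_tensor_def)
    thus "x \<in> B" using a unfolding B_def supp_in_def by (auto intro: less_imp_le)
  qed
  ultimately have sub: "supp d (psiT d l) \<subseteq> B" unfolding supp_def by (intro closure_minimal)
  have bound: "L2_set (\<lambda>i. x i - y i) {1..d} \<le> sqrt (real d) * r" if "x \<in> B" "y \<in> B" for x y
  proof -
    have "(x i - y i)\<^sup>2 \<le> r\<^sup>2" if "i \<in> {1..d}" for i
    proof -
      have "a i \<le> x i" "x i \<le> a i + r" "a i \<le> y i" "y i \<le> a i + r"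
        using \<open>x \<in> B\<close> \<open>y \<in> B\<close> that by (auto simp: B_def)
      hence "\<bar>x i - y i\<bar> \<le> \<bar>r\<bar>" by linarith
      thus ?thesis by (simp add: abs_le_square_iff)
    qed
    hence "(\<Sum>i=1..d. (x i - y i)\<^sup>2) \<le> real d * r\<^sup>2"
      using sum_bounded_above[of "{1..d}" "\<lambda>i. (x i - y i)\<^sup>2" "r\<^sup>2"] by simp
    hence "sqrt (\<Sum>i=1..d. (x i - y i)\<^sup>2) \<le> sqrt (real d * r\<^sup>2)" by (rule real_sqrt_le_mono)
    thus ?thesis using r by (simp add: L2_set_def real_sqrt_mult)
  qed
  have "euclidean_diam d (supp d (psiT d l)) \<le> sqrt (real d) * r"
  proof (cases "supp d (psiT d l) = {}")
    case True
    thus ?thesis using r by (simp add: euclidean_diam_def)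
  next
    case False
    have "(SUP (x, y)\<in>supp d (psiT d l) \<times> supp d (psiT d l). L2_set (\<lambda>i. x i - y i) {1..d}) \<le> sqrt (real d) * r"
      using False sub bound by (intro cSUP_least) auto
    thus ?thesis using False by (simp add: euclidean_diam_def)
  qed
  thus ?thesis by (simp add: r_def ac_simps)
qed

end

theorem theorem11:
  fixes \<phi> \<psi> \<psi>L \<psi>R :: "nat \<Rightarrow> real \<Rightarrow> real"
  assumes "spline_wavelet_construction \<phi> \<psi> \<psi>L \<psi>R"
  shows "(\<forall>d\<ge>1. \<forall>l\<in>tensor_index d.
            tensor_cubic_spline d (psi_tensor \<phi> \<psi> \<psi>L \<psi>R d l) \<and>
            C1_on_cube d (psi_tensor \<phi> \<psi> \<psi>L \<psi>R d l)) \<and>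
         (\<forall>d\<ge>1. orthogonal_basis (cube_measure d) (tensor_index d) (psi_tensor \<phi> \<psi> \<psi>L \<psi>R d)) \<and>
         (\<forall>d\<ge>1. \<forall>p\<in>polys_deg_less d 4. \<forall>l\<in>tensor_index d.
            (\<forall>i\<in>{1..d}. 3 \<le> snd (l i) \<and> snd (l i) \<le> 6 * 2 ^ fst (l i) - 2) \<longrightarrow>
            l2_inner (cube_measure d) p (psi_tensor \<phi> \<psi> \<psi>L \<psi>R d l) = 0) \<and>
         (\<exists>C. \<forall>d\<ge>1. \<forall>l\<in>tensor_index d.
            euclidean_diam d (supp d (psi_tensor \<phi> \<psi> \<psi>L \<psi>R d l))
              \<le> C * sqrt (real d) * 2 powr (- real (min_level d l)))"
proof -
  interpret spline_interval \<phi> \<psi> \<psi>L \<psi>R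
    using assms unfolding spline_wavelet_construction_def by unfold_locales auto
  show ?thesis
    using psiT_tensor_cubic_spline psiT_C1_on_cube orthogonal_basis_psiT psiT_vanishing_moments psiT_diam by blast
qed

end
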